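(* There exists no proper biharmonic hypersurface with at most two distinct principal curvatures (at each point) in the hyperbolic space $\mathbb{H}^{m+1}$.
   Context: $\mathbb{H}^{m+1}$ is the $(m+1)$-dimensional hyperbolic space of constant sectional curvature $-1$. For a smooth map $\phi:(M,g)\to(N,h)$ between Riemannian manifolds, the tension field is $\tau(\phi)=\operatorname{trace}\nabla d\phi$ and the bitension field is $\tau_2(\phi)=-\Delta\tau(\phi)-\operatorname{trace}R^N(d\phi,\tau(\phi))d\phi$, where $\Delta=-\operatorname{trace}\nabla^2$ is the rough Laplacian on sections of $\phi^{-1}TN$ and $R^N(X,Y)=[\nabla_X,\nabla_Y]-\nabla_{[X,Y]}$. The map $\phi$ is harmonic if $\tau(\phi)=0$, biharmonic if $\tau_2(\phi)=0$, and proper biharmonic if it is biharmonic and not harmonic. A submanifold $M$ of $N$ (with induced metric) is called biharmonic (resp. proper biharmonic) if its inclusion map is biharmonic (resp. proper biharmonic); the inclusion is harmonic exactly when $M$ is minimal. *)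

theory Defs
  imports "HOL-Analysis.Analysis"
begin

section \<open>Smooth maps between Euclidean spaces\<close>

text \<open>The derivative of \<open>f\<close> at \<open>x\<close> in the direction \<open>u\<close>.\<close>

abbreviation dir_deriv ::
    "('a::real_normed_vector \<Rightarrow> 'b::real_normed_vector) \<Rightarrow> 'a \<Rightarrow> 'a \<Rightarrow> 'b" where
  "dir_deriv f x u \<equiv> frechet_derivative f (at x) u"

text \<open>Class \<open>C\<^sup>k\<close> and class \<open>C\<^sup>\<infinity>\<close>; meant for open \<open>S\<close>.\<close>

primrec C_k_on ::
    "nat \<Rightarrow> ('a::euclidean_space \<Rightarrow> 'b::real_normed_vector) \<Rightarrow> 'a set \<Rightarrow> bool" where
  "C_k_on 0 f S \<longleftrightarrow> continuous_on S f"
| "C_k_on (Suc k) f S \<longleftrightarrow>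
     (\<forall>x\<in>S. f differentiable (at x)) \<and> (\<forall>u. C_k_on k (\<lambda>x. dir_deriv f x u) S)"

definition smooth_on ::
    "('a::euclidean_space \<Rightarrow> 'b::real_normed_vector) \<Rightarrow> 'a set \<Rightarrow> bool" where
  "smooth_on f S \<longleftrightarrow> (\<forall>k. C_k_on k f S)"

section \<open>Riemannian geometry in coordinates\<close>

text \<open>
  A metric on an open subset of a Euclidean space assigns to each point \<open>x\<close> an inner
  product \<open>g x\<close>; tangent vectors at \<open>x\<close> are elements of the ambient Euclidean space, and a
  fixed vector doubles as the vector field with constant coordinates.
\<close>

type_synonym 'a metric = "'a \<Rightarrow> 'a \<Rightarrow> 'a \<Rightarrow> real"

text \<open>The vector that is \<open>g x\<close>-dual to the covector \<open>\<alpha>\<close> (index raising).\<close>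

definition sharp :: "'a::euclidean_space metric \<Rightarrow> 'a \<Rightarrow> ('a \<Rightarrow> real) \<Rightarrow> 'a" where
  "sharp g x \<alpha> = (THE w. \<forall>z. g x w z = \<alpha> z)"

text \<open>
  The Levi-Civita derivative \<open>\<nabla>\<^sub>u v\<close> of fields with constant coordinates, given by the Koszul
  formula, in which the bracket terms vanish. Its components are
  \<open>\<Gamma>\<^sup>k\<^sub>i\<^sub>j u\<^sup>i v\<^sup>j\<close>.
\<close>

definition christoffel :: "'a::euclidean_space metric \<Rightarrow> 'a \<Rightarrow> 'a \<Rightarrow> 'a \<Rightarrow> 'a" where
  "christoffel g x u v = sharp g x (\<lambda>z.
     (dir_deriv (\<lambda>y. g y v z) x u + dir_deriv (\<lambda>y. g y u z) x v
        - dir_deriv (\<lambda>y. g y u v) x z) / 2)"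

text \<open>\<open>sharp g x (\<lambda>z. z \<bullet> b\<^sub>i)\<close> has components \<open>g\<^sup>i\<^sup>j\<close>, so this is \<open>g\<^sup>i\<^sup>j B\<^sub>i\<^sub>j\<close>.\<close>

definition metric_trace ::
    "'a::euclidean_space metric \<Rightarrow> 'a \<Rightarrow> ('a \<Rightarrow> 'a \<Rightarrow> 'b::real_vector) \<Rightarrow> 'b" where
  "metric_trace g x B = (\<Sum>b\<in>Basis. B (sharp g x (\<lambda>z. z \<bullet> b)) b)"

definition cov_deriv ::
    "'a::euclidean_space metric \<Rightarrow> 'a \<Rightarrow> ('a \<Rightarrow> 'a) \<Rightarrow> 'a \<Rightarrow> 'a" where
  "cov_deriv h u Y p = dir_deriv Y p u + christoffel h p u (Y p)"

text \<open>
  \<open>R(u,v)w = \<nabla>\<^sub>u\<nabla>\<^sub>v w - \<nabla>\<^sub>v\<nabla>\<^sub>u w\<close>; the term \<open>\<nabla>\<^bsub>[u,v]\<^esub> w\<close> vanishes for constant coordinates.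
\<close>

definition curvature :: "'a::euclidean_space metric \<Rightarrow> 'a \<Rightarrow> 'a \<Rightarrow> 'a \<Rightarrow> 'a \<Rightarrow> 'a" where
  "curvature h p u v w =
     cov_deriv h u (cov_deriv h v (\<lambda>_. w)) p - cov_deriv h v (cov_deriv h u (\<lambda>_. w)) p"

section \<open>Tension and bitension of a map between coordinate domains\<close>

text \<open>The pull-back connection on sections \<open>V\<close> of \<open>f\<^sup>-\<^sup>1TN\<close>.\<close>

definition pullback_cov_deriv ::
    "'n::euclidean_space metric \<Rightarrow> ('m::euclidean_space \<Rightarrow> 'n) \<Rightarrow> 'm \<Rightarrow> ('m \<Rightarrow> 'n) \<Rightarrow> 'm \<Rightarrow> 'n"
  where
  "pullback_cov_deriv h f u V x =
     dir_deriv V x u + christoffel h (f x) (dir_deriv f x u) (V x)"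

text \<open>\<open>(\<nabla>df)(u,v) = \<nabla>\<^sub>u(df(v)) - df(\<nabla>\<^sub>u v)\<close>.\<close>

definition nabla_d ::
    "'m::euclidean_space metric \<Rightarrow> 'n::euclidean_space metric \<Rightarrow> ('m \<Rightarrow> 'n)
      \<Rightarrow> 'm \<Rightarrow> 'm \<Rightarrow> 'm \<Rightarrow> 'n" where
  "nabla_d g h f x u v =
     pullback_cov_deriv h f u (\<lambda>y. dir_deriv f y v) x - dir_deriv f x (christoffel g x u v)"

definition tension ::
    "'m::euclidean_space metric \<Rightarrow> 'n::euclidean_space metric \<Rightarrow> ('m \<Rightarrow> 'n) \<Rightarrow> 'm \<Rightarrow> 'n" where
  "tension g h f x = metric_trace g x (nabla_d g h f x)"

text \<open>\<open>(\<nabla>\<^sup>2V)(u,v) = \<nabla>\<^sub>u\<nabla>\<^sub>v V - \<nabla>\<^bsub>\<nabla>\<^sub>u v\<^esub> V\<close>.\<close>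

definition nabla_sq ::
    "'m::euclidean_space metric \<Rightarrow> 'n::euclidean_space metric \<Rightarrow> ('m \<Rightarrow> 'n)
      \<Rightarrow> ('m \<Rightarrow> 'n) \<Rightarrow> 'm \<Rightarrow> 'm \<Rightarrow> 'm \<Rightarrow> 'n" where
  "nabla_sq g h f V x u v =
     pullback_cov_deriv h f u (pullback_cov_deriv h f v V) x
       - pullback_cov_deriv h f (christoffel g x u v) V x"

definition rough_laplacian ::
    "'m::euclidean_space metric \<Rightarrow> 'n::euclidean_space metric \<Rightarrow> ('m \<Rightarrow> 'n)
      \<Rightarrow> ('m \<Rightarrow> 'n) \<Rightarrow> 'm \<Rightarrow> 'n" where
  "rough_laplacian g h f V x = - metric_trace g x (nabla_sq g h f V x)"

definition bitension ::
    "'m::euclidean_space metric \<Rightarrow> 'n::euclidean_space metric \<Rightarrow> ('m \<Rightarrow> 'n) \<Rightarrow> 'm \<Rightarrow> 'n" where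
  "bitension g h f x =
     - rough_laplacian g h f (tension g h f) x
     - metric_trace g x (\<lambda>u v.
         curvature h (f x) (dir_deriv f x u) (tension g h f x) (dir_deriv f x v))"

section \<open>Smooth manifolds and maps into a coordinate domain\<close>

text \<open>A chart is a pair of its domain and its coordinate map.\<close>

type_synonym ('a, 'm) chart = "'a set \<times> ('a \<Rightarrow> 'm)"

abbreviation chart_inv :: "('a, 'm) chart \<Rightarrow> 'm \<Rightarrow> 'a" where
  "chart_inv c \<equiv> inv_into (fst c) (snd c)"

abbreviation chart_image :: "('a, 'm) chart \<Rightarrow> 'm set" where
  "chart_image c \<equiv> snd c ` fst c"

definition smooth_manifold :: "'a topology \<Rightarrow> ('a, 'm::euclidean_space) chart set \<Rightarrow> bool" where
  "smooth_manifold M \<A> \<longleftrightarrow>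
     Hausdorff_space M \<and> second_countable M \<and>
     (\<Union>c\<in>\<A>. fst c) = topspace M \<and>
     (\<forall>c\<in>\<A>. openin M (fst c) \<and> open (chart_image c) \<and>
        homeomorphic_map (subtopology M (fst c)) (top_of_set (chart_image c)) (snd c)) \<and>
     (\<forall>c\<in>\<A>. \<forall>d\<in>\<A>. smooth_on (snd d \<circ> chart_inv c) (snd c ` (fst c \<inter> fst d)))"

definition immersion ::
    "'a topology \<Rightarrow> ('a, 'm::euclidean_space) chart set \<Rightarrow> 'n::euclidean_space set
      \<Rightarrow> ('a \<Rightarrow> 'n) \<Rightarrow> bool" where
  "immersion M \<A> N \<phi> \<longleftrightarrow>
     \<phi> ` topspace M \<subseteq> N \<and>
     (\<forall>c\<in>\<A>. smooth_on (\<phi> \<circ> chart_inv c) (chart_image c) \<and>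
        (\<forall>x\<in>chart_image c. inj (dir_deriv (\<phi> \<circ> chart_inv c) x)))"

text \<open>
  A hypersurface of \<open>N\<close> is given by its inclusion map \<open>\<phi>\<close>. Only immersivity is required of
  \<open>\<phi>\<close>, so self-intersections are allowed; an embedded hypersurface is the case
  \<open>topspace M \<subseteq> N\<close> with \<open>\<phi>\<close> the identity.
\<close>

definition hypersurface ::
    "'a topology \<Rightarrow> ('a, 'm::euclidean_space) chart set \<Rightarrow> 'n::euclidean_space set
      \<Rightarrow> ('a \<Rightarrow> 'n) \<Rightarrow> bool" where
  "hypersurface M \<A> N \<phi> \<longleftrightarrow>
     DIM('n) = DIM('m) + 1 \<and> smooth_manifold M \<A> \<and> immersion M \<A> N \<phi>"

text \<open>
  A Riemannian metric on a manifold is represented by the family \<open>g\<close> of its coordinate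
  expressions, indexed by the charts. Harmonicity and biharmonicity do not depend on
  coordinates, so they are tested in every chart of the atlas.
\<close>

definition harmonic_map ::
    "('a, 'm::euclidean_space) chart set \<Rightarrow> (('a, 'm) chart \<Rightarrow> 'm metric)
      \<Rightarrow> 'n::euclidean_space metric \<Rightarrow> ('a \<Rightarrow> 'n) \<Rightarrow> bool" where
  "harmonic_map \<A> g h \<phi> \<longleftrightarrow>
     (\<forall>c\<in>\<A>. \<forall>x\<in>chart_image c. tension (g c) h (\<phi> \<circ> chart_inv c) x = 0)"

definition biharmonic_map ::
    "('a, 'm::euclidean_space) chart set \<Rightarrow> (('a, 'm) chart \<Rightarrow> 'm metric)
      \<Rightarrow> 'n::euclidean_space metric \<Rightarrow> ('a \<Rightarrow> 'n) \<Rightarrow> bool" where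
  "biharmonic_map \<A> g h \<phi> \<longleftrightarrow>
     (\<forall>c\<in>\<A>. \<forall>x\<in>chart_image c. bitension (g c) h (\<phi> \<circ> chart_inv c) x = 0)"

definition proper_biharmonic_map ::
    "('a, 'm::euclidean_space) chart set \<Rightarrow> (('a, 'm) chart \<Rightarrow> 'm metric)
      \<Rightarrow> 'n::euclidean_space metric \<Rightarrow> ('a \<Rightarrow> 'n) \<Rightarrow> bool" where
  "proper_biharmonic_map \<A> g h \<phi> \<longleftrightarrow> biharmonic_map \<A> g h \<phi> \<and> \<not> harmonic_map \<A> g h \<phi>"

definition pullback_metric ::
    "'n::euclidean_space metric \<Rightarrow> ('m::euclidean_space \<Rightarrow> 'n) \<Rightarrow> 'm metric" where
  "pullback_metric h f = (\<lambda>x u v. h (f x) (dir_deriv f x u) (dir_deriv f x v))"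

definition induced_metric ::
    "'n::euclidean_space metric \<Rightarrow> ('a \<Rightarrow> 'n) \<Rightarrow> ('a, 'm::euclidean_space) chart \<Rightarrow> 'm metric"
  where
  "induced_metric h \<phi> c = pullback_metric h (\<phi> \<circ> chart_inv c)"

section \<open>Principal curvatures of a hypersurface\<close>

definition unit_normal ::
    "'n::euclidean_space metric \<Rightarrow> ('m::euclidean_space \<Rightarrow> 'n) \<Rightarrow> 'm \<Rightarrow> 'n \<Rightarrow> bool" where
  "unit_normal h f x \<eta> \<longleftrightarrow>
     h (f x) \<eta> \<eta> = 1 \<and> (\<forall>u. h (f x) (dir_deriv f x u) \<eta> = 0)"

text \<open>
  The shape operator \<open>A\<^sub>\<eta>\<close> is determined by \<open>\<langle>A\<^sub>\<eta> u, v\<rangle> = \<langle>B(u,v), \<eta>\<rangle>\<close>, where the second fundamental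
  form \<open>B(u,v)\<close> is the normal component of \<open>\<nabla>\<^sub>u(df(v))\<close>; the tangential component drops out
  of the inner product with \<open>\<eta>\<close>.
\<close>

definition shape_operator ::
    "'n::euclidean_space metric \<Rightarrow> ('m::euclidean_space \<Rightarrow> 'n) \<Rightarrow> 'm \<Rightarrow> 'n \<Rightarrow> 'm \<Rightarrow> 'm" where
  "shape_operator h f x \<eta> u =
     sharp (pullback_metric h f) x
       (\<lambda>v. h (f x) (pullback_cov_deriv h f u (\<lambda>y. dir_deriv f y v) x) \<eta>)"

definition principal_curvatures ::
    "'n::euclidean_space metric \<Rightarrow> ('m::euclidean_space \<Rightarrow> 'n) \<Rightarrow> 'm \<Rightarrow> 'n \<Rightarrow> real set" where
  "principal_curvatures h f x \<eta> = {k. \<exists>u. u \<noteq> 0 \<and> shape_operator h f x \<eta> u = k *\<^sub>R u}"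

text \<open>
  Replacing \<open>\<eta>\<close> by \<open>-\<eta>\<close> changes the sign of all principal curvatures, so no choice of
  orientation matters here.
\<close>

definition at_most_two_principal_curvatures ::
    "('a, 'm::euclidean_space) chart set \<Rightarrow> 'n::euclidean_space metric \<Rightarrow> ('a \<Rightarrow> 'n) \<Rightarrow> bool"
  where
  "at_most_two_principal_curvatures \<A> h \<phi> \<longleftrightarrow>
     (\<forall>c\<in>\<A>. \<forall>x\<in>chart_image c. \<forall>\<eta>. unit_normal h (\<phi> \<circ> chart_inv c) x \<eta> \<longrightarrow>
        finite (principal_curvatures h (\<phi> \<circ> chart_inv c) x \<eta>) \<and>
        card (principal_curvatures h (\<phi> \<circ> chart_inv c) x \<eta>) \<le> 2)"

section \<open>Hyperbolic space\<close>

text \<open>The upper half-space model: \<open>{(x, y). y > 0}\<close> with the metric \<open>(|dx|\<^sup>2 + dy\<^sup>2) / y\<^sup>2\<close>.\<close>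

definition hyp_space :: "('e::euclidean_space \<times> real) set" where
  "hyp_space = {p. snd p > 0}"

definition hyp_metric :: "('e::euclidean_space \<times> real) metric" where
  "hyp_metric p u v = (u \<bullet> v) / (snd p)\<^sup>2"

end

theory Submission
  imports Defs
begin

text \<open>
  Near a point with \<open>\<tau>(\<phi>) \<noteq> 0\<close> the field \<open>\<eta> = \<tau>(\<phi>)/|\<tau>(\<phi>)|\<close> is a unit normal and \<open>\<tau>(\<phi>) = f \<eta>\<close> with
  \<open>f = tr A > 0\<close>. By the Gauss--Weingarten formulas the bitension field vanishes iff
  \<open>A T = -(f/2) T\<close> and \<open>tr \<nabla>T = (m + |A|\<^sup>2) f\<close>, where \<open>T = grad f\<close>.

  If \<open>T\<close> vanishes on an open set, the second equation is violated there. Where \<open>T \<noteq> 0\<close>, the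
  principal curvature \<open>-f/2\<close> is simple by the Codazzi equation, so the trace shows that the other one
  is \<open>3f/(2(m-1))\<close>, and \<open>A\<close> is determined by \<open>f\<close> and \<open>T\<close>. The Codazzi equation then
  expresses \<open>\<nabla>T\<close> through \<open>f\<close> and \<open>|T|\<^sup>2\<close>, and the Gauss equation turns into an algebraic relation
  between \<open>f\<close> and \<open>|T|\<^sup>2\<close>. It has no solution unless \<open>m < 4\<close>, and in that case differentiating it
  along \<open>T\<close> makes \<open>f\<close> locally constant, contradicting \<open>T \<noteq> 0\<close>.
\<close>

section \<open>Calculus of smooth maps\<close>

text \<open>Two obstacles of regularity shape the argument. The hypersurface may be non-orientable,
  so the normal field is taken from the tension field, which also fixes the sign of tr A. And
  principal curvatures and directions of a smooth operator need not be smooth, so no eigenframe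
  occurs: the second curvature is a rational expression in \<open>tr A\<close> and
  \<open>tr A\<^sup>2\<close>, and where T is nonzero both A and \<nabla>T have the form \<alpha> id
  + \<gamma> \<langle>T, .\<rangle> T with smooth coefficients, which can be differentiated
  directly. Hyperbolic space enters only through the Gauss and Codazzi equations and the summand m
  f. Curvature -1 gives the constant terms the same sign as the terms containing f, and the sign
  arguments rest on this. The bound m < 4 is the sign of \<kappa> = 1 + a (2 - m) with a = 3 / (m +
  2), that is \<kappa> = (8 - 2 m) / (m + 2): if \<beta> denotes the eigenvalue of the Hessian
  orthogonal to T, then both \<beta> and \<kappa> \<beta> turn out negative.\<close>

lemma dir_deriv_eqI:
  "(f has_derivative f') (at x) \<Longrightarrow> dir_deriv f x u = f' u"
  using frechet_derivative_at by metis

lemma has_derivative_dir_deriv: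
  "f differentiable (at x) \<Longrightarrow> (f has_derivative dir_deriv f x) (at x)"
  using frechet_derivative_works by blast

text \<open>\<open>frechet_derivative\<close> is a choice from the set of all derivatives, and this
  set depends only on the germ of the map; hence the two sides also agree where no derivative
  exists.\<close>

lemma dir_deriv_cong:
  assumes "open S" "x \<in> S" "\<And>y. y \<in> S \<Longrightarrow> f y = g y"
  shows "dir_deriv f x u = dir_deriv g x u"
proof (cases "f differentiable (at x)")
  case True
  then have "(g has_derivative dir_deriv f x) (at x)"
    using has_derivative_transform_within_open[OF has_derivative_dir_deriv assms(1,2)] assms(3) by blast
  then show ?thesis by (simp add: dir_deriv_eqI)
next
  case False
  have iff: "(f has_derivative D) (at x) \<longleftrightarrow> (g has_derivative D) (at x)" for D
    using has_derivative_transform_within_open[OF _ assms(1,2)] assms(3) by (metis (full_types))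
  show ?thesis unfolding frechet_derivative_def iff ..
qed

lemma differentiable_cong_open:
  assumes "open S" "x \<in> S" "\<And>y. y \<in> S \<Longrightarrow> f y = g y" "f differentiable (at x)"
  shows "g differentiable (at x)"
  using assms unfolding differentiable_def by (metis has_derivative_transform_within_open)

section \<open>Closure properties of the classes \<open>C_k_on\<close>\<close>

lemma C_k_on_cong:
  assumes "open S" "\<And>y. y \<in> S \<Longrightarrow> f y = g y" "C_k_on k f S"
  shows "C_k_on k g S"
  using assms(2,3)
proof (induction k arbitrary: f g)
  case 0
  then show ?case using continuous_on_cong by force
next
  case (Suc k)
  have "g differentiable (at x)" if "x \<in> S" for x
    using differentiable_cong_open[OF assms(1) that, of f g] Suc.prems that by auto
  moreover have "C_k_on k (\<lambda>x. dir_deriv g x u) S" for u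
    by (rule Suc.IH[of "\<lambda>x. dir_deriv f x u"])
      (use Suc.prems dir_deriv_cong[OF assms(1), of _ f g] in auto)
  ultimately show ?case by simp
qed

lemma C_k_on_Suc_imp: "C_k_on (Suc k) f S \<Longrightarrow> C_k_on k f S"
proof (induction k arbitrary: f)
  case 0
  then show ?case
    by (auto intro!: continuous_at_imp_continuous_on differentiable_imp_continuous_within)
next
  case (Suc k)
  then show ?case by (metis C_k_on.simps(2))
qed

lemma C_k_on_subset: "C_k_on k f S \<Longrightarrow> T \<subseteq> S \<Longrightarrow> C_k_on k f T"
  by (induction k arbitrary: f) (auto intro: continuous_on_subset)

lemma C_k_on_const: "C_k_on k (\<lambda>x. c) S"
  by (induction k arbitrary: c) simp_all

text \<open>Admits a derivative given by a formula, so that each differentiation rule can be plugged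
  into an induction on k.\<close>

lemma C_k_on_SucI:
  assumes "open S" "\<And>x. x \<in> S \<Longrightarrow> (f has_derivative f' x) (at x)"
    and "\<And>u. C_k_on k (\<lambda>x. f' x u) S"
  shows "C_k_on (Suc k) f S"
proof -
  have "C_k_on k (\<lambda>x. dir_deriv f x u) S" for u
    by (rule C_k_on_cong[OF assms(1) _ assms(3)[of u]]) (simp add: dir_deriv_eqI[OF assms(2)])
  moreover have "\<forall>x\<in>S. f differentiable (at x)"
    using assms(2) differentiable_def by blast
  ultimately show ?thesis by simp
qed

lemma C_k_on_SucD:
  assumes "C_k_on (Suc k) f S"
  shows "x \<in> S \<Longrightarrow> (f has_derivative dir_deriv f x) (at x)" "C_k_on k (\<lambda>x. dir_deriv f x u) S"
  using assms has_derivative_dir_deriv by auto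

lemma C_k_on_linear:
  assumes L: "bounded_linear L" and "open S" "C_k_on k f S"
  shows "C_k_on k (\<lambda>x. L (f x)) S"
  using assms(3)
proof (induction k arbitrary: f)
  case 0
  then show ?case using bounded_linear.continuous_on[OF L] by auto
next
  case (Suc k)
  note D = C_k_on_SucD[OF Suc.prems]
  show ?case
    by (rule C_k_on_SucI[OF assms(2) bounded_linear.has_derivative[OF L D(1)] Suc.IH[OF D(2)]])
qed

lemma C_k_on_add:
  assumes "open S" "C_k_on k f S" "C_k_on k g S"
  shows "C_k_on k (\<lambda>x. f x + g x) S"
  using assms(2,3)
proof (induction k arbitrary: f g)
  case 0
  then show ?case by (auto intro: continuous_on_add)
next
  case (Suc k)
  note D = C_k_on_SucD[OF Suc.prems(1)] C_k_on_SucD[OF Suc.prems(2)]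
  show ?case
    by (rule C_k_on_SucI[OF assms(1) has_derivative_add[OF D(1,3)] Suc.IH[OF D(2,4)]])
qed

lemma C_k_on_bilinear:
  assumes B: "bounded_bilinear B" and "open S" "C_k_on k f S" "C_k_on k g S"
  shows "C_k_on k (\<lambda>x. B (f x) (g x)) S"
  using assms(3,4)
proof (induction k arbitrary: f g)
  case 0
  then show ?case using bounded_bilinear.continuous_on[OF B] by auto
next
  case (Suc k)
  note D = C_k_on_SucD[OF Suc.prems(1)] C_k_on_SucD[OF Suc.prems(2)]
  show ?case
    by (rule C_k_on_SucI[OF assms(2) bounded_bilinear.FDERIV[OF B D(1,3)]], assumption+)
      (intro C_k_on_add assms(2) Suc.IH D Suc.prems[THEN C_k_on_Suc_imp])
qed

text \<open>The derivative of 1/f is built from 1/f and the derivative of f, so the induction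
  hypothesis for 1/f itself closes the step. The square root works the same way through 1 / sqrt
  f.\<close>

lemma C_k_on_inverse:
  fixes f :: "'a::euclidean_space \<Rightarrow> real"
  assumes "open S" "\<And>x. x \<in> S \<Longrightarrow> f x \<noteq> 0" "C_k_on k f S"
  shows "C_k_on k (\<lambda>x. inverse (f x)) S"
  using assms(3)
proof (induction k)
  case 0
  then show ?case using assms(2) by (auto intro: continuous_on_inverse)
next
  case (Suc k)
  note D = C_k_on_SucD[OF Suc.prems]
  have I: "C_k_on k (\<lambda>x. inverse (f x)) S" by (rule Suc.IH[OF C_k_on_Suc_imp[OF Suc.prems]])
  have E: "C_k_on k (\<lambda>x. - (inverse (f x) * dir_deriv f x u * inverse (f x))) S" for u
    by (intro C_k_on_linear[OF bounded_linear_minus[OF bounded_linear_ident]]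
        C_k_on_bilinear[OF bounded_bilinear_mult] assms(1) I D)
  show ?case
    by (rule C_k_on_SucI[OF assms(1) Deriv.has_derivative_inverse[OF assms(2) D(1)] E], assumption+)
qed

lemma C_k_on_sqrt:
  assumes "open S" "\<And>x. x \<in> S \<Longrightarrow> f x > 0" "C_k_on k f S"
  shows "C_k_on k (\<lambda>x. sqrt (f x)) S"
  using assms(3)
proof (induction k)
  case 0
  then show ?case by (auto intro: continuous_on_real_sqrt)
next
  case (Suc k)
  note D = C_k_on_SucD[OF Suc.prems]
  have I: "C_k_on k (\<lambda>x. inverse (sqrt (f x))) S"
    by (rule C_k_on_inverse[OF assms(1) _ Suc.IH[OF C_k_on_Suc_imp[OF Suc.prems]]])
      (use assms(2) in fastforce)
  have E: "C_k_on k (\<lambda>x. (inverse (sqrt (f x)) * (1/2)) * dir_deriv f x u) S" for u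
    by (intro C_k_on_bilinear[OF bounded_bilinear_mult] assms(1) I D C_k_on_const)
  have d: "((\<lambda>x. sqrt (f x)) has_derivative (\<lambda>u. (inverse (sqrt (f x)) * (1/2)) * dir_deriv f x u)) (at x)"
    if "x \<in> S" for x
    using DERIV_compose_FDERIV[OF DERIV_real_sqrt[OF assms(2)[OF that]] D(1)[OF that]]
    by (simp add: mult.commute mult.left_commute)
  show ?case by (rule C_k_on_SucI[OF assms(1) d E])
qed

section \<open>The class \<open>smooth_on\<close>\<close>

lemma smooth_on_cong:
  "open S \<Longrightarrow> (\<And>y. y \<in> S \<Longrightarrow> f y = g y) \<Longrightarrow> smooth_on f S \<Longrightarrow> smooth_on g S"
  unfolding smooth_on_def using C_k_on_cong by blast

lemma smooth_on_subset: "smooth_on f S \<Longrightarrow> T \<subseteq> S \<Longrightarrow> smooth_on f T"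
  unfolding smooth_on_def using C_k_on_subset by blast

lemma smooth_on_continuous: "smooth_on f S \<Longrightarrow> continuous_on S f"
  unfolding smooth_on_def by (metis C_k_on.simps(1))

lemma smooth_on_differentiable: "smooth_on f S \<Longrightarrow> x \<in> S \<Longrightarrow> f differentiable (at x)"
  unfolding smooth_on_def by (metis C_k_on.simps(2))

lemma smooth_on_has_derivative:
  "smooth_on f S \<Longrightarrow> x \<in> S \<Longrightarrow> (f has_derivative dir_deriv f x) (at x)"
  using smooth_on_differentiable has_derivative_dir_deriv by blast

lemma smooth_on_dir_deriv: "smooth_on f S \<Longrightarrow> smooth_on (\<lambda>x. dir_deriv f x u) S"
  unfolding smooth_on_def by (metis C_k_on.simps(2))

lemma smooth_on_const: "smooth_on (\<lambda>x. c) S"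
  by (simp add: smooth_on_def C_k_on_const)

lemma smooth_on_linear:
  "bounded_linear L \<Longrightarrow> open S \<Longrightarrow> smooth_on f S \<Longrightarrow> smooth_on (\<lambda>x. L (f x)) S"
  by (simp add: smooth_on_def C_k_on_linear)

lemma smooth_on_bilinear:
  "bounded_bilinear B \<Longrightarrow> open S \<Longrightarrow> smooth_on f S \<Longrightarrow> smooth_on g S
    \<Longrightarrow> smooth_on (\<lambda>x. B (f x) (g x)) S"
  by (simp add: smooth_on_def C_k_on_bilinear)

lemma smooth_on_add:
  "open S \<Longrightarrow> smooth_on f S \<Longrightarrow> smooth_on g S \<Longrightarrow> smooth_on (\<lambda>x. f x + g x) S"
  by (simp add: smooth_on_def C_k_on_add)

lemma smooth_on_minus: "open S \<Longrightarrow> smooth_on f S \<Longrightarrow> smooth_on (\<lambda>x. - f x) S"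
  by (rule smooth_on_linear[OF bounded_linear_minus[OF bounded_linear_ident]])

lemma smooth_on_diff:
  "open S \<Longrightarrow> smooth_on f S \<Longrightarrow> smooth_on g S \<Longrightarrow> smooth_on (\<lambda>x. f x - g x) S"
  using smooth_on_add[of S f "\<lambda>x. - g x"] smooth_on_minus by force

lemma smooth_on_inner:
  "open S \<Longrightarrow> smooth_on f S \<Longrightarrow> smooth_on g S \<Longrightarrow> smooth_on (\<lambda>x. f x \<bullet> g x) S"
  by (rule smooth_on_bilinear[OF bounded_bilinear_inner])

lemma smooth_on_scaleR:
  "open S \<Longrightarrow> smooth_on f S \<Longrightarrow> smooth_on g S \<Longrightarrow> smooth_on (\<lambda>x. f x *\<^sub>R g x) S"
  by (rule smooth_on_bilinear[OF bounded_bilinear_scaleR])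

lemma smooth_on_mult:
  fixes f g :: "_ \<Rightarrow> real"
  shows "open S \<Longrightarrow> smooth_on f S \<Longrightarrow> smooth_on g S \<Longrightarrow> smooth_on (\<lambda>x. f x * g x) S"
  by (rule smooth_on_bilinear[OF bounded_bilinear_mult])

lemma smooth_on_inverse:
  fixes f :: "_ \<Rightarrow> real"
  shows "open S \<Longrightarrow> (\<And>x. x \<in> S \<Longrightarrow> f x \<noteq> 0) \<Longrightarrow> smooth_on f S \<Longrightarrow> smooth_on (\<lambda>x. inverse (f x)) S"
  by (simp add: smooth_on_def C_k_on_inverse)

lemma smooth_on_divide:
  fixes f g :: "_ \<Rightarrow> real"
  assumes "open S" "\<And>x. x \<in> S \<Longrightarrow> g x \<noteq> 0" "smooth_on f S" "smooth_on g S"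
  shows "smooth_on (\<lambda>x. f x / g x) S"
  unfolding divide_inverse by (intro smooth_on_mult smooth_on_inverse assms)

lemma smooth_on_power:
  fixes f :: "_ \<Rightarrow> real"
  shows "open S \<Longrightarrow> smooth_on f S \<Longrightarrow> smooth_on (\<lambda>x. f x ^ n) S"
  by (induction n) (auto intro: smooth_on_mult smooth_on_const)

lemma smooth_on_sqrt:
  "open S \<Longrightarrow> (\<And>x. x \<in> S \<Longrightarrow> f x > 0) \<Longrightarrow> smooth_on f S \<Longrightarrow> smooth_on (\<lambda>x. sqrt (f x)) S"
  by (simp add: smooth_on_def C_k_on_sqrt)

lemma smooth_on_sum:
  assumes "open S" "\<And>i. i \<in> I \<Longrightarrow> smooth_on (f i) S"
  shows "smooth_on (\<lambda>x. \<Sum>i\<in>I. f i x) S"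
  using assms(2)
  by (induction I rule: infinite_finite_induct)
    (auto intro: smooth_on_const smooth_on_add[OF assms(1)])

lemma smooth_on_prod:
  fixes f :: "_ \<Rightarrow> _ \<Rightarrow> real"
  assumes "open S" "\<And>i. i \<in> I \<Longrightarrow> smooth_on (f i) S"
  shows "smooth_on (\<lambda>x. \<Prod>i\<in>I. f i x) S"
  using assms(2)
  by (induction I rule: infinite_finite_induct)
    (auto intro: smooth_on_const smooth_on_mult[OF assms(1)])

lemmas smooth_intros = smooth_on_const smooth_on_add smooth_on_minus smooth_on_diff
  smooth_on_inner smooth_on_scaleR smooth_on_mult smooth_on_inverse smooth_on_divide
  smooth_on_power smooth_on_sqrt smooth_on_sum smooth_on_prod smooth_on_dir_deriv

section \<open>Rules for directional derivatives\<close>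

lemma dir_deriv_add:
  assumes "f differentiable (at x)" "g differentiable (at x)"
  shows "dir_deriv (\<lambda>y. f y + g y) x u = dir_deriv f x u + dir_deriv g x u"
  by (rule dir_deriv_eqI) (intro has_derivative_add has_derivative_dir_deriv assms)

lemma dir_deriv_linear:
  assumes "bounded_linear L" "f differentiable (at x)"
  shows "dir_deriv (\<lambda>y. L (f y)) x u = L (dir_deriv f x u)"
  by (rule dir_deriv_eqI) (intro bounded_linear.has_derivative[OF assms(1)] has_derivative_dir_deriv assms)

lemma dir_deriv_bilinear:
  assumes "bounded_bilinear B" "f differentiable (at x)" "g differentiable (at x)"
  shows "dir_deriv (\<lambda>y. B (f y) (g y)) x u = B (f x) (dir_deriv g x u) + B (dir_deriv f x u) (g x)"
  by (rule dir_deriv_eqI)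
    (intro bounded_bilinear.FDERIV[OF assms(1)] has_derivative_dir_deriv assms)

lemmas dir_deriv_scaleR = dir_deriv_bilinear[OF bounded_bilinear_scaleR]
lemmas dir_deriv_mult = dir_deriv_bilinear[OF bounded_bilinear_mult]
lemmas dir_deriv_inner = dir_deriv_bilinear[OF bounded_bilinear_inner]

lemma dir_deriv_minus:
  "f differentiable (at x) \<Longrightarrow> dir_deriv (\<lambda>y. - f y) x u = - dir_deriv f x u"
  by (rule dir_deriv_linear[OF bounded_linear_minus[OF bounded_linear_ident]])

lemma dir_deriv_sum:
  assumes "\<And>i. i \<in> I \<Longrightarrow> f i differentiable (at x)"
  shows "dir_deriv (\<lambda>y. \<Sum>i\<in>I. f i y) x u = (\<Sum>i\<in>I. dir_deriv (f i) x u)"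
  by (rule dir_deriv_eqI) (intro has_derivative_sum has_derivative_dir_deriv assms)

lemma dir_deriv_expand:
  assumes "f differentiable (at x)"
  shows "dir_deriv f x u = (\<Sum>b\<in>Basis. (u \<bullet> b) *\<^sub>R dir_deriv f x b)"
proof -
  have "linear (dir_deriv f x)" by (rule linear_frechet_derivative[OF assms])
  then have "dir_deriv f x (\<Sum>b\<in>Basis. (u \<bullet> b) *\<^sub>R b) = (\<Sum>b\<in>Basis. (u \<bullet> b) *\<^sub>R dir_deriv f x b)"
    by (simp add: linear_sum linear_scale o_def)
  then show ?thesis by (simp add: euclidean_representation)
qed

lemma linear_expand:
  fixes L :: "'a::euclidean_space \<Rightarrow> 'b::real_vector"
  assumes "linear L"
  shows "L v = (\<Sum>b\<in>Basis. (v \<bullet> b) *\<^sub>R L b)"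
proof -
  have "L (\<Sum>b\<in>Basis. (v \<bullet> b) *\<^sub>R b) = (\<Sum>b\<in>Basis. (v \<bullet> b) *\<^sub>R L b)"
    using assms by (simp add: linear_sum linear_scale o_def)
  then show ?thesis by (simp add: euclidean_representation)
qed

text \<open>Operator fields such as A and the Christoffel operator are known to be smooth on
  constant vectors only; expanding the argument in the standard basis extends this to vector fields.
  The next lemma is the matching product rule.\<close>

lemma smooth_on_operator_apply:
  fixes L :: "'a::euclidean_space \<Rightarrow> 'b::euclidean_space \<Rightarrow> 'c::real_normed_vector"
  assumes "open S" "\<And>x. x \<in> S \<Longrightarrow> linear (L x)" "\<And>b. b \<in> Basis \<Longrightarrow> smooth_on (\<lambda>x. L x b) S"
    and "smooth_on V S"
  shows "smooth_on (\<lambda>x. L x (V x)) S"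
proof (rule smooth_on_cong[OF assms(1)])
  show "(\<Sum>b\<in>Basis. (V y \<bullet> b) *\<^sub>R L y b) = L y (V y)" if "y \<in> S" for y
    using linear_expand[OF assms(2)[OF that]] by metis
  show "smooth_on (\<lambda>y. \<Sum>b\<in>Basis. (V y \<bullet> b) *\<^sub>R L y b) S"
    by (intro smooth_intros assms)
qed

lemma dir_deriv_operator_apply:
  fixes L :: "'a::euclidean_space \<Rightarrow> 'b::euclidean_space \<Rightarrow> 'c::real_normed_vector"
  assumes S: "open S" "x \<in> S" and lin: "\<And>x. x \<in> S \<Longrightarrow> linear (L x)"
    and L: "\<And>v. (\<lambda>y. L y v) differentiable (at x)"
    and V: "V differentiable (at x)"
  shows "dir_deriv (\<lambda>y. L y (V y)) x u = dir_deriv (\<lambda>y. L y (V x)) x u + L x (dir_deriv V x u)"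
    and "(\<lambda>y. L y (V y)) differentiable (at x)"
proof -
  have Vb: "(\<lambda>y. V y \<bullet> b) differentiable (at x)" for b
    using V by (simp add: differentiable_inner)
  have eq: "(\<Sum>b\<in>Basis. (W y \<bullet> b) *\<^sub>R L y b) = L y (W y)" if "y \<in> S" for y W
    using linear_expand[OF lin[OF that]] by metis
  have prodD: "dir_deriv (\<lambda>y. (V y \<bullet> b) *\<^sub>R L y b) x u
      = (V x \<bullet> b) *\<^sub>R dir_deriv (\<lambda>y. L y b) x u + (dir_deriv V x u \<bullet> b) *\<^sub>R L x b" for b
    by (simp add: dir_deriv_scaleR[OF Vb L] dir_deriv_linear[OF bounded_linear_inner_left V])
  have prodDc: "dir_deriv (\<lambda>y. (V x \<bullet> b) *\<^sub>R L y b) x u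
      = (V x \<bullet> b) *\<^sub>R dir_deriv (\<lambda>y. L y b) x u" for b
    by (rule dir_deriv_linear[OF bounded_linear_scaleR_right L])
  have d: "(\<lambda>y. (V y \<bullet> b) *\<^sub>R L y b) differentiable (at x)" for b
    by (intro differentiable_scaleR Vb L)
  have dc: "(\<lambda>y. (V x \<bullet> b) *\<^sub>R L y b) differentiable (at x)" for b
    by (intro differentiable_scaleR L differentiable_const)
  have "dir_deriv (\<lambda>y. L y (V y)) x u = dir_deriv (\<lambda>y. \<Sum>b\<in>Basis. (V y \<bullet> b) *\<^sub>R L y b) x u"
    by (rule dir_deriv_cong[OF S]) (simp add: eq)
  also have "\<dots> = (\<Sum>b\<in>Basis. (V x \<bullet> b) *\<^sub>R dir_deriv (\<lambda>y. L y b) x u)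
      + (\<Sum>b\<in>Basis. (dir_deriv V x u \<bullet> b) *\<^sub>R L x b)"
    by (subst dir_deriv_sum) (simp_all add: d prodD sum.distrib)
  also have "(\<Sum>b\<in>Basis. (V x \<bullet> b) *\<^sub>R dir_deriv (\<lambda>y. L y b) x u)
      = dir_deriv (\<lambda>y. \<Sum>b\<in>Basis. (V x \<bullet> b) *\<^sub>R L y b) x u"
    by (subst dir_deriv_sum) (simp_all add: dc prodDc)
  also have "\<dots> = dir_deriv (\<lambda>y. L y (V x)) x u"
    by (rule dir_deriv_cong[OF S]) (simp add: eq[of _ "\<lambda>_. V x"])
  also have "(\<Sum>b\<in>Basis. (dir_deriv V x u \<bullet> b) *\<^sub>R L x b) = L x (dir_deriv V x u)"
    by (rule eq[OF S(2), of "\<lambda>_. dir_deriv V x u"])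
  finally show "dir_deriv (\<lambda>y. L y (V y)) x u = dir_deriv (\<lambda>y. L y (V x)) x u + L x (dir_deriv V x u)" .
  show "(\<lambda>y. L y (V y)) differentiable (at x)"
    by (rule differentiable_cong_open[OF S eq differentiable_sum]) (auto intro: d)
qed

text \<open>The mean value theorem is applied to the increment in direction v as a function of the
  step along u, and once more to the resulting difference of u-derivatives.\<close>

lemma second_difference_mean_value:
  fixes f :: "'a::euclidean_space \<Rightarrow> real"
  assumes f: "smooth_on f S" and s: "s > 0"
    and dom: "\<And>a b. 0 \<le> a \<Longrightarrow> a \<le> s \<Longrightarrow> 0 \<le> b \<Longrightarrow> b \<le> s \<Longrightarrow> x + a *\<^sub>R u + b *\<^sub>R v \<in> S"
  shows "\<exists>a b. 0 < a \<and> a < s \<and> 0 < b \<and> b < s \<and>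
    f (x + s *\<^sub>R u + s *\<^sub>R v) - f (x + s *\<^sub>R u) - f (x + s *\<^sub>R v) + f x
      = s * (s * dir_deriv (\<lambda>y. dir_deriv f y u) (x + a *\<^sub>R u + b *\<^sub>R v) v)"
proof -
  let ?k = "\<lambda>a. f (x + a *\<^sub>R u + s *\<^sub>R v) - f (x + a *\<^sub>R u)"
  have lin: "dir_deriv h y (t *\<^sub>R w) = t * dir_deriv h y w"
    if "smooth_on h S" "y \<in> S" for h :: "'a \<Rightarrow> real" and y w t
    using linear_frechet_derivative[OF smooth_on_differentiable[OF that]] by (simp add: linear_scale)
  have D: "((\<lambda>a. h (z + a *\<^sub>R w)) has_real_derivative dir_deriv h (z + a *\<^sub>R w) w) (at a)"
    if "smooth_on h S" "z + a *\<^sub>R w \<in> S" for h :: "'a \<Rightarrow> real" and z w a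
  proof -
    have "((\<lambda>a. h (z + a *\<^sub>R w)) has_derivative (\<lambda>t. dir_deriv h (z + a *\<^sub>R w) (t *\<^sub>R w))) (at a)"
      by (rule has_derivative_compose[of "\<lambda>a. z + a *\<^sub>R w", OF _ smooth_on_has_derivative[OF that]])
        (auto intro!: derivative_eq_intros)
    then show ?thesis
      by (simp add: has_field_derivative_def lin[OF that] mult.commute[of _ "dir_deriv h (z + a *\<^sub>R w) w"])
  qed
  have dk: "(?k has_real_derivative
      dir_deriv f (x + a *\<^sub>R u + s *\<^sub>R v) u - dir_deriv f (x + a *\<^sub>R u) u) (at a)"
    if "0 \<le> a" "a \<le> s" for a
  proof -
    have 1: "x + s *\<^sub>R v + a *\<^sub>R u \<in> S" using dom[OF that, of s] s by (simp add: algebra_simps)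
    have 2: "x + a *\<^sub>R u \<in> S" using dom[OF that, of 0] s by simp
    have "((\<lambda>a. f (x + s *\<^sub>R v + a *\<^sub>R u) - f (x + a *\<^sub>R u)) has_real_derivative
      dir_deriv f (x + s *\<^sub>R v + a *\<^sub>R u) u - dir_deriv f (x + a *\<^sub>R u) u) (at a)"
      by (intro DERIV_diff D[OF f] 1 2)
    then show ?thesis by (simp add: add.commute add.left_commute)
  qed
  obtain a where a: "0 < a" "a < s" and ka: "?k s - ?k 0
      = (s - 0) * (dir_deriv f (x + a *\<^sub>R u + s *\<^sub>R v) u - dir_deriv f (x + a *\<^sub>R u) u)"
    using MVT2[OF s dk] by auto
  have fu: "smooth_on (\<lambda>y. dir_deriv f y u) S" by (rule smooth_on_dir_deriv[OF f])
  obtain b where b: "0 < b" "b < s" and kb: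
      "dir_deriv f (x + a *\<^sub>R u + s *\<^sub>R v) u - dir_deriv f (x + a *\<^sub>R u + 0 *\<^sub>R v) u
        = (s - 0) * dir_deriv (\<lambda>y. dir_deriv f y u) (x + a *\<^sub>R u + b *\<^sub>R v) v"
    using MVT2[OF s D[OF fu, of "x + a *\<^sub>R u" _ v]] dom a by (metis less_eq_real_def)
  show ?thesis
    using a b ka kb by (intro exI[of _ a] exI[of _ b]) (simp add: algebra_simps)
qed

text \<open>The second difference is symmetric in u and v, so the two mixed derivatives agree at two
  points of an arbitrarily small parallelogram; continuity carries this to x.\<close>

lemma dir_deriv_commute_real:
  fixes f :: "'a::euclidean_space \<Rightarrow> real"
  assumes S: "open S" "x \<in> S" and f: "smooth_on f S"
  shows "dir_deriv (\<lambda>y. dir_deriv f y v) x u = dir_deriv (\<lambda>y. dir_deriv f y u) x v"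
proof (rule ccontr)
  let ?P = "\<lambda>y. dir_deriv (\<lambda>y. dir_deriv f y v) y u"
  let ?Q = "\<lambda>y. dir_deriv (\<lambda>y. dir_deriv f y u) y v"
  assume neq: "?P x \<noteq> ?Q x"
  define e where "e = \<bar>?P x - ?Q x\<bar> / 2"
  have e: "e > 0" using neq by (simp add: e_def)
  have cont: "isCont ?P x" "isCont ?Q x"
    using smooth_on_continuous[OF smooth_on_dir_deriv[OF smooth_on_dir_deriv[OF f]]]
      continuous_on_eq_continuous_at[OF S(1)] S(2) by blast+
  obtain d1 where d1: "d1 > 0" "\<And>y. dist y x < d1 \<Longrightarrow> dist (?P y) (?P x) < e"
    using cont(1) e unfolding continuous_at_eps_delta by metis
  obtain d2 where d2: "d2 > 0" "\<And>y. dist y x < d2 \<Longrightarrow> dist (?Q y) (?Q x) < e"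
    using cont(2) e unfolding continuous_at_eps_delta by metis
  obtain d3 where d3: "d3 > 0" "ball x d3 \<subseteq> S" using S open_contains_ball by metis
  define r where "r = min d1 (min d2 d3)"
  \<comment> \<open>The summand 1 keeps \<open>n\<close> positive when u and v both vanish.\<close>
  define n where "n = norm u + norm v + 1"
  define s where "s = r / (2 * n)"
  have r: "r > 0" using d1 d2 d3 by (simp add: r_def)
  have n: "n > 0" unfolding n_def by (smt (verit) norm_ge_zero)
  have s: "s > 0" using r n by (simp add: s_def)
  have near: "dist (x + a *\<^sub>R u + b *\<^sub>R v) x < r" if "0 \<le> a" "a \<le> s" "0 \<le> b" "b \<le> s" for a b
  proof -
    have "dist (x + a *\<^sub>R u + b *\<^sub>R v) x = norm (a *\<^sub>R u + b *\<^sub>R v)" by (simp add: dist_norm)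
    also have "\<dots> \<le> a * norm u + b * norm v"
      using that norm_triangle_ineq[of "a *\<^sub>R u" "b *\<^sub>R v"] by simp
    also have "\<dots> \<le> s * norm u + s * norm v" using that by (intro add_mono mult_right_mono) auto
    also have "\<dots> = s * (n - 1)" by (simp add: n_def algebra_simps)
    also have "\<dots> < s * (n * 2)" using s n by (intro mult_strict_left_mono) auto
    also have "\<dots> = r" using n by (simp add: s_def)
    finally show ?thesis .
  qed
  have inS: "x + a *\<^sub>R u + b *\<^sub>R v \<in> S" if "0 \<le> a" "a \<le> s" "0 \<le> b" "b \<le> s" for a b
    using near[OF that] d3(2) by (auto simp: r_def dist_commute)
  have inS': "x + a *\<^sub>R v + b *\<^sub>R u \<in> S" if "0 \<le> a" "a \<le> s" "0 \<le> b" "b \<le> s" for a b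
    using inS[OF that(3,4,1,2)] by (simp add: algebra_simps)
  obtain a b where ab: "0 < a" "a < s" "0 < b" "b < s"
      "f (x + s *\<^sub>R u + s *\<^sub>R v) - f (x + s *\<^sub>R u) - f (x + s *\<^sub>R v) + f x
        = s * (s * ?Q (x + a *\<^sub>R u + b *\<^sub>R v))"
    using second_difference_mean_value[OF f s inS] by blast
  obtain c d where cd: "0 < c" "c < s" "0 < d" "d < s"
      "f (x + s *\<^sub>R v + s *\<^sub>R u) - f (x + s *\<^sub>R v) - f (x + s *\<^sub>R u) + f x
        = s * (s * ?P (x + c *\<^sub>R v + d *\<^sub>R u))"
    using second_difference_mean_value[OF f s inS'] by blast
  have "s * (s * ?Q (x + a *\<^sub>R u + b *\<^sub>R v)) = s * (s * ?P (x + c *\<^sub>R v + d *\<^sub>R u))"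
    using ab(5) cd(5) by (simp add: algebra_simps)
  then have eq: "?Q (x + a *\<^sub>R u + b *\<^sub>R v) = ?P (x + c *\<^sub>R v + d *\<^sub>R u)" using s by simp
  have Q: "dist (?Q (x + a *\<^sub>R u + b *\<^sub>R v)) (?Q x) < e"
    by (rule d2(2)) (use near[of a b] ab in \<open>simp add: r_def\<close>)
  have P: "dist (?P (x + c *\<^sub>R v + d *\<^sub>R u)) (?P x) < e"
    by (rule d1(2)) (use near[of d c] cd in \<open>simp add: r_def algebra_simps\<close>)
  have "dist (?P x) (?Q x) < e + e"
    using dist_triangle3[of "?P x" "?Q x" "?P (x + c *\<^sub>R v + d *\<^sub>R u)"] P Q unfolding eq by linarith
  then show False by (simp add: dist_real_def e_def)
qed

lemma dir_deriv_commute: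
  fixes f :: "'a::euclidean_space \<Rightarrow> 'b::euclidean_space"
  assumes S: "open S" "x \<in> S" and f: "smooth_on f S"
  shows "dir_deriv (\<lambda>y. dir_deriv f y v) x u = dir_deriv (\<lambda>y. dir_deriv f y u) x v"
proof (rule euclidean_eqI)
  fix b :: 'b assume "b \<in> Basis"
  have fb: "smooth_on (\<lambda>y. f y \<bullet> b) S" by (intro smooth_intros S f)
  have 1: "dir_deriv (\<lambda>y. f y \<bullet> b) y w = dir_deriv f y w \<bullet> b" if "y \<in> S" for y w
    by (rule dir_deriv_linear[OF bounded_linear_inner_left smooth_on_differentiable[OF f that]])
  have 2: "dir_deriv (\<lambda>y. dir_deriv f y w) x z \<bullet> b = dir_deriv (\<lambda>y. dir_deriv (\<lambda>y. f y \<bullet> b) y w) x z" for w z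
  proof -
    have "dir_deriv (\<lambda>y. dir_deriv f y w) x z \<bullet> b = dir_deriv (\<lambda>y. dir_deriv f y w \<bullet> b) x z"
      by (rule dir_deriv_linear[OF bounded_linear_inner_left, symmetric])
        (rule smooth_on_differentiable[OF smooth_on_dir_deriv[OF f] S(2)])
    also have "\<dots> = dir_deriv (\<lambda>y. dir_deriv (\<lambda>y. f y \<bullet> b) y w) x z"
      by (rule dir_deriv_cong[OF S]) (simp add: 1)
    finally show ?thesis .
  qed
  show "dir_deriv (\<lambda>y. dir_deriv f y v) x u \<bullet> b = dir_deriv (\<lambda>y. dir_deriv f y u) x v \<bullet> b"
    unfolding 2 by (rule dir_deriv_commute_real[OF S fb])
qed

section \<open>Self-adjoint operators\<close>

text \<open>Written in the standard basis and free of any metric, so that it can be differentiated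
  termwise while the metric varies with the point.\<close>

definition tr :: "('a::euclidean_space \<Rightarrow> 'a) \<Rightarrow> real" where
  "tr L = (\<Sum>b\<in>Basis. L b \<bullet> b)"

lemma tr_add: "tr (\<lambda>v. L v + M v) = tr L + tr M"
  by (simp add: tr_def inner_add_left sum.distrib)

lemma tr_diff: "tr (\<lambda>v. L v - M v) = tr L - tr M"
  by (simp add: tr_def inner_diff_left sum_subtractf)

lemma tr_scaleR: "tr (\<lambda>v. c *\<^sub>R L v) = c * tr L"
  by (simp add: tr_def sum_distrib_left)

lemma tr_ident: "tr (\<lambda>v::'a. v) = DIM('a::euclidean_space)"
  by (simp add: tr_def inner_Basis)

lemma tr_rank_one:
  assumes "linear \<alpha>"
  shows "tr (\<lambda>v. \<alpha> v *\<^sub>R w) = \<alpha> w"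
  using linear_expand[OF assms, of w] by (simp add: tr_def mult.commute)

lemma tr_comp_commute:
  fixes L M :: "'a::euclidean_space \<Rightarrow> 'a"
  assumes "linear L" "linear M"
  shows "tr (\<lambda>v. L (M v)) = tr (\<lambda>v. M (L v))"
proof -
  have 1: "L (M b) \<bullet> b = (\<Sum>c\<in>Basis. (M b \<bullet> c) * (L c \<bullet> b))" for b
    by (subst linear_expand[OF assms(1)]) (simp add: inner_sum_left)
  have 2: "M (L b) \<bullet> b = (\<Sum>c\<in>Basis. (M c \<bullet> b) * (L b \<bullet> c))" for b
    by (subst linear_expand[OF assms(2)]) (simp add: inner_sum_left mult.commute)
  show ?thesis unfolding tr_def 1 2 by (rule sum.swap)
qed

locale inner_form =
  fixes G :: "'a::euclidean_space \<Rightarrow> 'a \<Rightarrow> real"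
  assumes linear_right: "linear (G u)"
    and sym: "G u v = G v u"
    and pos: "u \<noteq> 0 \<Longrightarrow> G u u > 0"
begin

lemma linear_left: "linear (\<lambda>u. G u v)"
proof -
  have "(\<lambda>u. G u v) = G v" by (rule ext) (rule sym)
  then show ?thesis using linear_right by simp
qed

lemmas simps = linear_add[OF linear_left] linear_add[OF linear_right]
  linear_diff[OF linear_left] linear_diff[OF linear_right]
  linear_scale[OF linear_left] linear_scale[OF linear_right]
  linear_neg[OF linear_left] linear_neg[OF linear_right]
  linear_0[OF linear_left] linear_0[OF linear_right]
  linear_sum[OF linear_left] linear_sum[OF linear_right]

lemma eq_0_iff: "G u u = 0 \<longleftrightarrow> u = 0"
  using pos[of u] simps by force

lemma eqI:
  assumes "\<And>z. G u z = G v z"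
  shows "u = v"
proof -
  have "G (u - v) (u - v) = 0" using assms by (simp add: simps)
  then show ?thesis by (simp add: eq_0_iff)
qed

text \<open>\<open>?L\<close> sends w to the coordinates of the covector G w. Definiteness makes it
  injective, hence surjective in finite dimension.\<close>

lemma ex_dual:
  assumes "linear \<alpha>"
  shows "\<exists>w. \<forall>z. G w z = \<alpha> z"
proof -
  let ?L = "\<lambda>w. \<Sum>b\<in>Basis. G w b *\<^sub>R b"
  have L: "linear ?L"
    by (rule linearI) (simp_all add: simps sum.distrib scaleR_add_left scaleR_sum_right)
  have Lb: "?L w \<bullet> b = G w b" if "b \<in> Basis" for w b
    using that by (rule inner_sum_left_Basis)
  have ext: "G w z = \<beta> z" if "\<And>b. b \<in> Basis \<Longrightarrow> G w b = \<beta> b" "linear \<beta>" for w z \<beta>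
    unfolding linear_expand[OF linear_right, of w z] linear_expand[OF that(2), of z]
    by (simp add: that(1))
  have "inj ?L"
  proof (rule linear_injective_0[OF L, THEN iffD2], intro allI impI)
    fix w assume w: "?L w = 0"
    have "G w b = 0" if "b \<in> Basis" for b using Lb[OF that, of w] by (simp only: w inner_zero_left)
    then have "G w w = 0" by (rule ext[OF _ linear_zero])
    then show "w = 0" by (simp only: eq_0_iff)
  qed
  then have "surj ?L" by (simp add: linear_injective_imp_surjective[OF L])
  then obtain w where w: "(\<Sum>b\<in>Basis. \<alpha> b *\<^sub>R b) = ?L w" by (rule surjE)
  have "G w b = \<alpha> b" if "b \<in> Basis" for b
  proof -
    have "(\<Sum>b\<in>Basis. \<alpha> b *\<^sub>R b) \<bullet> b = \<alpha> b" by (rule inner_sum_left_Basis[OF that])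
    then show ?thesis unfolding w Lb[OF that] .
  qed
  then have "G w z = \<alpha> z" for z by (rule ext[where \<beta>=\<alpha>, OF _ assms])
  then show ?thesis by blast
qed

lemma bounded_bilinear: "bounded_bilinear G"
  unfolding bilinear_conv_bounded_bilinear[symmetric] bilinear_def
  by (intro conjI allI linear_left linear_right)

text \<open>A maximiser of the Rayleigh quotient is an eigenvector.\<close>

lemma ex_eigenvector:
  assumes V: "subspace V" "V \<noteq> {0}" and A: "linear A" "\<And>u v. G (A u) v = G u (A v)"
    and inv: "\<And>v. v \<in> V \<Longrightarrow> A v \<in> V"
  shows "\<exists>v\<in>V. v \<noteq> 0 \<and> (\<exists>k. A v = k *\<^sub>R v)"
proof -
  \<comment> \<open>The quotient is homogeneous of degree 0, so maximising over the compact
    Euclidean unit sphere is enough, although G is another inner product.\<close>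
  let ?K = "V \<inter> sphere 0 1"
  let ?q = "\<lambda>v. G (A v) v / G v v"
  obtain w where w: "w \<in> V" "w \<noteq> 0" using V subspace_0 by blast
  then have "(1 / norm w) *\<^sub>R w \<in> ?K" using V(1) by (simp add: subspace_scale)
  then have ne: "?K \<noteq> {}" by blast
  have comp: "compact ?K"
    by (simp add: closed_Int_compact closed_subspace V(1))
  have c1: "continuous_on ?K A" by (rule linear_continuous_on) (simp add: A(1) linear_conv_bounded_linear[symmetric])
  have "continuous_on ?K ?q"
    by (intro continuous_on_divide bounded_bilinear.continuous_on[OF bounded_bilinear] c1 continuous_on_id)
      (auto simp: eq_0_iff)
  from continuous_attains_sup[OF comp ne this]
  obtain v where v: "v \<in> ?K" and max: "\<And>u. u \<in> ?K \<Longrightarrow> ?q u \<le> ?q v" by blast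
  define k where "k = ?q v"
  have v0: "v \<noteq> 0" using v by auto
  have le: "G (A u) u \<le> k * G u u" if "u \<in> V" for u
  proof (cases "u = 0")
    case False
    have "(1 / norm u) *\<^sub>R u \<in> ?K" using False that V(1) by (simp add: subspace_scale)
    from max[OF this] have "?q u \<le> k"
      using False by (simp add: k_def simps linear_scale[OF A(1)])
    then show ?thesis using pos[OF False] by (simp add: divide_simps mult.commute)
  qed (simp add: simps linear_0[OF A(1)])
  have eqv: "G (A v) v = k * G v v" using pos[OF v0] by (simp add: k_def)
  \<comment> \<open>The residual of the eigenvector equation serves as direction of perturbation:
    the first-order change of the quadratic form along z is 2 G z z.\<close>
  define z where "z = k *\<^sub>R v - A v"
  have zV: "z \<in> V" using v inv V(1) by (simp add: z_def subspace_diff subspace_scale)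
  have quad: "0 \<le> 2 * t * G z z + t\<^sup>2 * (k * G z z - G (A z) z)" for t
  proof -
    have *: "G (A (v + t *\<^sub>R z)) (v + t *\<^sub>R z) \<le> k * G (v + t *\<^sub>R z) (v + t *\<^sub>R z)"
      using v zV V(1) by (intro le) (simp add: subspace_add subspace_scale)
    have 1: "G (A (v + t *\<^sub>R z)) (v + t *\<^sub>R z)
        = G (A v) v + 2 * t * G (A v) z + t\<^sup>2 * G (A z) z"
      using A(2)[of z v] sym[of z "A v"]
      by (simp add: linear_add[OF A(1)] linear_scale[OF A(1)] simps power2_eq_square algebra_simps)
    have 2: "G (v + t *\<^sub>R z) (v + t *\<^sub>R z) = G v v + 2 * t * G v z + t\<^sup>2 * G z z"
      using sym[of z v] by (simp add: simps power2_eq_square algebra_simps)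
    have 3: "G z z = k * G v z - G (A v) z"
    proof -
      have "G z z = G (k *\<^sub>R v - A v) z" by (simp only: z_def[symmetric])
      then show ?thesis by (simp add: simps)
    qed
    have "0 \<le> 2 * t * (k * G v z - G (A v) z) + t\<^sup>2 * (k * G z z - G (A z) z)"
      using * unfolding 1 2 eqv by (simp add: algebra_simps)
    then show ?thesis by (simp only: 3[symmetric])
  qed
  have "G z z = 0"
  proof (rule ccontr)
    assume nz: "G z z \<noteq> 0"
    then have p: "G z z > 0" using pos eq_0_iff by blast
    \<comment> \<open>\<open>M\<close> bounds the quadratic coefficient strictly from above, and the
      step -G z z / M makes the linear term outweigh the quadratic one.\<close>
    define M where "M = \<bar>k * G z z - G (A z) z\<bar> + 1"
    define t where "t = G z z / M"
    have M: "M > 0" by (simp add: M_def)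
    have t: "t > 0" using p M by (simp add: t_def)
    have "0 \<le> 2 * (-t) * G z z + (-t)\<^sup>2 * (k * G z z - G (A z) z)" by (rule quad)
    also have "(-t)\<^sup>2 * (k * G z z - G (A z) z) \<le> t\<^sup>2 * M"
      unfolding power2_minus by (rule mult_left_mono) (auto simp: M_def)
    also have "t\<^sup>2 * M = t * G z z" using M by (simp add: t_def power2_eq_square)
    finally have "0 \<le> - (t * G z z)" by simp
    then show False using mult_pos_pos[OF t p] by simp
  qed
  then have "A v = k *\<^sub>R v" by (simp add: eq_0_iff z_def)
  then show ?thesis using v v0 by blast
qed

text \<open>The operator N = (A - k1)(A - k2) is self-adjoint and has an A-invariant range. A
  nonzero range would contain an eigenvector v = N u of A; its eigenvalue is k1 or k2, so N v = 0
  and G v v = G u (N v) = 0. No diagonalisation is involved.\<close>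

lemma two_eigenvalues_quadratic:
  assumes A: "linear A" "\<And>u v. G (A u) v = G u (A v)"
    and fin: "finite {k. \<exists>u. u \<noteq> 0 \<and> A u = k *\<^sub>R u}" "card {k. \<exists>u. u \<noteq> 0 \<and> A u = k *\<^sub>R u} \<le> 2"
    and k1: "w \<noteq> 0" "A w = k1 *\<^sub>R w"
  shows "\<exists>k2. \<forall>v. A (A v) - (k1 + k2) *\<^sub>R A v + (k1 * k2) *\<^sub>R v = 0"
proof -
  let ?E = "{k. \<exists>u. u \<noteq> 0 \<and> A u = k *\<^sub>R u}"
  define E where "E = ?E"
  have finE: "finite E" "card E \<le> 2" using fin by (simp_all add: E_def)
  have k1E: "k1 \<in> E" using k1 unfolding E_def by blast
  have "\<exists>k2. E \<subseteq> {k1, k2}"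
  \<comment> \<open>If k1 is the only eigenvalue, every choice of k2 satisfies the
    inclusion.\<close>
  proof (cases "E = {k1}")
    case False
    then obtain k where k: "k \<in> E" "k \<noteq> k1" using k1E by blast
    have "{k1, k} = E"
      using finE k1E k by (intro card_seteq) auto
    then show ?thesis by blast
  qed blast
  then obtain k2 where k2: "E \<subseteq> {k1, k2}" by blast
  let ?N = "\<lambda>v. A (A v) - (k1 + k2) *\<^sub>R A v + (k1 * k2) *\<^sub>R v"
  note lin = linear_add[OF A(1)] linear_diff[OF A(1)] linear_scale[OF A(1)]
  have N: "linear ?N" by (rule linearI) (simp_all add: lin algebra_simps)
  have Nsym: "G (?N u) v = G u (?N v)" for u v by (simp add: simps A(2))
  have range_N: "range ?N = {0}"
  proof (rule ccontr)
    assume ne: "range ?N \<noteq> {0}"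
    have sub: "subspace (range ?N)" by (rule linear_subspace_image[OF N subspace_UNIV])
    have "A v \<in> range ?N" if vin: "v \<in> range ?N" for v
    proof -
      obtain u where "v = ?N u" using vin by (rule rangeE)
      then have "A v = ?N (A u)" by (simp add: lin)
      then show ?thesis by blast
    qed
    from ex_eigenvector[OF sub ne A this] obtain v k where
      v: "v \<in> range ?N" "v \<noteq> 0" "A v = k *\<^sub>R v" by blast
    then have "k \<in> E" unfolding E_def by blast
    then have "k = k1 \<or> k = k2" using k2 by blast
    then have Nv: "?N v = 0" using v(3) by (auto simp: lin algebra_simps)
    obtain u where u: "v = ?N u" using v(1) by (rule rangeE)
    have "G (?N u) v = 0" unfolding Nsym Nv by (simp add: simps)
    then have "G v v = 0" by (simp only: u[symmetric])
    then show False using v(2) by (simp add: eq_0_iff)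
  qed
  have "?N v = 0" for v using rangeI[of ?N v] unfolding range_N by simp
  then show ?thesis by (intro exI[of _ k2] allI)
qed

end

section \<open>Index raising and metric traces\<close>

lemma sharp_eqI:
  assumes "inner_form (g x)" "\<And>z. g x w z = \<alpha> z"
  shows "sharp g x \<alpha> = w"
  unfolding sharp_def
proof (rule the_equality)
  show "\<forall>z. g x w z = \<alpha> z" using assms(2) by blast
  show "w' = w" if "\<forall>z. g x w' z = \<alpha> z" for w'
    by (rule inner_form.eqI[OF assms(1)]) (simp add: that assms(2))
qed

lemma sharp_eq:
  assumes "inner_form (g x)" "linear \<alpha>"
  shows "g x (sharp g x \<alpha>) z = \<alpha> z"
proof -
  obtain w where w: "\<And>z. g x w z = \<alpha> z" using inner_form.ex_dual[OF assms] by blast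
  have "sharp g x \<alpha> = w" by (rule sharp_eqI[of g x w \<alpha>, OF assms(1) w])
  then show ?thesis by (simp only: w)
qed

lemma sharp_inner:
  assumes "inner_form (g x)"
  shows "g x (sharp g x (\<lambda>z. z \<bullet> b)) z = z \<bullet> b"
  by (rule sharp_eq[of g x "\<lambda>z. z \<bullet> b" z, OF assms]) (rule bounded_linear.linear[OF bounded_linear_inner_left])

text \<open>Self-adjointness moves L away from the raised index, and pairing with
  \<open>sharp g x (\<lambda>z. z \<bullet> b)\<close> reads off the b-coordinate.\<close>

lemma metric_trace_self_adjoint:
  assumes "inner_form (g x)" "\<And>u v. g x (L u) v = g x u (L v)"
  shows "metric_trace g x (\<lambda>u v. g x (L u) v) = tr L"
  unfolding metric_trace_def tr_def assms(2) sharp_inner[of g x, OF assms(1)] ..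

lemma smooth_on_det:
  fixes M :: "'a::euclidean_space \<Rightarrow> real ^ 'n ^ 'n"
  assumes "open S" "\<And>i j. smooth_on (\<lambda>x. M x $ i $ j) S"
  shows "smooth_on (\<lambda>x. det (M x)) S"
  unfolding det_def by (intro smooth_on_sum smooth_on_mult smooth_on_prod smooth_on_const assms)

lemma smooth_on_vec:
  fixes f :: "'n::finite \<Rightarrow> 'a::euclidean_space \<Rightarrow> real"
  assumes "open S" "\<And>i. smooth_on (f i) S"
  shows "smooth_on (\<lambda>x. \<chi> i. f i x) S"
proof -
  have "(\<chi> i. f i x) = (\<Sum>i\<in>UNIV. f i x *\<^sub>R axis i 1)" for x
    by (simp add: vec_eq_iff axis_def if_distrib cong: if_cong)
  then show ?thesis by (simp only:) (intro smooth_intros assms)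
qed

text \<open>Cramer's rule writes the dual vector as a quotient of determinants with smooth entries.
  This is why coordinates live in \<open>real ^ 'n\<close>, where determinants are
  available.\<close>

lemma smooth_on_sharp:
  fixes g :: "(real ^ 'n) metric"
  assumes S: "open S" and G: "\<And>x. x \<in> S \<Longrightarrow> inner_form (g x)"
    and smg: "\<And>u v. smooth_on (\<lambda>x. g x u v) S"
    and lin: "\<And>x. x \<in> S \<Longrightarrow> linear (\<alpha> x)" and sm: "\<And>v. smooth_on (\<lambda>x. \<alpha> x v) S"
  shows "smooth_on (\<lambda>x. sharp g x (\<alpha> x)) S"
proof -
  let ?M = "\<lambda>x. (\<chi> i j. g x (axis j 1) (axis i 1)) :: real^'n^'n"
  let ?C = "\<lambda>x k. (\<chi> i j. if j = k then \<alpha> x (axis i 1) else ?M x $ i $ j) :: real^'n^'n"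
  have mv: "?M x *v w = (\<chi> i. g x w (axis i 1))" if "x \<in> S" for x w
  proof -
    interpret inner_form "g x" by (rule G[OF that])
    have "g x w z = (\<Sum>j\<in>UNIV. g x (axis j 1) z * w $ j)" for z
      by (subst basis_expansion[of w, symmetric]) (simp add: simps scalar_mult_eq_scaleR mult.commute)
    then show ?thesis by (simp add: vec_eq_iff matrix_vector_mult_def)
  qed
  have det: "det (?M x) \<noteq> 0" if "x \<in> S" for x
  proof -
    interpret inner_form "g x" by (rule G[OF that])
    have "w = 0" if w: "?M x *v w = 0" for w
    proof -
      have 0: "g x w (axis i 1) = 0" for i using w mv[OF \<open>x \<in> S\<close>, of w] by (simp add: vec_eq_iff)
      have "g x w z = 0" for z
        by (subst basis_expansion[of z, symmetric]) (simp add: simps scalar_mult_eq_scaleR 0)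
      then show ?thesis using eq_0_iff by blast
    qed
    then have "inj ((*v) (?M x))" by (simp add: linear_injective_0)
    then show ?thesis using invertible_det_nz invertible_left_inverse matrix_left_invertible_injective by blast
  qed
  have eq: "(\<chi> k. det (?C x k) / det (?M x)) = sharp g x (\<alpha> x)" if x: "x \<in> S" for x
  proof -
    have "?M x *v sharp g x (\<alpha> x) = (\<chi> i. \<alpha> x (axis i 1))"
      using mv[OF x] sharp_eq[of g x, OF G[OF x] lin[OF x]] by simp
    from cramer[OF det[OF x], THEN iffD1, OF this] show ?thesis by (simp cong: if_cong)
  qed
  have 1: "smooth_on (\<lambda>x. det (?M x)) S"
    by (rule smooth_on_det[OF S]) (simp add: smg)
  have 2: "smooth_on (\<lambda>x. det (?C x k)) S" for k
  proof (rule smooth_on_det[OF S])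
    show "smooth_on (\<lambda>x. ?C x k $ i $ j) S" for i j
      by (cases "j = k") (simp_all add: smg sm)
  qed
  have 3: "smooth_on (\<lambda>x. \<chi> k. det (?C x k) / det (?M x)) S"
    by (rule smooth_on_vec[OF S], rule smooth_on_divide[OF S det 2 1])
  show ?thesis by (rule smooth_on_cong[OF S eq 3])
qed

context inner_form
begin

text \<open>An orthonormal set of maximal cardinality is a basis.\<close>

lemma ex_orthonormal_basis:
  "\<exists>B. \<forall>v. v = (\<Sum>b\<in>B. G b v *\<^sub>R b)"
proof -
  let ?on = "\<lambda>B. finite B \<and> (\<forall>b\<in>B. \<forall>c\<in>B. G b c = (if b = c then 1 else 0))"
  have bound: "card B \<le> DIM('a)" if B: "?on B" for B
  proof -
    have "independent B"
    proof (rule independent_if_scalars_zero)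
      show "finite B" using B by blast
      fix f b assume f: "(\<Sum>c\<in>B. f c *\<^sub>R c) = 0" and b: "b \<in> B"
      have "G b (\<Sum>c\<in>B. f c *\<^sub>R c) = (\<Sum>c\<in>B. if b = c then f c else 0)"
        unfolding simps by (rule sum.cong) (use B b in auto)
      also have "\<dots> = f b" using B b by simp
      finally show "f b = 0" unfolding f by (simp add: simps)
    qed
    then show ?thesis using independent_bound by blast
  qed
  define on where "on = ?on"
  have "on {}" "\<forall>B. on B \<longrightarrow> card B < Suc (DIM('a))"
    using bound by (auto simp: on_def less_Suc_eq_le)
  from ex_has_greatest_nat[of on, OF this]
  obtain B where "on B" and max: "\<And>C. on C \<Longrightarrow> card C \<le> card B" by blast
  then have B: "?on B" by (simp add: on_def)
  have "v = (\<Sum>b\<in>B. G b v *\<^sub>R b)" for v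
  proof (rule ccontr)
    assume neq: "v \<noteq> (\<Sum>b\<in>B. G b v *\<^sub>R b)"
    define w where "w = v - (\<Sum>b\<in>B. G b v *\<^sub>R b)"
    have "w \<noteq> 0" using neq by (simp add: w_def)
    then have p: "G w w > 0" by (rule pos)
    have orth: "G c w = 0" if c: "c \<in> B" for c
    proof -
      have "G c (\<Sum>b\<in>B. G b v *\<^sub>R b) = (\<Sum>b\<in>B. if c = b then G b v else 0)"
        unfolding simps by (rule sum.cong) (use B c in auto)
      also have "\<dots> = G c v" using B c by simp
      finally show ?thesis by (simp only: w_def simps diff_self)
    qed
    define e where "e = (1 / sqrt (G w w)) *\<^sub>R w"
    have ee: "G e e = 1" using p by (simp add: e_def simps field_simps)
    have ec: "G c e = 0" "G e c = 0" if "c \<in> B" for c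
      using orth[OF that] sym[of e c] by (simp_all add: e_def simps)
    have "e \<notin> B" using ee ec by force
    then have "card (insert e B) = Suc (card B)" using B by simp
    moreover have "?on (insert e B)" using B ee ec \<open>e \<notin> B\<close> by auto
    ultimately show False using max[of "insert e B"] by (simp add: on_def)
  qed
  then show ?thesis by blast
qed

text \<open>A is self-adjoint for G and not for the standard inner product, so the standard trace
  has to be rewritten in a G-orthonormal basis, where it becomes a sum of the squares G (A b) (A
  b).\<close>

lemma tr_square_nonneg:
  assumes "linear A" "\<And>u v. G (A u) v = G u (A v)"
  shows "tr (\<lambda>v. A (A v)) \<ge> 0"
proof -
  obtain B where B: "\<And>v. v = (\<Sum>b\<in>B. G b v *\<^sub>R b)" using ex_orthonormal_basis by blast
  have AA: "A (A v) = (\<Sum>b\<in>B. G b v *\<^sub>R A (A b))" for v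
    by (subst (1) B) (simp add: linear_sum[OF assms(1)] linear_scale[OF assms(1)])
  have "tr (\<lambda>v. A (A v)) = tr (\<lambda>v. \<Sum>b\<in>B. G b v *\<^sub>R A (A b))"
    by (rule arg_cong[of _ _ tr]) (intro ext AA)
  also have "\<dots> = (\<Sum>b\<in>B. tr (\<lambda>v. G b v *\<^sub>R A (A b)))"
    unfolding tr_def inner_sum_left by (rule sum.swap)
  also have "\<dots> = (\<Sum>b\<in>B. G (A b) (A b))"
    by (simp add: tr_rank_one[OF linear_right] assms(2))
  also have "\<dots> \<ge> 0"
    by (rule sum_nonneg) (metis eq_0_iff less_eq_real_def pos)
  finally show ?thesis .
qed

end

lemma linear_dir_deriv_param:
  fixes L :: "'a::euclidean_space \<Rightarrow> 'b::real_vector \<Rightarrow> 'c::real_normed_vector"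
  assumes S: "open S" "x \<in> S" and lin: "\<And>y. y \<in> S \<Longrightarrow> linear (L y)"
    and diff: "\<And>z. (\<lambda>y. L y z) differentiable (at x)"
  shows "linear (\<lambda>z. dir_deriv (\<lambda>y. L y z) x u)"
proof (rule linearI)
  fix z w and r :: real
  have "dir_deriv (\<lambda>y. L y (z + w)) x u = dir_deriv (\<lambda>y. L y z + L y w) x u"
    by (rule dir_deriv_cong[OF S]) (simp add: linear_add[OF lin])
  then show "dir_deriv (\<lambda>y. L y (z + w)) x u = dir_deriv (\<lambda>y. L y z) x u + dir_deriv (\<lambda>y. L y w) x u"
    by (simp only: dir_deriv_add[OF diff diff])
  have "dir_deriv (\<lambda>y. L y (r *\<^sub>R z)) x u = dir_deriv (\<lambda>y. r *\<^sub>R L y z) x u"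
    by (rule dir_deriv_cong[OF S]) (simp add: linear_scale[OF lin])
  then show "dir_deriv (\<lambda>y. L y (r *\<^sub>R z)) x u = r *\<^sub>R dir_deriv (\<lambda>y. L y z) x u"
    by (simp only: dir_deriv_linear[OF bounded_linear_scaleR_right diff])
qed

section \<open>The Levi-Civita connection of a coordinate domain\<close>

locale riemannian_domain =
  fixes S :: "(real ^ 'm) set" and g :: "(real ^ 'm) metric"
  assumes open_S: "open S"
    and form: "x \<in> S \<Longrightarrow> inner_form (g x)"
    and smooth_g: "smooth_on (\<lambda>x. g x u v) S"
begin

lemma diff_g: "x \<in> S \<Longrightarrow> (\<lambda>y. g y u v) differentiable (at x)"
  by (rule smooth_on_differentiable[OF smooth_g])

lemma g_sym: "x \<in> S \<Longrightarrow> g x u v = g x v u"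
  using inner_form.sym[OF form] .

lemma linear_dg:
  assumes x: "x \<in> S"
  shows "linear (\<lambda>z. dir_deriv (\<lambda>y. g y v z) x u)" "linear (\<lambda>z. dir_deriv (\<lambda>y. g y z v) x u)"
  by (rule linear_dir_deriv_param[OF open_S x], rule inner_form.linear_right[OF form], assumption,
      rule diff_g[OF x])
    (rule linear_dir_deriv_param[OF open_S x], rule inner_form.linear_left[OF form], assumption,
      rule diff_g[OF x])

lemma dg_sym: "x \<in> S \<Longrightarrow> dir_deriv (\<lambda>y. g y u v) x w = dir_deriv (\<lambda>y. g y v u) x w"
  by (rule dir_deriv_cong[OF open_S]) (auto intro: g_sym)

lemma linear_koszul:
  assumes x: "x \<in> S"
  shows "linear (\<lambda>z. (dir_deriv (\<lambda>y. g y v z) x u + dir_deriv (\<lambda>y. g y u z) x v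
        - dir_deriv (\<lambda>y. g y u v) x z) / 2)"
proof -
  have l: "linear (dir_deriv (\<lambda>y. g y u v) x)" by (rule linear_frechet_derivative[OF diff_g[OF x]])
  show ?thesis
    by (rule linearI)
      (simp_all add: linear_add[OF linear_dg(1)[OF x]] linear_scale[OF linear_dg(1)[OF x]]
        linear_add[OF l] linear_scale[OF l] field_simps)
qed

lemma koszul:
  assumes x: "x \<in> S"
  shows "g x (christoffel g x u v) z
    = (dir_deriv (\<lambda>y. g y v z) x u + dir_deriv (\<lambda>y. g y u z) x v - dir_deriv (\<lambda>y. g y u v) x z) / 2"
  unfolding christoffel_def
  by (rule sharp_eq[of g x "\<lambda>z. (dir_deriv (\<lambda>y. g y v z) x u + dir_deriv (\<lambda>y. g y u z) x v
        - dir_deriv (\<lambda>y. g y u v) x z) / 2", OF form[OF x] linear_koszul[OF x]])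

lemma christoffel_sym:
  assumes x: "x \<in> S"
  shows "christoffel g x u v = christoffel g x v u"
  by (rule inner_form.eqI[OF form[OF x]]) (simp add: koszul[OF x] dg_sym[OF x, of v u])

lemma christoffel_compat:
  assumes x: "x \<in> S"
  shows "dir_deriv (\<lambda>y. g y u v) x w = g x (christoffel g x w u) v + g x u (christoffel g x w v)"
  unfolding g_sym[OF x, of u] koszul[OF x]
  using dg_sym[OF x, of u v w] dg_sym[OF x, of w v u] dg_sym[OF x, of w u v] by (simp add: field_simps)

lemma linear_christoffel_right: 
  assumes x: "x \<in> S"
  shows "linear (christoffel g x u)"
proof (rule linearI)
  interpret inner_form "g x" by (rule form[OF x])
  have l: "linear (dir_deriv (\<lambda>y. g y u v) x)" for u v by (rule linear_frechet_derivative[OF diff_g[OF x]])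
  show "christoffel g x u (v + w) = christoffel g x u v + christoffel g x u w" for v w
    by (rule eqI) (simp add: simps koszul[OF x] linear_add[OF linear_dg(1)[OF x]]
        linear_add[OF linear_dg(2)[OF x]] linear_add[OF l] field_simps)
  show "christoffel g x u (r *\<^sub>R v) = r *\<^sub>R christoffel g x u v" for r v
    by (rule eqI) (simp add: simps koszul[OF x] linear_scale[OF linear_dg(1)[OF x]]
        linear_scale[OF linear_dg(2)[OF x]] linear_scale[OF l] field_simps)
qed

lemma linear_christoffel_left: "x \<in> S \<Longrightarrow> linear (\<lambda>u. christoffel g x u v)"
  using linear_christoffel_right by (simp only: christoffel_sym[of x _ v])

lemma smooth_christoffel: "smooth_on (\<lambda>x. christoffel g x u v) S"
  unfolding christoffel_def
proof (rule smooth_on_sharp[OF open_S form smooth_g linear_koszul])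
  show "smooth_on (\<lambda>x. (dir_deriv (\<lambda>y. g y v z) x u + dir_deriv (\<lambda>y. g y u z) x v
        - dir_deriv (\<lambda>y. g y u v) x z) / 2) S" for z
    by (intro smooth_on_divide smooth_on_diff smooth_on_add smooth_on_dir_deriv smooth_g
        smooth_on_const open_S) simp
qed

text \<open>The product rule for operator fields is applied to the two slots one after the other;
  what remains is compatibility on constant vectors.\<close>

lemma dir_deriv_g:
  assumes x: "x \<in> S" and V: "V differentiable (at x)" and W: "W differentiable (at x)"
  shows "dir_deriv (\<lambda>y. g y (V y) (W y)) x u
    = g x (cov_deriv g u V x) (W x) + g x (V x) (cov_deriv g u W x)"
proof -
  interpret inner_form "g x" by (rule form[OF x])
  note lr = inner_form.linear_right[OF form] and ll = inner_form.linear_left[OF form]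
  have d1: "(\<lambda>y. g y (V y) w) differentiable (at x)" for w
    by (rule dir_deriv_operator_apply(2)[OF open_S x _ _ V, where L="\<lambda>y v. g y v w"])
      (auto intro: ll diff_g[OF x])
  have d2: "(\<lambda>y. g y v (W y)) differentiable (at x)" for v
    by (rule dir_deriv_operator_apply(2)[OF open_S x _ _ W, where L="\<lambda>y w. g y v w"])
      (auto intro: lr diff_g[OF x])
  have "dir_deriv (\<lambda>y. g y (V y) (W y)) x u
      = dir_deriv (\<lambda>y. g y (V y) (W x)) x u + g x (V x) (dir_deriv W x u)"
    by (rule dir_deriv_operator_apply(1)[OF open_S x _ _ W, where L="\<lambda>y w. g y (V y) w"])
      (auto intro: lr d1)
  also have "dir_deriv (\<lambda>y. g y (V y) (W x)) x u
      = dir_deriv (\<lambda>y. g y (V x) (W x)) x u + g x (dir_deriv V x u) (W x)"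
    by (rule dir_deriv_operator_apply(1)[OF open_S x _ _ V, where L="\<lambda>y v. g y v (W x)"])
      (auto intro: ll diff_g[OF x])
  finally show ?thesis by (simp add: christoffel_compat[OF x] cov_deriv_def simps)
qed

lemma smooth_g_apply:
  assumes "smooth_on V S" "smooth_on W S"
  shows "smooth_on (\<lambda>y. g y (V y) (W y)) S"
proof (rule smooth_on_operator_apply[OF open_S, where L="\<lambda>y w. g y (V y) w"])
  show "smooth_on (\<lambda>y. g y (V y) b) S" for b
    by (rule smooth_on_operator_apply[OF open_S, where L="\<lambda>y v. g y v b"])
      (auto intro: inner_form.linear_left[OF form] smooth_g assms)
qed (auto intro: inner_form.linear_right[OF form] assms)

lemma smooth_cov_deriv:
  assumes "smooth_on V S"
  shows "smooth_on (cov_deriv g u V) S"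
  unfolding cov_deriv_def
  by (rule smooth_on_add[OF open_S smooth_on_dir_deriv[OF assms]],
      rule smooth_on_operator_apply[OF open_S, where L="\<lambda>x. christoffel g x u"])
    (auto intro: assms smooth_christoffel linear_christoffel_right)

lemma cov_deriv_const: "x \<in> S \<Longrightarrow> cov_deriv g u (\<lambda>_. v) x = christoffel g x u v"
  by (simp add: cov_deriv_def)

lemma cov_deriv_cong:
  "open U \<Longrightarrow> x \<in> U \<Longrightarrow> (\<And>y. y \<in> U \<Longrightarrow> V y = W y) \<Longrightarrow> cov_deriv g u V x = cov_deriv g u W x"
  using dir_deriv_cong[of U x V W] by (simp add: cov_deriv_def)

lemma linear_cov_deriv:
  assumes x: "x \<in> S" and V: "V differentiable (at x)"
  shows "linear (\<lambda>u. cov_deriv g u V x)"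
  unfolding cov_deriv_def
  by (rule linear_compose_add[OF linear_frechet_derivative[OF V] linear_christoffel_left[OF x]])

text \<open>The common shape of \<open>A v\<close> and \<open>\<nabla>\<^sub>v T\<close> on the set where the gradient \<open>T\<close> does not vanish.\<close>

lemma cov_deriv_two_terms:
  assumes x: "x \<in> S" and f: "f differentiable (at x)" and h: "h differentiable (at x)"
    and T: "T differentiable (at x)"
  shows "cov_deriv g u (\<lambda>y. f y *\<^sub>R v + h y *\<^sub>R T y) x
    = dir_deriv f x u *\<^sub>R v + f x *\<^sub>R christoffel g x u v
      + dir_deriv h x u *\<^sub>R T x + h x *\<^sub>R cov_deriv g u T x"
proof -
  note l = linear_christoffel_right[OF x]
  have "dir_deriv (\<lambda>y. f y *\<^sub>R v + h y *\<^sub>R T y) x u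
      = dir_deriv (\<lambda>y. f y *\<^sub>R v) x u + dir_deriv (\<lambda>y. h y *\<^sub>R T y) x u"
    by (intro dir_deriv_add differentiable_scaleR f h T differentiable_const)
  also have "dir_deriv (\<lambda>y. f y *\<^sub>R v) x u = dir_deriv f x u *\<^sub>R v"
    by (rule dir_deriv_linear[OF bounded_linear_scaleR_left f])
  also have "dir_deriv (\<lambda>y. h y *\<^sub>R T y) x u = h x *\<^sub>R dir_deriv T x u + dir_deriv h x u *\<^sub>R T x"
    by (rule dir_deriv_scaleR[OF h T])
  finally show ?thesis
    by (simp add: cov_deriv_def linear_add[OF l] linear_scale[OF l] scaleR_add_right)
qed

definition grad :: "(real ^ 'm \<Rightarrow> real) \<Rightarrow> real ^ 'm \<Rightarrow> real ^ 'm" where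
  "grad f x = sharp g x (dir_deriv f x)"

lemma g_grad:
  assumes "x \<in> S" "f differentiable (at x)"
  shows "g x (grad f x) v = dir_deriv f x v"
  unfolding grad_def
  by (rule sharp_eq[of g x "dir_deriv f x", OF form[OF assms(1)] linear_frechet_derivative[OF assms(2)]])

lemma smooth_grad:
  assumes "smooth_on f S"
  shows "smooth_on (grad f) S"
  unfolding grad_def
  by (rule smooth_on_sharp[OF open_S form smooth_g])
    (auto intro: linear_frechet_derivative smooth_on_differentiable[OF assms] smooth_on_dir_deriv[OF assms])

lemma g_hess:
  assumes x: "x \<in> S" and f: "smooth_on f S"
  shows "g x (cov_deriv g u (grad f) x) v
    = dir_deriv (\<lambda>y. dir_deriv f y v) x u - dir_deriv f x (christoffel g x u v)"
proof -
  have "dir_deriv (\<lambda>y. dir_deriv f y v) x u = dir_deriv (\<lambda>y. g y (grad f y) v) x u"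
    by (rule dir_deriv_cong[OF open_S x]) (simp add: g_grad smooth_on_differentiable[OF f])
  also have "\<dots> = g x (cov_deriv g u (grad f) x) v + g x (grad f x) (christoffel g x u v)"
    using dir_deriv_g[OF x smooth_on_differentiable[OF smooth_grad[OF f] x] differentiable_const]
    by (simp add: cov_deriv_const[OF x])
  finally show ?thesis by (simp add: g_grad[OF x smooth_on_differentiable[OF f x]])
qed

text \<open>Combines the symmetry of the Christoffel operator (no torsion) with that of second
  derivatives.\<close>

lemma hess_sym:
  assumes x: "x \<in> S" and f: "smooth_on f S"
  shows "g x (cov_deriv g u (grad f) x) v = g x u (cov_deriv g v (grad f) x)"
  unfolding g_sym[OF x, of u] g_hess[OF x f] christoffel_sym[OF x, of u v]
  using dir_deriv_commute[OF open_S x f] by simp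

end

section \<open>Biharmonic shape operators\<close>

text \<open>Keeps only the intrinsic data of a hypersurface, without the immersion. In
  \<open>gauss\<close> the directions u and v are constant, so no bracket term occurs; the first two
  terms come from the shape operator, the last two from the ambient curvature -1.\<close>

locale hyperbolic_shape_operator = riemannian_domain S g
  for S :: "(real ^ 'm) set" and g :: "(real ^ 'm) metric" +
  fixes A :: "real ^ 'm \<Rightarrow> real ^ 'm \<Rightarrow> real ^ 'm"
  assumes lin_A: "x \<in> S \<Longrightarrow> linear (A x)"
    and A_self_adjoint: "x \<in> S \<Longrightarrow> g x (A x u) v = g x u (A x v)"
    and smooth_A: "smooth_on (\<lambda>x. A x u) S"
    and codazzi: "x \<in> S \<Longrightarrow> cov_deriv g u (\<lambda>y. A y v) x = cov_deriv g v (\<lambda>y. A y u) x"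
    and gauss: "x \<in> S \<Longrightarrow> smooth_on V S \<Longrightarrow>
      cov_deriv g u (cov_deriv g v V) x - cov_deriv g v (cov_deriv g u V) x
        = g x (A x v) (V x) *\<^sub>R A x u - g x (A x u) (V x) *\<^sub>R A x v
          - g x v (V x) *\<^sub>R u + g x u (V x) *\<^sub>R v"
begin

definition mean :: "real ^ 'm \<Rightarrow> real" where
  "mean x = tr (A x)"

definition sq_norm_A :: "real ^ 'm \<Rightarrow> real" where
  "sq_norm_A x = tr (\<lambda>v. A x (A x v))"

lemma smooth_mean: "smooth_on mean S"
  unfolding mean_def tr_def
  by (intro smooth_on_sum smooth_on_inner smooth_A smooth_on_const open_S)

lemma smooth_sq_norm_A: "smooth_on sq_norm_A S"
  unfolding sq_norm_A_def tr_def
  by (rule smooth_on_sum[OF open_S], rule smooth_on_inner[OF open_S _ smooth_on_const],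
      rule smooth_on_operator_apply[OF open_S, where L=A])
    (auto intro: lin_A smooth_A)

lemma sq_norm_A_nonneg: "x \<in> S \<Longrightarrow> sq_norm_A x \<ge> 0"
  unfolding sq_norm_A_def
  by (rule inner_form.tr_square_nonneg[OF form]) (auto intro: lin_A A_self_adjoint)

abbreviation T :: "real ^ 'm \<Rightarrow> real ^ 'm" where
  "T \<equiv> grad mean"

lemma g_T: "x \<in> S \<Longrightarrow> g x (T x) v = dir_deriv mean x v"
  by (rule g_grad[OF _ smooth_on_differentiable[OF smooth_mean]])

lemma smooth_T: "smooth_on T S"
  by (rule smooth_grad[OF smooth_mean])

text \<open>The trace of the Codazzi equation, with the commutator of \<open>A\<close> and the Christoffel
  operator \<open>\<Gamma>(w,\<cdot>)\<close> dropping out.\<close>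

lemma divergence_A:
  assumes x: "x \<in> S"
  defines "E \<equiv> \<lambda>b. sharp g x (\<lambda>z. z \<bullet> b)"
  shows "(\<Sum>b\<in>Basis. cov_deriv g (E b) (\<lambda>y. A y b) x - A x (christoffel g x (E b) b)) = T x"
proof (rule inner_form.eqI[OF form[OF x]])
  fix w
  interpret inner_form "g x" by (rule form[OF x])
  \<comment> \<open>\<open>?D u v\<close> is the tensor \<open>(\<nabla>\<^sub>u A) v\<close>. The
    Codazzi equation makes it symmetric in u and v, and self-adjointness of A makes
    \<open>\<nabla>\<^sub>u A\<close> self-adjoint; together they allow w to change places with the
    contracted index.\<close>
  let ?D = "\<lambda>u v. cov_deriv g u (\<lambda>y. A y v) x - A x (christoffel g x u v)"
  have dA: "(\<lambda>y. A y v) differentiable (at x)" for v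
    by (rule smooth_on_differentiable[OF smooth_A x])
  have Dsym: "?D u v = ?D v u" for u v
    using codazzi[OF x, of u v] christoffel_sym[OF x, of u v] by simp
  have Dadj: "g x (?D u v) z = g x v (?D u z)" for u v z
  proof -
    have "dir_deriv (\<lambda>y. g y (A y v) z) x u = dir_deriv (\<lambda>y. g y v (A y z)) x u"
      by (rule dir_deriv_cong[OF open_S x]) (rule A_self_adjoint)
    then show ?thesis
      unfolding dir_deriv_g[OF x dA differentiable_const] dir_deriv_g[OF x differentiable_const dA]
        cov_deriv_const[OF x]
      by (simp add: simps A_self_adjoint[OF x])
  qed
  have "g x (\<Sum>b\<in>Basis. ?D (E b) b) w = (\<Sum>b\<in>Basis. g x (?D (E b) b) w)"
    by (rule linear_sum[OF linear_left, unfolded o_def])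
  also have "\<dots> = (\<Sum>b\<in>Basis. g x (E b) (?D w b))"
  proof (rule sum.cong[OF refl])
    fix b
    have "g x (?D (E b) b) w = g x b (?D (E b) w)" by (rule Dadj)
    also have "\<dots> = g x b (?D w (E b))" by (simp only: Dsym)
    also have "\<dots> = g x (?D w b) (E b)" by (rule Dadj[symmetric])
    finally show "g x (?D (E b) b) w = g x (E b) (?D w b)" by (simp only: sym)
  qed
  also have "\<dots> = tr (?D w)"
    by (simp add: E_def sharp_inner[of g x, OF form[OF x]] tr_def)
  also have "\<dots> = tr (\<lambda>b. dir_deriv (\<lambda>y. A y b) x w)
      + (tr (\<lambda>b. christoffel g x w (A x b)) - tr (\<lambda>b. A x (christoffel g x w b)))"
    by (simp add: cov_deriv_def tr_diff tr_add)
  also have "tr (\<lambda>b. christoffel g x w (A x b)) = tr (\<lambda>b. A x (christoffel g x w b))"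
    by (rule tr_comp_commute[OF linear_christoffel_right[OF x] lin_A[OF x]])
  also have "tr (\<lambda>b. dir_deriv (\<lambda>y. A y b) x w) = dir_deriv mean x w"
  proof -
    have "dir_deriv mean x w = (\<Sum>b\<in>Basis. dir_deriv (\<lambda>y. A y b \<bullet> b) x w)"
      unfolding mean_def tr_def
      by (rule dir_deriv_sum) (intro differentiable_inner dA differentiable_const)
    then show ?thesis
      by (simp add: tr_def dir_deriv_linear[OF bounded_linear_inner_left dA])
  qed
  finally show "g x (\<Sum>b\<in>Basis. ?D (E b) b) w = g x (T x) w"
    by (simp add: g_T[OF x])
qed

end

locale biharmonic_shape_operator = hyperbolic_shape_operator S g A
  for S :: "(real ^ 'm) set" and g A +
  assumes mean_pos: "x \<in> S \<Longrightarrow> mean x > 0"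
    and A_T: "x \<in> S \<Longrightarrow> A x (T x) = (- mean x / 2) *\<^sub>R T x"
    and tr_hess: "x \<in> S \<Longrightarrow> tr (\<lambda>u. cov_deriv g u T x) = (CARD('m) + sq_norm_A x) * mean x"
    and finite_curvatures: "x \<in> S \<Longrightarrow> finite {k. \<exists>u. u \<noteq> 0 \<and> A x u = k *\<^sub>R u}"
    and card_curvatures: "x \<in> S \<Longrightarrow> card {k. \<exists>u. u \<noteq> 0 \<and> A x u = k *\<^sub>R u} \<le> 2"
begin

section \<open>The set where the gradient of tr A does not vanish, and the second principal
  curvature there\<close>

definition R :: "(real ^ 'm) set" where
  "R = {x \<in> S. T x \<noteq> 0}"

definition t :: "real ^ 'm \<Rightarrow> real" where
  "t x = g x (T x) (T x)"

lemma R_S: "x \<in> R \<Longrightarrow> x \<in> S"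
  by (simp add: R_def)

lemma open_R: "open R"
  unfolding R_def
  using continuous_open_preimage[OF smooth_on_continuous[OF smooth_T] open_S, of "- {0}"]
  by (simp add: vimage_def Int_def open_Compl)

lemma t_pos: "x \<in> R \<Longrightarrow> t x > 0"
  unfolding t_def R_def using inner_form.pos[OF form] by blast

lemma smooth_t: "smooth_on t S"
  unfolding t_def by (rule smooth_g_apply[OF smooth_T smooth_T])

lemma diff_mean: "x \<in> S \<Longrightarrow> mean differentiable (at x)"
  by (rule smooth_on_differentiable[OF smooth_mean])

lemma diff_t: "x \<in> S \<Longrightarrow> t differentiable (at x)"
  by (rule smooth_on_differentiable[OF smooth_t])

lemma diff_T: "x \<in> S \<Longrightarrow> T differentiable (at x)"
  by (rule smooth_on_differentiable[OF smooth_T])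

lemma dir_deriv_mean_T: "x \<in> S \<Longrightarrow> dir_deriv mean x (T x) = t x"
  by (simp add: t_def g_T)

lemma dir_deriv_t: "x \<in> S \<Longrightarrow> dir_deriv t x u = 2 * g x (cov_deriv g u T x) (T x)"
  using dir_deriv_g[OF _ diff_T diff_T] g_sym unfolding t_def by simp

lemma hess_T_sym: "x \<in> S \<Longrightarrow> g x (cov_deriv g u T x) v = g x u (cov_deriv g v T x)"
  by (rule hess_sym[OF _ smooth_mean])

text \<open>The solution k of the trace of (A + f/2)(A - k) = 0, where f = tr A and m is the
  dimension: \<open>|A|\<^sup>2 + f\<^sup>2/2 = k f (1 + m/2)\<close>.\<close>

definition k2 :: "real ^ 'm \<Rightarrow> real" where
  "k2 x = (sq_norm_A x + (mean x)\<^sup>2 / 2) / (mean x * (1 + CARD('m) / 2))"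

text \<open>The second principal curvature, and hence \<open>k2\<close>, is recovered from the traces of \<open>A\<close> and
  \<open>A\<^sup>2\<close>; this makes it smooth.\<close>

lemma A_quadratic:
  assumes x: "x \<in> R"
  shows "A x (A x v) = (k2 x - mean x / 2) *\<^sub>R A x v + (mean x / 2 * k2 x) *\<^sub>R v"
proof -
  have xS: "x \<in> S" and Tx: "T x \<noteq> 0" using x by (auto simp: R_def)
  let ?k = "- mean x / 2"
  obtain k where k: "\<And>v. A x (A x v) - (?k + k) *\<^sub>R A x v + (?k * k) *\<^sub>R v = 0"
    using inner_form.two_eigenvalues_quadratic[OF form[OF xS] lin_A[OF xS] A_self_adjoint[OF xS]
        finite_curvatures[OF xS] card_curvatures[OF xS] Tx A_T[OF xS]] by blast
  have "tr (\<lambda>v. A x (A x v) - (?k + k) *\<^sub>R A x v + (?k * k) *\<^sub>R v) = 0"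
    unfolding k by (simp add: tr_def)
  then have "sq_norm_A x - (?k + k) * mean x + ?k * k * CARD('m) = 0"
    by (simp add: tr_add tr_diff tr_scaleR tr_ident sq_norm_A_def mean_def)
  then have "k * (mean x * (1 + CARD('m) / 2)) = sq_norm_A x + (mean x)\<^sup>2 / 2"
    by (simp add: field_simps power2_eq_square)
  moreover have "mean x * (1 + CARD('m) / 2) > 0" using mean_pos[OF xS] by (simp add: add_pos_nonneg)
  ultimately have "k = k2 x" unfolding k2_def by (auto simp: eq_divide_eq)
  then show ?thesis using k[of v] by (simp add: algebra_simps)
qed

lemma smooth_k2: "smooth_on k2 S"
  unfolding k2_def
proof (intro smooth_on_divide smooth_on_add smooth_on_mult smooth_on_power smooth_mean
    smooth_sq_norm_A smooth_on_const open_S)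
  show "mean x * (1 + CARD('m) / 2) \<noteq> 0" if "x \<in> S" for x
  proof -
    have "1 + CARD('m) / 2 > 0" by (simp add: add_pos_nonneg)
    then show ?thesis using mean_pos[OF that] by simp
  qed
qed simp_all

text \<open>Otherwise the self-adjoint operator A + f/2 has square zero, hence vanishes, and the
  trace gives f = -m f/2, against f > 0.\<close>

lemma k2_neq:
  assumes x: "x \<in> R"
  shows "k2 x \<noteq> - mean x / 2"
proof
  assume eq: "k2 x = - mean x / 2"
  have xS: "x \<in> S" by (rule R_S[OF x])
  interpret inner_form "g x" by (rule form[OF xS])
  have "A x v = (- mean x / 2) *\<^sub>R v" for v
  proof -
    let ?w = "A x v - (- mean x / 2) *\<^sub>R v"
    have "A x ?w = (- mean x / 2) *\<^sub>R ?w"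
      by (simp add: linear_add[OF lin_A[OF xS]] linear_scale[OF lin_A[OF xS]] A_quadratic[OF x] eq
          vec_eq_iff field_simps)
    then have "g x v (A x ?w) = g x v ((- mean x / 2) *\<^sub>R ?w)" by (rule arg_cong)
    then have "g x (A x v) ?w - (- mean x / 2) * g x v ?w = 0"
      unfolding A_self_adjoint[OF xS] simps(6) by simp
    then have "g x ?w ?w = 0" unfolding simps(3) simps(5) real_scaleR_def .
    then show ?thesis unfolding eq_0_iff right_minus_eq .
  qed
  then have "A x = (\<lambda>v. (- mean x / 2) *\<^sub>R v)" by (rule ext)
  then have "tr (A x) = tr (\<lambda>v::real^'m. (- mean x / 2) *\<^sub>R v)" by (rule arg_cong)
  then have "mean x = - mean x / 2 * CARD('m)"
    unfolding tr_scaleR tr_ident mean_def[symmetric] by simp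
  then have "mean x * (1 + CARD('m) / 2) = 0" by (simp add: field_simps)
  moreover have "1 + CARD('m) / 2 > 0" by (simp add: add_pos_nonneg)
  ultimately show False using mean_pos[OF xS] by simp
qed

text \<open>Sandwiching the derivative of \<open>B\<^sup>2 = \<mu> B\<close>, where \<open>B = A - k\<^sub>1\<close>, between kernel vectors of \<open>B\<close>
  gives \<open>\<langle>(\<nabla>\<^sub>w B) p, q\<rangle> = 0\<close>.\<close>

lemma deriv_A_kernel:
  assumes x: "x \<in> R" and p: "A x p = (- mean x / 2) *\<^sub>R p" and q: "A x q = (- mean x / 2) *\<^sub>R q"
  shows "g x (cov_deriv g w (\<lambda>y. A y p) x) q
    = - dir_deriv mean x w / 2 * g x p q - mean x / 2 * g x (christoffel g x w p) q"
proof -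
  have xS: "x \<in> S" by (rule R_S[OF x])
  interpret inner_form "g x" by (rule form[OF xS])
  \<comment> \<open>\<open>V v\<close> is the field B v, and \<open>\<mu>\<close> is the difference
    of the two curvatures, nonzero at x by \<open>k2_neq\<close>.\<close>
  define V where "V v y = A y v + (mean y / 2) *\<^sub>R v" for v y
  define \<mu> where "\<mu> y = k2 y + mean y / 2" for y
  have Vp: "V p x = 0" and Vq: "V q x = 0" using p q by (simp_all add: V_def)
  have dm: "(\<lambda>y. mean y / 2) differentiable (at x)"
    using smooth_on_differentiable[OF smooth_on_divide[OF open_S _ smooth_mean smooth_on_const[of 2]] xS]
    by simp
  have dA: "(\<lambda>y. A y v) differentiable (at x)" for v
    by (rule smooth_on_differentiable[OF smooth_A xS])
  have dV: "V v differentiable (at x)" for v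
    unfolding V_def by (intro differentiable_add dA differentiable_scaleR dm differentiable_const)
  have d\<mu>: "\<mu> differentiable (at x)"
    unfolding \<mu>_def by (intro differentiable_add dm smooth_on_differentiable[OF smooth_k2 xS])
  have dg: "(\<lambda>y. g y (V p y) q) differentiable (at x)"
    by (rule dir_deriv_operator_apply(2)[OF open_S xS _ _ dV, where L="\<lambda>y v. g y v q"])
      (auto intro: inner_form.linear_left[OF form] diff_g[OF xS])
  \<comment> \<open>Both factors B p and B q vanish at x, so the product rule gives 0; rewriting the
    pairing as \<mu> \<langle>B p, q\<rangle> leaves a single derivative of B.\<close>
  have "0 = dir_deriv (\<lambda>y. g y (V p y) (V q y)) x w"
    by (simp add: dir_deriv_g[OF xS dV dV] Vp Vq simps)
  also have "\<dots> = dir_deriv (\<lambda>y. \<mu> y * g y (V p y) q) x w"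
  proof (rule dir_deriv_cong[OF open_R x])
    fix y assume y: "y \<in> R"
    have yS: "y \<in> S" by (rule R_S[OF y])
    interpret y: inner_form "g y" by (rule form[OF yS])
    have "g y (V p y) (V q y) = g y (A y (V p y) + (mean y / 2) *\<^sub>R V p y) q"
      by (simp add: V_def[of q] y.simps A_self_adjoint[OF yS])
    also have "A y (V p y) + (mean y / 2) *\<^sub>R V p y = \<mu> y *\<^sub>R V p y"
      by (simp add: V_def \<mu>_def A_quadratic[OF y] linear_add[OF lin_A[OF yS]]
          linear_scale[OF lin_A[OF yS]] algebra_simps)
    finally show "g y (V p y) (V q y) = \<mu> y * g y (V p y) q" by (simp add: y.simps)
  qed
  also have "\<dots> = \<mu> x * dir_deriv (\<lambda>y. g y (V p y) q) x w + dir_deriv \<mu> x w * g x (V p x) q"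
    by (rule dir_deriv_mult[OF d\<mu> dg])
  also have "\<dots> = \<mu> x * g x (cov_deriv g w (V p) x) q"
    by (simp add: dir_deriv_g[OF xS dV differentiable_const] Vp simps)
  finally have "g x (cov_deriv g w (V p) x) q = 0"
    using k2_neq[OF x] by (simp add: \<mu>_def)
  moreover have "cov_deriv g w (V p) x = cov_deriv g w (\<lambda>y. A y p) x
      + (dir_deriv mean x w / 2) *\<^sub>R p + (mean x / 2) *\<^sub>R christoffel g x w p"
  proof -
    have 1: "dir_deriv (\<lambda>y. (mean y / 2) *\<^sub>R p) x w = (dir_deriv mean x w / 2) *\<^sub>R p"
      using dir_deriv_linear[OF bounded_linear_scaleR_left dm, of p w]
        dir_deriv_linear[OF bounded_linear_divide diff_mean[OF xS], of 2 w] by simp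
    have "dir_deriv (V p) x w = dir_deriv (\<lambda>y. A y p) x w + dir_deriv (\<lambda>y. (mean y / 2) *\<^sub>R p) x w"
      unfolding V_def by (intro dir_deriv_add dA differentiable_scaleR dm differentiable_const)
    then show ?thesis
      by (simp add: cov_deriv_def 1 V_def linear_add[OF linear_christoffel_right[OF xS]]
          linear_scale[OF linear_christoffel_right[OF xS]])
  qed
  ultimately show ?thesis by (simp add: simps)
qed

text \<open>The Codazzi equation exchanges T and v in \<langle>(\<nabla>A), v\<rangle>. By
  \<open>deriv_A_kernel\<close> one side contains the derivative of f along T times \<langle>v,
  v\<rangle>, the other the factor \<langle>T, v\<rangle> = 0, and the Christoffel terms agree by
  symmetry.\<close>

lemma kernel_simple:
  assumes x: "x \<in> R" and v: "A x v = (- mean x / 2) *\<^sub>R v" and orth: "g x (T x) v = 0"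
  shows "v = 0"
proof -
  have xS: "x \<in> S" by (rule R_S[OF x])
  interpret inner_form "g x" by (rule form[OF xS])
  have "g x (cov_deriv g (T x) (\<lambda>y. A y v) x) v = g x (cov_deriv g v (\<lambda>y. A y (T x)) x) v"
    by (simp only: codazzi[OF xS, of "T x"])
  then have "t x * g x v v = 0"
    unfolding deriv_A_kernel[OF x v v] deriv_A_kernel[OF x A_T[OF xS] v]
    using orth by (simp add: christoffel_sym[OF xS, of v] dir_deriv_mean_T[OF xS])
  then show ?thesis using t_pos[OF x] eq_0_iff by simp
qed

text \<open>For w orthogonal to T the vector z = (A - k2) w is annihilated by A + f/2 and again
  orthogonal to T, so it vanishes by \<open>kernel_simple\<close>. Thus A is k2 off the line of T
  and -f/2 on it.\<close>

lemma A_rank_one: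
  assumes x: "x \<in> R"
  shows "A x v = k2 x *\<^sub>R v - ((k2 x + mean x / 2) * g x (T x) v / t x) *\<^sub>R T x"
proof -
  have xS: "x \<in> S" by (rule R_S[OF x])
  interpret inner_form "g x" by (rule form[OF xS])
  note lin = linear_add[OF lin_A[OF xS]] linear_diff[OF lin_A[OF xS]] linear_scale[OF lin_A[OF xS]]
  define s where "s = g x (T x) v / t x"
  define w where "w = v - s *\<^sub>R T x"
  have Tw: "g x (T x) w = 0" using t_pos[OF x] by (simp add: w_def s_def simps t_def)
  define z where "z = A x w - k2 x *\<^sub>R w"
  have "A x z = (- mean x / 2) *\<^sub>R z"
    by (simp add: z_def lin A_quadratic[OF x] algebra_simps)
  moreover have "g x (T x) z = 0"
    by (simp add: z_def simps A_self_adjoint[OF xS, symmetric] A_T[OF xS] Tw)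
  ultimately have "z = 0" by (rule kernel_simple[OF x])
  then have "A x w = k2 x *\<^sub>R w" by (simp add: z_def)
  then have "A x v = k2 x *\<^sub>R v - (k2 x * s) *\<^sub>R T x - (s * (mean x / 2)) *\<^sub>R T x"
    by (simp add: w_def lin A_T[OF xS] algebra_simps)
  then show ?thesis by (simp add: s_def algebra_simps add_divide_distrib)
qed

lemma linear_g_T: "x \<in> S \<Longrightarrow> linear (\<lambda>v. r * g x (T x) v / s)"
  by (rule linearI) (simp_all add: inner_form.simps[OF form] field_simps add_divide_distrib)

lemma k2_mean:
  assumes x: "x \<in> R"
  shows "(real CARD('m) - 1) * k2 x = 3 / 2 * mean x"
proof -
  have "tr (A x) = tr (\<lambda>v. k2 x *\<^sub>R v - ((k2 x + mean x / 2) * g x (T x) v / t x) *\<^sub>R T x)"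
    by (rule arg_cong[of _ _ tr]) (intro ext A_rank_one[OF x])
  also have "\<dots> = k2 x * CARD('m) - (k2 x + mean x / 2) * g x (T x) (T x) / t x"
    by (simp add: tr_diff tr_scaleR tr_ident tr_rank_one[OF linear_g_T[OF R_S[OF x]]])
  also have "\<dots> = k2 x * CARD('m) - (k2 x + mean x / 2)"
    using t_pos[OF x] by (simp add: t_def)
  finally show ?thesis by (simp add: mean_def[symmetric] algebra_simps)
qed

text \<open>In dimension one the left side of \<open>k2_mean\<close> is 0, while tr A > 0.\<close>

lemma dim_ge_2: "x \<in> R \<Longrightarrow> CARD('m) \<ge> 2"
proof -
  assume x: "x \<in> R"
  have "CARD('m) \<noteq> 1" using k2_mean[OF x] mean_pos[OF R_S[OF x]] by auto
  moreover have "CARD('m) > 0" by simp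
  ultimately show ?thesis by linarith
qed

text \<open>Otherwise the identity would be the projection onto the line of T, and its trace 1. The
  factors 1 in the proof only match the shape of \<open>linear_g_T\<close>.\<close>

lemma ex_orthogonal:
  assumes x: "x \<in> R"
  shows "\<exists>u. u \<noteq> 0 \<and> g x (T x) u = 0"
proof (rule ccontr)
  assume none: "\<nexists>u. u \<noteq> 0 \<and> g x (T x) u = 0"
  have xS: "x \<in> S" by (rule R_S[OF x])
  interpret inner_form "g x" by (rule form[OF xS])
  have "v = (1 * g x (T x) v / t x) *\<^sub>R T x" for v
  proof -
    have "g x (T x) (v - (1 * g x (T x) v / t x) *\<^sub>R T x) = 0"
      using t_pos[OF x] by (simp add: simps t_def)
    then have "v - (1 * g x (T x) v / t x) *\<^sub>R T x = 0" using none by blast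
    then show ?thesis by simp
  qed
  then have "(\<lambda>v. v) = (\<lambda>v. (1 * g x (T x) v / t x) *\<^sub>R T x)" by (rule ext)
  then have "tr (\<lambda>v::real^'m. v) = tr (\<lambda>v. (1 * g x (T x) v / t x) *\<^sub>R T x)"
    by (rule arg_cong)
  also have "\<dots> = 1 * g x (T x) (T x) / t x" by (rule tr_rank_one[OF linear_g_T[OF xS]])
  also have "\<dots> = 1" using t_pos[OF x] by (simp add: t_def)
  finally show False using dim_ge_2[OF x] by (simp add: tr_ident)
qed

lemma dir_deriv_ddmean_sym:
  "x \<in> S \<Longrightarrow> dir_deriv (\<lambda>y. dir_deriv mean y v) x u = dir_deriv (\<lambda>y. dir_deriv mean y u) x v"
  by (rule dir_deriv_commute[OF open_S _ smooth_mean])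

lemma R_subset: "R \<subseteq> S"
  by (auto simp: R_def)

text \<open>Serves for both A v and \<open>\<nabla>\<^sub>v T\<close>. The Christoffel term and the
  second derivative of f stay visible because they are symmetric in v and w and so cancel when the
  arguments are exchanged and subtracted.\<close>

lemma cov_deriv_split:
  assumes x: "x \<in> R" and \<alpha>: "smooth_on \<alpha> R" and \<gamma>: "smooth_on \<gamma> R"
    and V: "\<And>y. y \<in> R \<Longrightarrow> V y = \<alpha> y *\<^sub>R v + (\<gamma> y * dir_deriv mean y v) *\<^sub>R T y"
  shows "cov_deriv g w V x = dir_deriv \<alpha> x w *\<^sub>R v + \<alpha> x *\<^sub>R christoffel g x w v
    + (\<gamma> x * dir_deriv (\<lambda>y. dir_deriv mean y v) x w + dir_deriv \<gamma> x w * dir_deriv mean x v) *\<^sub>R T x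
    + (\<gamma> x * dir_deriv mean x v) *\<^sub>R cov_deriv g w T x"
proof -
  have xS: "x \<in> S" by (rule R_S[OF x])
  have d1: "\<alpha> differentiable (at x)" "\<gamma> differentiable (at x)"
    by (rule smooth_on_differentiable[OF \<alpha> x] smooth_on_differentiable[OF \<gamma> x])+
  have d2: "(\<lambda>y. dir_deriv mean y v) differentiable (at x)"
    by (rule smooth_on_differentiable[OF smooth_on_dir_deriv[OF smooth_mean] xS])
  have "cov_deriv g w V x = cov_deriv g w (\<lambda>y. \<alpha> y *\<^sub>R v + (\<gamma> y * dir_deriv mean y v) *\<^sub>R T y) x"
    by (rule cov_deriv_cong[OF open_R x V])
  also have "\<dots> = dir_deriv \<alpha> x w *\<^sub>R v + \<alpha> x *\<^sub>R christoffel g x w v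
      + dir_deriv (\<lambda>y. \<gamma> y * dir_deriv mean y v) x w *\<^sub>R T x
      + (\<gamma> x * dir_deriv mean x v) *\<^sub>R cov_deriv g w T x"
    by (rule cov_deriv_two_terms[OF xS d1(1) differentiable_mult[OF d1(2) d2] diff_T[OF xS]])
  finally show ?thesis by (simp only: dir_deriv_mult[OF d1(2) d2])
qed

text \<open>On \<open>R\<close> the second principal curvature is \<open>c\<close> times the trace of \<open>A\<close>, so that
  \<open>A v = c \<cdot> tr A \<cdot> v - q\<cdot>\<langle>T, v\<rangle> T\<close>.\<close>

context
  fixes c :: real
  assumes c: "(real CARD('m) - 1) * c = 3 / 2"
begin

text \<open>Minus the coefficient of \<langle>T, v\<rangle> T in A v, that is (k2 + f/2) / t with k2
  = c f.\<close>

definition q :: "real ^ 'm \<Rightarrow> real" where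
  "q x = (c + 1 / 2) * mean x / t x"

text \<open>Equal to -c/q; it will be the eigenvalue of the Hessian of f on the orthogonal
  complement of T.\<close>

definition \<beta> :: "real ^ 'm \<Rightarrow> real" where
  "\<beta> x = - (c / (c + 1 / 2)) * t x / mean x"

text \<open>Chosen so that \<beta> id + \<nu> \<langle>T, .\<rangle> T has the trace that
  \<open>tr_hess\<close> prescribes for \<nabla>T.\<close>

definition \<nu> :: "real ^ 'm \<Rightarrow> real" where
  "\<nu> x = ((CARD('m) + sq_norm_A x) * mean x - CARD('m) * \<beta> x) / t x"

lemma k2_c: "x \<in> R \<Longrightarrow> k2 x = c * mean x"
proof -
  assume x: "x \<in> R"
  have eq: "(real CARD('m) - 1) * k2 x = (real CARD('m) - 1) * (c * mean x)"
    unfolding k2_mean[OF x] mult.assoc[symmetric] c ..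
  have "real CARD('m) - 1 \<noteq> 0" using c by auto
  from iffD1[OF mult_cancel_left eq] this show ?thesis by blast
qed

lemma c_pos: "x \<in> R \<Longrightarrow> c > 0"
  using c dim_ge_2[of x] by (smt (verit) mult_nonneg_nonpos of_nat_1 of_nat_le_iff one_le_numeral order_trans zero_less_divide_iff)

text \<open>The sum \<open>f\<^sup>2/4 + (m - 1) c\<^sup>2 f\<^sup>2\<close> of the squared
  curvatures, with (m - 1) c = 3/2; it is obtained by solving the definition of \<open>k2\<close>
  for \<open>sq_norm_A\<close>.\<close>

lemma sq_norm_A_eq:
  assumes x: "x \<in> R"
  shows "sq_norm_A x = (3 * c / 2 + 1 / 4) * (mean x)\<^sup>2"
proof -
  have f: "mean x > 0" by (rule mean_pos[OF R_S[OF x]])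
  have "1 + CARD('m) / 2 > 0" by (simp add: add_pos_nonneg)
  then have "mean x * (1 + CARD('m) / 2) \<noteq> 0" using f by simp
  then have "c * mean x * (mean x * (1 + CARD('m) / 2)) = sq_norm_A x + (mean x)\<^sup>2 / 2"
    unfolding k2_c[OF x, symmetric] k2_def by simp
  moreover have "c * CARD('m) = 3 / 2 + c" using c by (simp add: algebra_simps)
  ultimately show ?thesis by (simp add: power2_eq_square algebra_simps) algebra
qed

lemma smooth_q: "smooth_on q R"
  unfolding q_def
  by (intro smooth_on_divide smooth_on_mult smooth_on_const open_R smooth_on_subset[OF smooth_mean R_subset]
      smooth_on_subset[OF smooth_t R_subset]) (use t_pos in force)

lemma smooth_\<beta>: "smooth_on \<beta> R"
  unfolding \<beta>_def
  by (intro smooth_on_divide smooth_on_mult smooth_on_const open_R smooth_on_subset[OF smooth_mean R_subset]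
      smooth_on_subset[OF smooth_t R_subset]) (use mean_pos R_S in force)

lemma smooth_\<nu>: "smooth_on \<nu> R"
  unfolding \<nu>_def
  by (intro smooth_on_divide smooth_on_diff smooth_on_add smooth_on_mult smooth_on_const open_R smooth_\<beta>
      smooth_on_subset[OF smooth_mean R_subset] smooth_on_subset[OF smooth_sq_norm_A R_subset]
      smooth_on_subset[OF smooth_t R_subset]) (use t_pos in force)

lemma cov_deriv_A:
  assumes x: "x \<in> R"
  shows "cov_deriv g w (\<lambda>y. A y v) x
    = (c * dir_deriv mean x w) *\<^sub>R v + (c * mean x) *\<^sub>R christoffel g x w v
      + (- q x * dir_deriv (\<lambda>y. dir_deriv mean y v) x w + dir_deriv (\<lambda>y. - q y) x w * dir_deriv mean x v) *\<^sub>R T x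
      + (- q x * dir_deriv mean x v) *\<^sub>R cov_deriv g w T x"
proof -
  have "cov_deriv g w (\<lambda>y. A y v) x
    = dir_deriv (\<lambda>y. c * mean y) x w *\<^sub>R v + (c * mean x) *\<^sub>R christoffel g x w v
      + (- q x * dir_deriv (\<lambda>y. dir_deriv mean y v) x w + dir_deriv (\<lambda>y. - q y) x w * dir_deriv mean x v) *\<^sub>R T x
      + (- q x * dir_deriv mean x v) *\<^sub>R cov_deriv g w T x"
  proof (rule cov_deriv_split[OF x])
    show "smooth_on (\<lambda>y. c * mean y) R"
      by (intro smooth_on_mult smooth_on_const open_R smooth_on_subset[OF smooth_mean R_subset])
    show "smooth_on (\<lambda>y. - q y) R" by (rule smooth_on_minus[OF open_R smooth_q])
    show "A y v = (c * mean y) *\<^sub>R v + (- q y * dir_deriv mean y v) *\<^sub>R T y" if "y \<in> R" for y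
      using A_rank_one[OF that, of v] by (simp add: k2_c[OF that] g_T[OF R_S[OF that]] q_def algebra_simps)
  qed
  also have "dir_deriv (\<lambda>y. c * mean y) x w = c * dir_deriv mean x w"
    by (rule dir_deriv_linear[OF bounded_linear_mult_right diff_mean[OF R_S[OF x]]])
  finally show ?thesis .
qed

lemma \<beta>_q:
  assumes x: "x \<in> R"
  shows "q x * \<beta> x = - c"
proof -
  have "d * f / s * (- (c / d) * s / f) = - c" if "d > 0" "s > 0" "f > 0" for d s f :: real
    using that by (simp add: field_simps)
  from this[of "c + 1 / 2", OF _ t_pos[OF x] mean_pos[OF R_S[OF x]]] show ?thesis
    using c_pos[OF x] by (simp add: q_def \<beta>_def)
qed

lemma q_pos: "x \<in> R \<Longrightarrow> q x > 0"
  using c_pos[of x] t_pos[of x] mean_pos[OF R_S, of x] by (simp add: q_def)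

text \<open>The Codazzi equation for u and T determines \<open>\<nabla>\<^sub>u T\<close> up to a
  multiple r of T, where r is minus the derivative of q along u. Pairing with T gives one equation
  for r. Since q t is a constant multiple of f, it is stationary along u, which gives a second one;
  together they force r = 0.\<close>

lemma hess_orthogonal:
  assumes x: "x \<in> R" and orth: "g x (T x) u = 0"
  shows "cov_deriv g u T x = \<beta> x *\<^sub>R u"
proof -
  have xS: "x \<in> S" by (rule R_S[OF x])
  interpret inner_form "g x" by (rule form[OF xS])
  have dq: "q differentiable (at x)" by (rule smooth_on_differentiable[OF smooth_q x])
  have fu: "dir_deriv mean x u = 0" using orth by (simp add: g_T[OF xS])
  define r where "r = dir_deriv (\<lambda>y. - q y) x u"
  have r: "r = - dir_deriv q x u" unfolding r_def by (rule dir_deriv_minus[OF dq])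
  have "(r * t x) *\<^sub>R T x - (q x * t x) *\<^sub>R cov_deriv g u T x = (c * t x) *\<^sub>R u"
    using codazzi[OF xS, of u "T x"] unfolding cov_deriv_A[OF x]
    by (simp add: fu dir_deriv_mean_T[OF xS] christoffel_sym[OF xS, of u] dir_deriv_ddmean_sym[OF xS, of "T x" u]
        r_def algebra_simps)
  then have "t x *\<^sub>R (r *\<^sub>R T x - q x *\<^sub>R cov_deriv g u T x) = t x *\<^sub>R (c *\<^sub>R u)"
    by (simp add: algebra_simps)
  then have eq: "r *\<^sub>R T x - q x *\<^sub>R cov_deriv g u T x = c *\<^sub>R u"
    by (rule scaleR_left_imp_eq[rotated]) (use t_pos[OF x] in simp)
  have "g x (T x) (r *\<^sub>R T x - q x *\<^sub>R cov_deriv g u T x) = 0"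
    unfolding eq by (simp add: simps orth)
  then have 1: "r * t x = q x * g x (T x) (cov_deriv g u T x)" by (simp add: simps t_def)
  have "dir_deriv (\<lambda>y. q y * t y) x u = dir_deriv (\<lambda>y. (c + 1 / 2) * mean y) x u"
    by (rule dir_deriv_cong[OF open_R x]) (use t_pos in \<open>force simp: q_def\<close>)
  also have "\<dots> = 0"
    using dir_deriv_linear[OF bounded_linear_mult_right diff_mean[OF xS]] fu by simp
  finally have "q x * (2 * g x (T x) (cov_deriv g u T x)) - r * t x = 0"
    unfolding dir_deriv_mult[OF dq diff_t[OF xS]] r dir_deriv_t[OF xS] by (simp add: sym[of "T x"])
  then have "r * t x = 0" using 1 by simp
  then have "r = 0" using t_pos[OF x] by simp
  then have "q x *\<^sub>R cov_deriv g u T x = (- c) *\<^sub>R u"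
    using arg_cong[OF eq, of uminus] \<open>r = 0\<close> by simp
  also have "\<dots> = q x *\<^sub>R (\<beta> x *\<^sub>R u)" by (simp add: \<beta>_q[OF x])
  finally show ?thesis
    by (rule scaleR_left_imp_eq[rotated]) (use q_pos[OF x] in simp)
qed

text \<open>The Hessian is symmetric and acts as \<beta> on the complement of T, so T is an
  eigenvector too; its eigenvalue \<open>l\<close> follows from the trace.\<close>

lemma hess_formula:
  assumes x: "x \<in> R"
  shows "cov_deriv g v T x = \<beta> x *\<^sub>R v + (\<nu> x * dir_deriv mean x v) *\<^sub>R T x"
proof -
  have xS: "x \<in> S" by (rule R_S[OF x])
  interpret inner_form "g x" by (rule form[OF xS])
  let ?H = "\<lambda>v. cov_deriv g v T x"
  have lin: "linear ?H" by (rule linear_cov_deriv[OF xS diff_T[OF xS]])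
  have t: "t x \<noteq> 0" "t x = g x (T x) (T x)" using t_pos[OF x] by (auto simp: t_def)
  define l where "l = g x (T x) (?H (T x)) / t x"
  define w where "w = ?H (T x) - l *\<^sub>R T x"
  have Tw: "g x (T x) w = 0" using t by (simp add: w_def l_def simps)
  have "g x w w = g x (?H (T x) - l *\<^sub>R T x) w" by (simp only: w_def)
  also have "\<dots> = g x (?H (T x)) w" by (simp add: simps Tw)
  also have "\<dots> = g x (T x) (?H w)" by (rule hess_T_sym[OF xS])
  also have "\<dots> = 0" by (simp add: hess_orthogonal[OF x Tw] simps Tw)
  finally have "w = 0" by (simp add: eq_0_iff)
  then have HT: "?H (T x) = l *\<^sub>R T x" by (simp add: w_def)
  have H: "?H v = \<beta> x *\<^sub>R v + ((l - \<beta> x) * g x (T x) v / t x) *\<^sub>R T x" for v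
  proof -
    define s where "s = g x (T x) v / t x"
    have "g x (T x) (v - s *\<^sub>R T x) = 0" using t by (simp add: s_def simps)
    from hess_orthogonal[OF x this] have "?H v = \<beta> x *\<^sub>R (v - s *\<^sub>R T x) + s *\<^sub>R l *\<^sub>R T x"
      by (simp add: linear_diff[OF lin] linear_scale[OF lin] HT algebra_simps)
    then show ?thesis by (simp add: s_def algebra_simps diff_divide_distrib)
  qed
  have "tr ?H = tr (\<lambda>v. \<beta> x *\<^sub>R v + ((l - \<beta> x) * g x (T x) v / t x) *\<^sub>R T x)"
    by (rule arg_cong[of _ _ tr]) (intro ext H)
  also have "\<dots> = \<beta> x * CARD('m) + (l - \<beta> x)"
    using t by (simp add: tr_add tr_scaleR tr_ident tr_rank_one[OF linear_g_T[OF xS]])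
  finally have "(l - \<beta> x) / t x = \<nu> x"
    by (simp add: tr_hess[OF xS] \<nu>_def algebra_simps)
  then show ?thesis unfolding H[of v] by (simp add: g_T[OF xS] times_divide_eq_left[symmetric] del: times_divide_eq_left)
qed

text \<open>The Gauss equation for the plane spanned by T and an orthogonal u. Its sectional
  curvature is -1 plus the product of the curvatures -f/2 and c f.\<close>

lemma gauss_radial:
  assumes x: "x \<in> R"
  shows "\<nu> x * t x * \<beta> x - dir_deriv \<beta> x (T x) = - (c * (mean x)\<^sup>2 / 2 + 1) * t x"
proof -
  have xS: "x \<in> S" by (rule R_S[OF x])
  interpret inner_form "g x" by (rule form[OF xS])
  obtain u where u: "u \<noteq> 0" and orth: "g x (T x) u = 0" using ex_orthogonal[OF x] by blast
  have orth': "g x u (T x) = 0" using orth sym by simp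
  have fu: "dir_deriv mean x u = 0" using orth by (simp add: g_T[OF xS])
  have HH: "cov_deriv g w (cov_deriv g v T) x = dir_deriv \<beta> x w *\<^sub>R v + \<beta> x *\<^sub>R christoffel g x w v
    + (\<nu> x * dir_deriv (\<lambda>y. dir_deriv mean y v) x w + dir_deriv \<nu> x w * dir_deriv mean x v) *\<^sub>R T x
    + (\<nu> x * dir_deriv mean x v) *\<^sub>R cov_deriv g w T x" for v w
    by (rule cov_deriv_split[OF x smooth_\<beta> smooth_\<nu> hess_formula])
  have Au: "A x u = (c * mean x) *\<^sub>R u"
    using A_rank_one[OF x, of u] by (simp add: orth k2_c[OF x])
  have "g x (cov_deriv g u (cov_deriv g (T x) T) x - cov_deriv g (T x) (cov_deriv g u T) x) u
      = (\<nu> x * t x * \<beta> x - dir_deriv \<beta> x (T x)) * g x u u"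
    unfolding HH by (simp add: simps orth fu dir_deriv_mean_T[OF xS] hess_orthogonal[OF x orth]
        christoffel_sym[OF xS, of u] algebra_simps)
  also have "cov_deriv g u (cov_deriv g (T x) T) x - cov_deriv g (T x) (cov_deriv g u T) x
      = (- (c * (mean x)\<^sup>2 / 2 + 1) * t x) *\<^sub>R u"
    unfolding gauss[OF xS smooth_T] A_T[OF xS] Au
    by (simp add: simps orth orth' t_def[symmetric] power2_eq_square algebra_simps)
  finally have "(- (c * (mean x)\<^sup>2 / 2 + 1) * t x) * g x u u = (\<nu> x * t x * \<beta> x - dir_deriv \<beta> x (T x)) * g x u u"
    by (simp only: simps real_scaleR_def)
  moreover have "g x u u \<noteq> 0" using pos[OF u] by simp
  ultimately show ?thesis by (simp only: mult_cancel_right simp_thms)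
qed

text \<open>With \<open>\<lambda> = \<beta> + \<nu> t\<close>, the eigenvalue of the Hessian in direction \<open>T\<close>.\<close>

lemma radial_identities:
  assumes x: "x \<in> R"
  defines "a \<equiv> c / (c + 1 / 2)" and "l \<equiv> \<beta> x + \<nu> x * t x"
  shows "\<beta> x * mean x = - a * t x"
    and "l = (CARD('m) + (3 * c / 2 + 1 / 4) * (mean x)\<^sup>2) * mean x - (real CARD('m) - 1) * \<beta> x"
    and "dir_deriv t x (T x) = 2 * l * t x"
    and "a * l + (1 + a) * \<beta> x = - (1 + c * (mean x)\<^sup>2 / 2) * mean x"
proof -
  have xS: "x \<in> S" by (rule R_S[OF x])
  interpret inner_form "g x" by (rule form[OF xS])
  have t: "t x > 0" and f: "mean x > 0" using t_pos[OF x] mean_pos[OF xS] by auto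
  have \<beta>f: "\<beta> y * mean y = - a * t y" if "y \<in> R" for y
    using mean_pos[OF R_S[OF that]] by (simp add: \<beta>_def a_def)
  show 1: "\<beta> x * mean x = - a * t x" by (rule \<beta>f[OF x])
  show 2: "l = (CARD('m) + (3 * c / 2 + 1 / 4) * (mean x)\<^sup>2) * mean x - (real CARD('m) - 1) * \<beta> x"
  proof -
    have "\<nu> x * t x = (CARD('m) + sq_norm_A x) * mean x - CARD('m) * \<beta> x"
      unfolding \<nu>_def using t by simp
    then show ?thesis by (simp add: l_def sq_norm_A_eq[OF x] algebra_simps)
  qed
  show 3: "dir_deriv t x (T x) = 2 * l * t x"
    by (simp add: dir_deriv_t[OF xS] hess_formula[OF x] simps dir_deriv_mean_T[OF xS] t_def[symmetric]
        l_def algebra_simps)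
  \<comment> \<open>Differentiating \<beta> f = -a t along T expresses the derivative of \<beta> in
    \<open>gauss_radial\<close> through l and t; a common factor t then cancels.\<close>
  have "dir_deriv (\<lambda>y. \<beta> y * mean y) x (T x) = dir_deriv (\<lambda>y. - a * t y) x (T x)"
    by (rule dir_deriv_cong[OF open_R x \<beta>f])
  then have "\<beta> x * t x + dir_deriv \<beta> x (T x) * mean x = - a * (2 * l * t x)"
    unfolding dir_deriv_mult[OF smooth_on_differentiable[OF smooth_\<beta> x] diff_mean[OF xS]]
      dir_deriv_linear[OF bounded_linear_mult_right diff_t[OF xS]] dir_deriv_mean_T[OF xS] 3 .
  moreover have "(\<nu> x * t x * \<beta> x - dir_deriv \<beta> x (T x)) * mean x = - (c * (mean x)\<^sup>2 / 2 + 1) * t x * mean x"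
    by (simp only: gauss_radial[OF x])
  moreover have "\<nu> x * t x = l - \<beta> x" by (simp add: l_def)
  ultimately have "t x * (a * l + (1 + a) * \<beta> x) = t x * (- (1 + c * (mean x)\<^sup>2 / 2) * mean x)"
    using 1 by (simp add: algebra_simps) algebra
  then show "a * l + (1 + a) * \<beta> x = - (1 + c * (mean x)\<^sup>2 / 2) * mean x" using t by simp
qed

text \<open>Eliminating \<open>\<lambda>\<close> shows that \<open>|T|\<^sup>2\<close> is a polynomial in \<open>f = tr A\<close>. Differentiating along \<open>T\<close> gives
  a second equation, which forces \<open>f\<close> to be constant.\<close>

lemma not_regular: "x \<notin> R"
proof
  assume x: "x \<in> R"
  define a where "a = c / (c + 1 / 2)"
  \<comment> \<open>\<open>\<kappa>\<close> is the coefficient of \<beta> once l is eliminated: 1 +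
    a - a (m - 1). \<open>P\<close> and \<open>Q\<close> are the coefficients in
    \<open>t = P f\<^sup>2 + Q f\<^sup>4\<close>, and \<open>Y\<close> collects the cubic terms in f
    of the last radial identity after both l and \<beta> are written through f.\<close>
  define \<kappa> where "\<kappa> = 1 + a * (2 - real CARD('m))"
  define P where "P = (1 + a * CARD('m)) / (a * \<kappa>)"
  define Q where "Q = (a * (3 * c / 2 + 1 / 4) + c / 2) / (a * \<kappa>)"
  define Y where "Y = a * Q * (1 - a) + c / 2"
  have cpos: "c > 0" by (rule c_pos[OF x])
  have a: "0 < a" "a < 1" using cpos by (simp_all add: a_def)
  have \<kappa>\<beta>: "\<kappa> * \<beta> y = - (1 + a * CARD('m) + (a * (3 * c / 2 + 1 / 4) + c / 2) * (mean y)\<^sup>2) * mean y"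
    if y: "y \<in> R" for y
    using radial_identities(4)[OF y] unfolding radial_identities(2)[OF y] a_def[symmetric] \<kappa>_def
    by (simp add: algebra_simps)
  \<comment> \<open>By definition \<beta> < 0, and \<kappa> \<beta> is negative by
    \<open>\<kappa>\<beta>\<close>. This is where dimensions m \<ge> 4 are excluded.\<close>
  have \<kappa>: "\<kappa> > 0"
  proof -
    have f: "mean x > 0" by (rule mean_pos[OF R_S[OF x]])
    have "\<beta> x < 0" using t_pos[OF x] f cpos by (simp add: \<beta>_def)
    moreover have "\<kappa> * \<beta> x < 0"
    proof -
      have "1 + a * CARD('m) + (a * (3 * c / 2 + 1 / 4) + c / 2) * (mean x)\<^sup>2 > 0"
        using a cpos by (intro add_pos_nonneg) auto
      then show ?thesis unfolding \<kappa>\<beta>[OF x] mult_minus_left neg_less_0_iff_less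
        using f by (rule mult_pos_pos)
    qed
    ultimately show ?thesis by (simp add: mult_less_0_iff)
  qed
  have Q: "Q > 0" using a cpos \<kappa> by (simp add: Q_def add_pos_pos)
  have t_poly: "t y = P * (mean y)\<^sup>2 + Q * (mean y) ^ 4" if y: "y \<in> R" for y
  proof -
    have "a * \<kappa> * t y = - (\<kappa> * \<beta> y) * mean y"
      using radial_identities(1)[OF y] by (simp add: a_def algebra_simps)
    also have "\<dots> = (1 + a * CARD('m)) * (mean y)\<^sup>2 + (a * (3 * c / 2 + 1 / 4) + c / 2) * (mean y) ^ 4"
      unfolding \<kappa>\<beta>[OF y] by (simp add: algebra_simps power2_eq_square power4_eq_xxxx)
    also have "\<dots> = a * \<kappa> * (P * (mean y)\<^sup>2 + Q * (mean y) ^ 4)"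
      using a \<kappa> by (simp add: P_def Q_def distrib_left)
    finally show ?thesis using a \<kappa> by simp
  qed
  have dmean: "((\<lambda>y. mean y) has_derivative dir_deriv mean y) (at y)" if "y \<in> R" for y
    by (rule smooth_on_has_derivative[OF smooth_mean R_S[OF that]])
  \<comment> \<open>The derivative of t along T is known twice: as 2 l t and from the polynomial.
    Comparing them makes l, and with it the last radial identity, a polynomial in f alone.\<close>
  have const: "Y * (mean y)\<^sup>2 = - 1 - a * P + (1 + a) * a * P" if y: "y \<in> R" for y
  proof -
    define l where "l = \<beta> y + \<nu> y * t y"
    have f: "mean y > 0" by (rule mean_pos[OF R_S[OF y]])
    have "dir_deriv t y (T y) = dir_deriv (\<lambda>y. P * (mean y)\<^sup>2 + Q * (mean y) ^ 4) y (T y)"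
      by (rule dir_deriv_cong[OF open_R y t_poly])
    also have "\<dots> = (2 * P * mean y + 4 * Q * (mean y) ^ 3) * t y"
    proof -
      have "((\<lambda>y. P * (mean y)\<^sup>2 + Q * (mean y) ^ 4) has_derivative
          (\<lambda>h. (2 * P * mean y + 4 * Q * (mean y) ^ 3) * dir_deriv mean y h)) (at y)"
        by (rule derivative_eq_intros dmean[OF y] refl)+ (simp add: fun_eq_iff algebra_simps)
      then show ?thesis by (simp add: dir_deriv_eqI dir_deriv_mean_T[OF R_S[OF y]])
    qed
    finally have l: "l = P * mean y + 2 * Q * (mean y) ^ 3"
      using t_pos[OF y] unfolding radial_identities(3)[OF y] l_def[symmetric] by simp
    have \<beta>: "\<beta> y = - a * (P * mean y + Q * (mean y) ^ 3)"
    proof -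
      have "\<beta> y * mean y = - a * (P * mean y + Q * (mean y) ^ 3) * mean y"
        using radial_identities(1)[OF y] t_poly[OF y]
        by (simp add: a_def algebra_simps power2_eq_square power4_eq_xxxx power3_eq_cube)
      from iffD1[OF mult_cancel_right this] f show ?thesis by simp
    qed
    have "a * l + (1 + a) * \<beta> y = - (1 + c * (mean y)\<^sup>2 / 2) * mean y"
      using radial_identities(4)[OF y] by (simp only: a_def l_def)
    then have "mean y * (Y * (mean y)\<^sup>2) = mean y * (- 1 - a * P + (1 + a) * a * P)"
      unfolding l \<beta> Y_def by (simp add: algebra_simps power2_eq_square power3_eq_cube)
    then show ?thesis using f by simp
  qed
  have "dir_deriv (\<lambda>y. Y * (mean y)\<^sup>2) x (T x) = dir_deriv (\<lambda>y. - 1 - a * P + (1 + a) * a * P) x (T x)"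
    by (rule dir_deriv_cong[OF open_R x const])
  moreover have "dir_deriv (\<lambda>y. Y * (mean y)\<^sup>2) x (T x) = 2 * Y * mean x * t x"
  proof -
    have "((\<lambda>y. Y * (mean y)\<^sup>2) has_derivative (\<lambda>h. 2 * Y * mean x * dir_deriv mean x h)) (at x)"
      by (rule derivative_eq_intros dmean[OF x] refl)+ (simp add: fun_eq_iff algebra_simps)
    then show ?thesis by (simp add: dir_deriv_eqI dir_deriv_mean_T[OF R_S[OF x]])
  qed
  \<comment> \<open>Since 0 < a < 1, the number Y is positive, so the derivative 2 Y f t of a
    constant would be positive.\<close>
  moreover have "Y > 0" using a Q cpos by (simp add: Y_def add_pos_pos)
  ultimately show False using t_pos[OF x] mean_pos[OF R_S[OF x]] by simp
qed

end

theorem empty: "S = {}"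
proof (rule ccontr)
  assume "S \<noteq> {}"
  then obtain x where xS: "x \<in> S" by blast
  have "y \<notin> R" for y
  proof
    assume y: "y \<in> R"
    have "real CARD('m) - 1 \<noteq> 0" using dim_ge_2[OF y] by simp
    moreover have "r * (3 / (2 * r)) = 3 / 2" if "r \<noteq> 0" for r :: real using that by simp
    ultimately have "(real CARD('m) - 1) * (3 / (2 * (real CARD('m) - 1))) = 3 / 2" by blast
    from not_regular[OF this] show False using y by blast
  qed
  then have T0: "T y = 0" if "y \<in> S" for y using that by (auto simp: R_def)
  have "cov_deriv g u T x = cov_deriv g u (\<lambda>_. 0) x" for u
    by (rule cov_deriv_cong[OF open_S xS T0])
  then have "cov_deriv g u T x = 0" for u
    by (simp add: cov_deriv_const[OF xS] linear_0[OF linear_christoffel_right[OF xS]])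
  then have "(CARD('m) + sq_norm_A x) * mean x = 0"
    using tr_hess[OF xS] by (simp add: tr_def)
  moreover have "CARD('m) + sq_norm_A x > 0"
    using sq_norm_A_nonneg[OF xS] by (simp add: add_pos_nonneg)
  ultimately show False using mean_pos[OF xS] by simp
qed

end

section \<open>The connection of hyperbolic space\<close>

text \<open>The Christoffel operator of the half-space metric multiplied by the height. It is a
  fixed bilinear map, so all dependence on the point sits in the factor 1 /
  \<open>snd p\<close>.\<close>

definition hyp_gamma :: "'e::euclidean_space \<times> real \<Rightarrow> 'e \<times> real \<Rightarrow> 'e \<times> real" where
  "hyp_gamma u v = (u \<bullet> v) *\<^sub>R (0, 1) - snd v *\<^sub>R u - snd u *\<^sub>R v"

lemma inner_vertical: "(0, r) \<bullet> (z :: 'e::euclidean_space \<times> real) = r * snd z"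
  by (simp add: inner_prod_def)

lemma inner_hyp_gamma: "hyp_gamma u v \<bullet> z = (u \<bullet> v) * snd z - snd v * (u \<bullet> z) - snd u * (v \<bullet> z)"
  by (simp add: hyp_gamma_def inner_diff_left inner_vertical)

lemma hyp_gamma_sym: "hyp_gamma u v = hyp_gamma v u"
  by (simp add: hyp_gamma_def inner_commute)

lemma bounded_bilinear_hyp_gamma:
  "bounded_bilinear (hyp_gamma :: 'e::euclidean_space \<times> real \<Rightarrow> _)"
proof -
  have lin: "linear (hyp_gamma u)" for u :: "'e \<times> real"
    by (rule linearI) (simp_all add: hyp_gamma_def inner_add_right algebra_simps)
  have "(\<lambda>v. hyp_gamma v u) = hyp_gamma u" for u :: "'e \<times> real"
    by (rule ext) (rule hyp_gamma_sym)
  then have "bilinear (hyp_gamma :: 'e \<times> real \<Rightarrow> _)"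
    unfolding bilinear_def by (simp add: lin)
  then show ?thesis by (simp add: bilinear_conv_bounded_bilinear)
qed

lemmas hyp_gamma_simps = bounded_bilinear.add_left[OF bounded_bilinear_hyp_gamma]
  bounded_bilinear.add_right[OF bounded_bilinear_hyp_gamma]
  bounded_bilinear.diff_left[OF bounded_bilinear_hyp_gamma]
  bounded_bilinear.diff_right[OF bounded_bilinear_hyp_gamma]
  bounded_bilinear.scaleR_left[OF bounded_bilinear_hyp_gamma]
  bounded_bilinear.scaleR_right[OF bounded_bilinear_hyp_gamma]

lemma open_hyp_space: "open (hyp_space :: ('e::euclidean_space \<times> real) set)"
  unfolding hyp_space_def by (rule open_Collect_less) (intro continuous_intros)+

lemma inner_form_hyp_metric:
  assumes "p \<in> hyp_space"
  shows "inner_form (hyp_metric p)"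
proof (rule inner_form.intro)
  have p: "snd p > 0" using assms by (simp add: hyp_space_def)
  show "linear (hyp_metric p u)" for u
    by (rule linearI) (simp_all add: hyp_metric_def inner_add_right add_divide_distrib)
  show "hyp_metric p u v = hyp_metric p v u" for u v
    by (simp add: hyp_metric_def inner_commute)
  show "hyp_metric p u u > 0" if "u \<noteq> 0" for u
    using p that by (simp add: hyp_metric_def)
qed

lemma has_derivative_inverse_snd:
  assumes "p \<in> hyp_space"
  shows "((\<lambda>y. 1 / snd y) has_derivative (\<lambda>z. - snd z / (snd p)\<^sup>2)) (at p)"
  using assms unfolding hyp_space_def
  by (auto intro!: derivative_eq_intros simp: power2_eq_square field_simps)

lemma dir_deriv_hyp_metric:
  assumes p: "p \<in> hyp_space"
  shows "dir_deriv (\<lambda>y. hyp_metric y u v) p z = - 2 * (u \<bullet> v) * snd z / (snd p) ^ 3"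
proof -
  have p0: "snd p \<noteq> 0" using p by (simp add: hyp_space_def)
  have "((\<lambda>y. (u \<bullet> v) * (1 / snd y)\<^sup>2) has_derivative
      (\<lambda>z. (u \<bullet> v) * (2 * (- snd z / (snd p)\<^sup>2) * (1 / snd p)))) (at p)"
    by (rule derivative_eq_intros has_derivative_inverse_snd[OF p] refl)+ (simp add: fun_eq_iff)
  then have "dir_deriv (\<lambda>y. hyp_metric y u v) p z = (u \<bullet> v) * (2 * (- snd z / (snd p)\<^sup>2) * (1 / snd p))"
    unfolding hyp_metric_def by (intro dir_deriv_eqI) (simp add: power_inverse divide_inverse)
  then show ?thesis using p0 by (simp add: power2_eq_square power3_eq_cube)
qed

lemma christoffel_hyp_metric:
  assumes p: "p \<in> hyp_space"
  shows "christoffel hyp_metric p u v = (1 / snd p) *\<^sub>R hyp_gamma u v"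
  unfolding christoffel_def
proof (rule sharp_eqI[of hyp_metric p, OF inner_form_hyp_metric[OF p]])
  have p0: "snd p \<noteq> 0" using p by (simp add: hyp_space_def)
  show "hyp_metric p ((1 / snd p) *\<^sub>R hyp_gamma u v) z
    = (dir_deriv (\<lambda>y. hyp_metric y v z) p u + dir_deriv (\<lambda>y. hyp_metric y u z) p v
        - dir_deriv (\<lambda>y. hyp_metric y u v) p z) / 2" for z
    unfolding dir_deriv_hyp_metric[OF p] using p0
    by (simp add: hyp_metric_def inner_hyp_gamma divide_simps power2_eq_square power3_eq_cube)
qed

text \<open>Curvature -1 in purely algebraic form, multiplied by the squared height: the summands
  with \<open>snd u\<close> and \<open>snd v\<close> come from differentiating the factor 1 /
  \<open>snd p\<close>. It yields both the ambient curvature and the curvature of the pull-back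
  connection.\<close>

lemma hyp_gamma_curvature:
  fixes u v w :: "'e::euclidean_space \<times> real"
  shows "hyp_gamma u (hyp_gamma v w) - snd u *\<^sub>R hyp_gamma v w
    - (hyp_gamma v (hyp_gamma u w) - snd v *\<^sub>R hyp_gamma u w) = (u \<bullet> w) *\<^sub>R v - (v \<bullet> w) *\<^sub>R u"
proof (rule vector_eq_rdot[THEN iffD1], rule allI)
  fix z :: "'e \<times> real"
  have s: "snd (hyp_gamma v w) = v \<bullet> w - 2 * snd v * snd w" for v w :: "'e \<times> real"
    by (simp add: hyp_gamma_def)
  have i: "u \<bullet> hyp_gamma v w = (v \<bullet> w) * snd u - snd w * (u \<bullet> v) - snd v * (u \<bullet> w)"
    for u v w :: "'e \<times> real"
    unfolding inner_commute[of u "hyp_gamma v w"] inner_hyp_gamma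
    by (simp only: inner_commute[of v u] inner_commute[of w u])
  show "(hyp_gamma u (hyp_gamma v w) - snd u *\<^sub>R hyp_gamma v w
    - (hyp_gamma v (hyp_gamma u w) - snd v *\<^sub>R hyp_gamma u w)) \<bullet> z
    = ((u \<bullet> w) *\<^sub>R v - (v \<bullet> w) *\<^sub>R u) \<bullet> z"
    by (simp only: inner_diff_left inner_scaleR_left inner_hyp_gamma s i inner_commute[of v u])
      (simp add: algebra_simps)
qed

lemma curvature_hyp_metric:
  assumes p: "p \<in> hyp_space"
  shows "curvature hyp_metric p u v w = hyp_metric p u w *\<^sub>R v - hyp_metric p v w *\<^sub>R u"
proof -
  have p0: "snd p \<noteq> 0" using p by (simp add: hyp_space_def)
  have "cov_deriv hyp_metric u (cov_deriv hyp_metric v (\<lambda>_. w)) p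
      = (1 / (snd p)\<^sup>2) *\<^sub>R (hyp_gamma u (hyp_gamma v w) - snd u *\<^sub>R hyp_gamma v w)" for u v
  proof -
    have eq: "cov_deriv hyp_metric v (\<lambda>_. w) y = (1 / snd y) *\<^sub>R hyp_gamma v w" if "y \<in> hyp_space" for y
      by (simp add: cov_deriv_def christoffel_hyp_metric[OF that])
    have "((\<lambda>y. (1 / snd y) *\<^sub>R hyp_gamma v w) has_derivative
        (\<lambda>z. (- snd z / (snd p)\<^sup>2) *\<^sub>R hyp_gamma v w)) (at p)"
      by (rule bounded_linear.has_derivative[OF bounded_linear_scaleR_left has_derivative_inverse_snd[OF p]])
    then have "dir_deriv (cov_deriv hyp_metric v (\<lambda>_. w)) p u = (- snd u / (snd p)\<^sup>2) *\<^sub>R hyp_gamma v w"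
      using dir_deriv_cong[OF open_hyp_space p eq] by (simp add: dir_deriv_eqI)
    then show ?thesis
      unfolding cov_deriv_def[of _ u] eq[OF p] christoffel_hyp_metric[OF p]
      by (simp add: hyp_gamma_simps power2_eq_square scaleR_diff_right)
  qed
  then have "curvature hyp_metric p u v w = (1 / (snd p)\<^sup>2) *\<^sub>R
    (hyp_gamma u (hyp_gamma v w) - snd u *\<^sub>R hyp_gamma v w
      - (hyp_gamma v (hyp_gamma u w) - snd v *\<^sub>R hyp_gamma u w))"
    unfolding curvature_def by (simp only: scaleR_diff_right)
  then show ?thesis
    unfolding hyp_gamma_curvature by (simp add: hyp_metric_def scaleR_diff_right)
qed

section \<open>Immersions into hyperbolic space\<close>

locale hyp_immersion =
  fixes S :: "(real ^ 'm) set" and f :: "real ^ 'm \<Rightarrow> (real ^ 'm) \<times> real"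
  assumes open_S: "open S"
    and smooth_f: "smooth_on f S"
    and f_hyp: "x \<in> S \<Longrightarrow> f x \<in> hyp_space"
    and inj_df: "x \<in> S \<Longrightarrow> inj (dir_deriv f x)"
begin

abbreviation h :: "real ^ 'm \<Rightarrow> (real ^ 'm) \<times> real \<Rightarrow> (real ^ 'm) \<times> real \<Rightarrow> real" where
  "h x \<equiv> hyp_metric (f x)"

abbreviation D where
  "D u V x \<equiv> pullback_cov_deriv hyp_metric f u V x"

abbreviation g :: "(real ^ 'm) metric" where
  "g \<equiv> pullback_metric hyp_metric f"

lemma form_h: "x \<in> S \<Longrightarrow> inner_form (h x)"
  by (rule inner_form_hyp_metric[OF f_hyp])

lemma lin_df: "x \<in> S \<Longrightarrow> linear (dir_deriv f x)"
  by (rule linear_frechet_derivative[OF smooth_on_differentiable[OF smooth_f]])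

lemma smooth_df: "smooth_on (\<lambda>x. dir_deriv f x v) S"
  by (rule smooth_on_dir_deriv[OF smooth_f])

lemma diff_df: "x \<in> S \<Longrightarrow> (\<lambda>x. dir_deriv f x v) differentiable (at x)"
  by (rule smooth_on_differentiable[OF smooth_df])

lemma D_eq:
  "x \<in> S \<Longrightarrow> D u V x = dir_deriv V x u + (1 / snd (f x)) *\<^sub>R hyp_gamma (dir_deriv f x u) (V x)"
  by (simp add: pullback_cov_deriv_def christoffel_hyp_metric[OF f_hyp])

lemma snd_f_pos: "x \<in> S \<Longrightarrow> snd (f x) > 0"
  using f_hyp by (simp add: hyp_space_def)

lemma smooth_inverse_snd: "smooth_on (\<lambda>x. 1 / snd (f x)) S"
  by (intro smooth_on_divide smooth_on_const open_S smooth_on_linear[OF bounded_linear_snd] smooth_f)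
    (use snd_f_pos in force)

lemma dir_deriv_inverse_snd:
  assumes x: "x \<in> S"
  shows "dir_deriv (\<lambda>x. 1 / snd (f x)) x u = - snd (dir_deriv f x u) / (snd (f x))\<^sup>2"
  by (rule dir_deriv_eqI, rule has_derivative_compose[OF smooth_on_has_derivative[OF smooth_f x]
        has_derivative_inverse_snd[OF f_hyp[OF x]]])

lemma smooth_h:
  assumes "smooth_on V S" "smooth_on W S"
  shows "smooth_on (\<lambda>x. h x (V x) (W x)) S"
proof -
  have "h x v w = (v \<bullet> w) * (1 / snd (f x))\<^sup>2" for x v w
    by (simp add: hyp_metric_def power_inverse divide_inverse)
  then show ?thesis
    by (simp only:) (intro smooth_on_mult smooth_on_power smooth_on_inner smooth_inverse_snd assms open_S)
qed

lemma smooth_D: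
  assumes "smooth_on V S"
  shows "smooth_on (D u V) S"
  by (rule smooth_on_cong[OF open_S D_eq[symmetric]], assumption)
    (intro smooth_on_add smooth_on_scaleR smooth_on_dir_deriv smooth_inverse_snd assms smooth_f open_S
      smooth_on_bilinear[OF bounded_bilinear_hyp_gamma])

lemma D_cong:
  assumes "x \<in> S" "\<And>y. y \<in> S \<Longrightarrow> V y = W y"
  shows "D u V x = D u W x"
  using dir_deriv_cong[OF open_S assms(1), of V W] assms by (simp add: pullback_cov_deriv_def)

lemma linear_D:
  assumes x: "x \<in> S" and V: "V differentiable (at x)"
  shows "linear (\<lambda>u. D u V x)"
  by (rule linearI)
    (simp_all add: D_eq[OF x] linear_add[OF linear_frechet_derivative[OF V]] linear_add[OF lin_df[OF x]]
      linear_scale[OF linear_frechet_derivative[OF V]] linear_scale[OF lin_df[OF x]] hyp_gamma_simps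
      algebra_simps)

lemma D_add:
  assumes x: "x \<in> S" and V: "V differentiable (at x)" and W: "W differentiable (at x)"
  shows "D u (\<lambda>y. V y + W y) x = D u V x + D u W x"
  by (simp add: D_eq[OF x] dir_deriv_add[OF V W] hyp_gamma_simps algebra_simps)

lemma D_scaleR:
  assumes x: "x \<in> S" and c: "c differentiable (at x)" and V: "V differentiable (at x)"
  shows "D u (\<lambda>y. c y *\<^sub>R V y) x = dir_deriv c x u *\<^sub>R V x + c x *\<^sub>R D u V x"
  by (simp add: D_eq[OF x] dir_deriv_scaleR[OF c V] hyp_gamma_simps algebra_simps)

lemma D_minus:
  assumes x: "x \<in> S" and V: "V differentiable (at x)"
  shows "D u (\<lambda>y. - V y) x = - D u V x"
  using D_scaleR[OF x differentiable_const V, of u "-1"] by simp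

lemma D_metric:
  assumes x: "x \<in> S" and V: "V differentiable (at x)" and W: "W differentiable (at x)"
  shows "dir_deriv (\<lambda>y. h y (V y) (W y)) x u = h x (D u V x) (W x) + h x (V x) (D u W x)"
proof -
  let ?k = "\<lambda>x. 1 / snd (f x)"
  have k: "?k differentiable (at x)" by (rule smooth_on_differentiable[OF smooth_inverse_snd x])
  have f0: "snd (f x) \<noteq> 0" using snd_f_pos[OF x] by simp
  have VW: "(\<lambda>y. V y \<bullet> W y) differentiable (at x)" by (rule differentiable_inner[OF V W])
  have eq: "h y v w = (?k y * ?k y) * (v \<bullet> w)" for y v w
    by (simp add: hyp_metric_def power2_eq_square)
  have "dir_deriv (\<lambda>y. h y (V y) (W y)) x u
    = (?k x * ?k x) * (V x \<bullet> dir_deriv W x u + dir_deriv V x u \<bullet> W x)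
      + (?k x * (- snd (dir_deriv f x u) / (snd (f x))\<^sup>2) + (- snd (dir_deriv f x u) / (snd (f x))\<^sup>2) * ?k x) * (V x \<bullet> W x)"
    unfolding eq dir_deriv_mult[OF differentiable_mult[OF k k] VW] dir_deriv_mult[OF k k]
      dir_deriv_inner[OF V W] dir_deriv_inverse_snd[OF x] ..
  also have "\<dots> = h x (D u V x) (W x) + h x (V x) (D u W x)"
    unfolding D_eq[OF x] hyp_metric_def using f0
    by (simp add: inner_add_left inner_add_right inner_hyp_gamma inner_commute[of _ "hyp_gamma _ _"]
        divide_simps power2_eq_square)
      (simp add: inner_commute algebra_simps)
  finally show ?thesis .
qed

lemma D_df_sym: "x \<in> S \<Longrightarrow> D u (\<lambda>y. dir_deriv f y v) x = D v (\<lambda>y. dir_deriv f y u) x"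
  by (simp add: D_eq dir_deriv_commute[OF open_S _ smooth_f, of x u v] hyp_gamma_sym[of "dir_deriv f x u"])

text \<open>The pull-back connection has the pulled-back curvature. It is computed directly, since a
  section V along f need not come from a vector field on the ambient space.\<close>

lemma D_curvature:
  assumes x: "x \<in> S" and V: "smooth_on V S"
  shows "D u (D v V) x - D v (D u V) x
    = h x (dir_deriv f x u) (V x) *\<^sub>R dir_deriv f x v - h x (dir_deriv f x v) (V x) *\<^sub>R dir_deriv f x u"
proof -
  let ?k = "\<lambda>x. 1 / snd (f x)"
  let ?G = "\<lambda>v y. hyp_gamma (dir_deriv f y v) (V y)"
  have k: "?k differentiable (at x)" by (rule smooth_on_differentiable[OF smooth_inverse_snd x])
  have dV: "V differentiable (at x)" by (rule smooth_on_differentiable[OF V x])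
  have G: "?G v differentiable (at x)" for v
    by (rule smooth_on_differentiable[OF smooth_on_bilinear[OF bounded_bilinear_hyp_gamma open_S smooth_df V] x])
  have dVv: "(\<lambda>y. dir_deriv V y v) differentiable (at x)" for v
    by (rule smooth_on_differentiable[OF smooth_on_dir_deriv[OF V] x])
  \<comment> \<open>Apart from the last line, the right side is symmetric in u and v because second
    derivatives of f and V commute.\<close>
  have DD: "D u (D v V) x = dir_deriv (\<lambda>y. dir_deriv V y v) x u
      + ?k x *\<^sub>R hyp_gamma (dir_deriv f x v) (dir_deriv V x u)
      + ?k x *\<^sub>R hyp_gamma (dir_deriv f x u) (dir_deriv V x v)
      + ?k x *\<^sub>R hyp_gamma (dir_deriv (\<lambda>y. dir_deriv f y v) x u) (V x)
      + (1 / (snd (f x))\<^sup>2) *\<^sub>R (hyp_gamma (dir_deriv f x u) (?G v x) - snd (dir_deriv f x u) *\<^sub>R ?G v x)"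
    for u v
  proof -
    have "D u (D v V) x = D u (\<lambda>y. dir_deriv V y v + ?k y *\<^sub>R ?G v y) x"
      by (rule D_cong[OF x D_eq])
    also have "\<dots> = D u (\<lambda>y. dir_deriv V y v) x + (dir_deriv ?k x u *\<^sub>R ?G v x + ?k x *\<^sub>R D u (?G v) x)"
      unfolding D_add[OF x dVv differentiable_scaleR[OF k G]] D_scaleR[OF x k G] ..
    also have "D u (\<lambda>y. dir_deriv V y v) x
        = dir_deriv (\<lambda>y. dir_deriv V y v) x u + ?k x *\<^sub>R hyp_gamma (dir_deriv f x u) (dir_deriv V x v)"
      by (rule D_eq[OF x])
    also have "D u (?G v) x = hyp_gamma (dir_deriv f x v) (dir_deriv V x u)
        + hyp_gamma (dir_deriv (\<lambda>y. dir_deriv f y v) x u) (V x) + ?k x *\<^sub>R hyp_gamma (dir_deriv f x u) (?G v x)"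
      unfolding D_eq[OF x] dir_deriv_bilinear[OF bounded_bilinear_hyp_gamma diff_df[OF x] dV] ..
    finally show ?thesis
      by (simp add: dir_deriv_inverse_snd[OF x] power2_eq_square scaleR_add_right scaleR_diff_right)
  qed
  have "D u (D v V) x - D v (D u V) x = (1 / (snd (f x))\<^sup>2) *\<^sub>R
      (hyp_gamma (dir_deriv f x u) (?G v x) - snd (dir_deriv f x u) *\<^sub>R ?G v x
        - (hyp_gamma (dir_deriv f x v) (?G u x) - snd (dir_deriv f x v) *\<^sub>R ?G u x))"
    unfolding DD dir_deriv_commute[OF open_S x V, of v u] dir_deriv_commute[OF open_S x smooth_f, of v u]
      scaleR_diff_right[of "1 / (snd (f x))\<^sup>2"] by simp
  then show ?thesis
    unfolding hyp_gamma_curvature by (simp add: hyp_metric_def scaleR_diff_right)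
qed

lemma g_eq: "g x u v = h x (dir_deriv f x u) (dir_deriv f x v)"
  by (simp add: pullback_metric_def)

lemma df_eq_0: "x \<in> S \<Longrightarrow> dir_deriv f x u = 0 \<longleftrightarrow> u = 0"
  using linear_injective_0[OF lin_df] inj_df linear_0[OF lin_df] by blast

sublocale riemannian_domain S g
proof (rule riemannian_domain.intro)
  show "open S" by (rule open_S)
  show "smooth_on (\<lambda>x. g x u v) S" for u v
    unfolding g_eq by (rule smooth_h[OF smooth_df smooth_df])
next
  fix x assume x: "x \<in> S"
  interpret H: inner_form "h x" by (rule form_h[OF x])
  note lin = linear_add[OF lin_df[OF x]] linear_scale[OF lin_df[OF x]]
  show "inner_form (g x)"
  proof (rule inner_form.intro)
    show "linear (g x u)" for u by (rule linearI) (simp_all add: g_eq lin H.simps)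
    show "g x u v = g x v u" for u v by (simp add: g_eq H.sym)
    show "g x u u > 0" if "u \<noteq> 0" for u
      using that by (simp add: g_eq H.pos df_eq_0[OF x])
  qed
qed

text \<open>The tangential part of the pull-back connection is the Levi-Civita connection of the induced
  metric, since it satisfies the Koszul formula.\<close>

lemma D_df_tangential:
  assumes x: "x \<in> S"
  shows "h x (D u (\<lambda>y. dir_deriv f y v) x) (dir_deriv f x w) = g x (christoffel g x u v) w"
proof -
  interpret H: inner_form "h x" by (rule form_h[OF x])
  have dg: "dir_deriv (\<lambda>y. g y v w) x u = h x (D u (\<lambda>y. dir_deriv f y v) x) (dir_deriv f x w)
      + h x (D u (\<lambda>y. dir_deriv f y w) x) (dir_deriv f x v)" for u v w
    unfolding g_eq D_metric[OF x diff_df[OF x] diff_df[OF x]] by (simp add: H.sym)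
  show ?thesis
    unfolding koszul[OF x] dg D_df_sym[OF x, of v u] D_df_sym[OF x, of w u] D_df_sym[OF x, of w v]
    by simp
qed

lemma D_df_field:
  assumes x: "x \<in> S" and V: "V differentiable (at x)"
  shows "D u (\<lambda>y. dir_deriv f y (V y)) x
      = D u (\<lambda>y. dir_deriv f y (V x)) x + dir_deriv f x (dir_deriv V x u)"
    and "(\<lambda>y. dir_deriv f y (V y)) differentiable (at x)"
proof -
  note op = dir_deriv_operator_apply[OF open_S x lin_df diff_df[OF x] V]
  show "D u (\<lambda>y. dir_deriv f y (V y)) x
      = D u (\<lambda>y. dir_deriv f y (V x)) x + dir_deriv f x (dir_deriv V x u)"
    by (simp add: D_eq[OF x] op(1))
  show "(\<lambda>y. dir_deriv f y (V y)) differentiable (at x)" by (rule op(2))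
qed

lemma nabla_d_normal:
  assumes x: "x \<in> S"
  shows "h x (nabla_d g hyp_metric f x u v) (dir_deriv f x w) = 0"
  unfolding nabla_d_def
  by (simp add: inner_form.simps[OF form_h[OF x]] D_df_tangential[OF x] g_eq)

lemma linear_nabla_d:
  assumes x: "x \<in> S"
  shows "linear (\<lambda>u. nabla_d g hyp_metric f x u v)"
  unfolding nabla_d_def
  by (rule linear_compose_sub[OF linear_D[OF x diff_df[OF x]]
        linear_compose[OF linear_christoffel_left[OF x] lin_df[OF x], unfolded o_def]])

lemma smooth_sharp_basis: "smooth_on (\<lambda>x. sharp g x (\<lambda>z. z \<bullet> b)) S"
  by (rule smooth_on_sharp[OF open_S form smooth_g])
    (auto intro: bounded_linear.linear[OF bounded_linear_inner_left] smooth_on_const)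

text \<open>Established before any normal field is at hand, because the normal field will be the
  normalised tension field.\<close>

lemma smooth_tension: "smooth_on (tension g hyp_metric f) S"
proof -
  have "smooth_on (\<lambda>x. nabla_d g hyp_metric f x u b) S" for u b
    unfolding nabla_d_def
    by (intro smooth_on_diff[OF open_S smooth_D[OF smooth_df]]
        smooth_on_operator_apply[OF open_S lin_df smooth_df smooth_christoffel])
  then have "smooth_on (\<lambda>x. nabla_d g hyp_metric f x (sharp g x (\<lambda>z. z \<bullet> b)) b) S" for b
    by (intro smooth_on_operator_apply[OF open_S _ _ smooth_sharp_basis,
          where L="\<lambda>x u. nabla_d g hyp_metric f x u b"] linear_nabla_d)
  then show ?thesis
    unfolding tension_def metric_trace_def by (intro smooth_on_sum open_S)
qed

lemma tension_normal:
  assumes x: "x \<in> S"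
  shows "h x (tension g hyp_metric f x) (dir_deriv f x w) = 0"
proof -
  interpret H: inner_form "h x" by (rule form_h[OF x])
  show ?thesis
    unfolding tension_def metric_trace_def by (simp add: H.simps nabla_d_normal[OF x])
qed

end

section \<open>The fundamental equations of a hypersurface\<close>

locale hyp_hypersurface = hyp_immersion S f
  for S :: "(real ^ 'm) set" and f +
  fixes \<eta> :: "real ^ 'm \<Rightarrow> (real ^ 'm) \<times> real"
  assumes smooth_\<eta>: "smooth_on \<eta> S"
    and unit_normal_\<eta>: "x \<in> S \<Longrightarrow> unit_normal hyp_metric f x (\<eta> x)"
begin

lemma \<eta>_unit: "x \<in> S \<Longrightarrow> h x (\<eta> x) (\<eta> x) = 1"
  using unit_normal_\<eta> by (simp add: unit_normal_def)

lemma df_\<eta>: "x \<in> S \<Longrightarrow> h x (dir_deriv f x u) (\<eta> x) = 0"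
  using unit_normal_\<eta> by (simp add: unit_normal_def)

lemma \<eta>_df: "x \<in> S \<Longrightarrow> h x (\<eta> x) (dir_deriv f x u) = 0"
  using df_\<eta> inner_form.sym[OF form_h] by metis

lemma diff_\<eta>: "x \<in> S \<Longrightarrow> \<eta> differentiable (at x)"
  by (rule smooth_on_differentiable[OF smooth_\<eta>])

lemma tangent_normal_unique:
  assumes x: "x \<in> S" and eq: "dir_deriv f x a + s *\<^sub>R \<eta> x = dir_deriv f x b + r *\<^sub>R \<eta> x"
  shows "a = b" "s = r"
proof -
  interpret H: inner_form "h x" by (rule form_h[OF x])
  have "h x (dir_deriv f x a + s *\<^sub>R \<eta> x) (\<eta> x) = h x (dir_deriv f x b + r *\<^sub>R \<eta> x) (\<eta> x)"
    by (simp only: eq)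
  then show sr: "s = r" by (simp add: H.simps df_\<eta>[OF x] \<eta>_unit[OF x])
  then have "dir_deriv f x a = dir_deriv f x b" using eq by simp
  then show "a = b" using inj_df[OF x] by (rule injD[rotated])
qed

text \<open>Codimension one enters here: tangent vectors together with \<eta> span by a dimension
  count, so V - W is orthogonal to itself.\<close>

lemma tangent_normal_eqI:
  assumes x: "x \<in> S" and tan: "\<And>w. h x V (dir_deriv f x w) = h x W (dir_deriv f x w)"
    and norm: "h x V (\<eta> x) = h x W (\<eta> x)"
  shows "V = W"
proof -
  interpret H: inner_form "h x" by (rule form_h[OF x])
  let ?L = "\<lambda>p. dir_deriv f x (fst p) + snd p *\<^sub>R \<eta> x"
  have L: "linear ?L"
    by (rule linearI) (simp_all add: linear_add[OF lin_df[OF x]] linear_scale[OF lin_df[OF x]] algebra_simps)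
  have "inj ?L"
    by (rule injI) (rule prod_eqI[OF tangent_normal_unique[OF x]])
  then have "surj ?L" by (simp add: linear_injective_imp_surjective[OF L])
  then obtain p where p: "V - W = ?L p" by (rule surjE)
  have "h x (V - W) (?L p) = 0" by (simp add: H.simps tan norm)
  then have "V - W = 0" unfolding p[symmetric] H.eq_0_iff .
  then show ?thesis by simp
qed

definition A :: "real ^ 'm \<Rightarrow> real ^ 'm \<Rightarrow> real ^ 'm" where
  "A x = shape_operator hyp_metric f x (\<eta> x)"

lemma linear_second_fundamental:
  assumes x: "x \<in> S"
  shows "linear (\<lambda>v. h x (D u (\<lambda>y. dir_deriv f y v) x) (\<eta> x))"
proof -
  interpret H: inner_form "h x" by (rule form_h[OF x])
  have l: "linear (\<lambda>v. D v (\<lambda>y. dir_deriv f y u) x)" by (rule linear_D[OF x diff_df[OF x]])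
  show ?thesis
    unfolding D_df_sym[OF x, of u] using linear_compose[OF l H.linear_left] by (simp add: o_def)
qed

lemma g_A:
  assumes x: "x \<in> S"
  shows "g x (A x u) v = h x (D u (\<lambda>y. dir_deriv f y v) x) (\<eta> x)"
  unfolding A_def shape_operator_def
  by (rule sharp_eq[of g x "\<lambda>v. h x (D u (\<lambda>y. dir_deriv f y v) x) (\<eta> x)",
        OF form[OF x] linear_second_fundamental[OF x]])

lemma A_adj: "x \<in> S \<Longrightarrow> g x (A x u) v = g x u (A x v)"
  unfolding g_sym[of x u] g_A by (simp add: D_df_sym[of x u])

lemma linear_A:
  assumes x: "x \<in> S"
  shows "linear (A x)"
proof (rule linearI)
  note l = linear_D[OF x diff_df[OF x]]
  interpret inner_form "g x" by (rule form[OF x])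
  interpret H: inner_form "h x" by (rule form_h[OF x])
  show "A x (u + v) = A x u + A x v" for u v
    by (rule eqI) (simp add: simps g_A[OF x] linear_add[OF l] H.simps)
  show "A x (r *\<^sub>R u) = r *\<^sub>R A x u" for r u
    by (rule eqI) (simp add: simps g_A[OF x] linear_scale[OF l] H.simps)
qed

lemma smooth_shape: "smooth_on (\<lambda>x. A x u) S"
  unfolding A_def shape_operator_def
  by (rule smooth_on_sharp[OF open_S form smooth_g linear_second_fundamental])
    (auto intro: smooth_h[OF smooth_D[OF smooth_df] smooth_\<eta>])

lemma gauss_formula_const:
  assumes x: "x \<in> S"
  shows "D u (\<lambda>y. dir_deriv f y v) x = dir_deriv f x (christoffel g x u v) + g x (A x u) v *\<^sub>R \<eta> x"
proof (rule tangent_normal_eqI[OF x])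
  interpret H: inner_form "h x" by (rule form_h[OF x])
  show "h x (D u (\<lambda>y. dir_deriv f y v) x) (dir_deriv f x w)
      = h x (dir_deriv f x (christoffel g x u v) + g x (A x u) v *\<^sub>R \<eta> x) (dir_deriv f x w)" for w
    by (simp add: D_df_tangential[OF x] H.simps \<eta>_df[OF x] g_eq)
  show "h x (D u (\<lambda>y. dir_deriv f y v) x) (\<eta> x)
      = h x (dir_deriv f x (christoffel g x u v) + g x (A x u) v *\<^sub>R \<eta> x) (\<eta> x)"
    by (simp add: g_A[OF x] H.simps df_\<eta>[OF x] \<eta>_unit[OF x])
qed

lemma gauss_formula:
  assumes x: "x \<in> S" and V: "V differentiable (at x)"
  shows "D u (\<lambda>y. dir_deriv f y (V y)) x = dir_deriv f x (cov_deriv g u V x) + g x (A x u) (V x) *\<^sub>R \<eta> x"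
  by (simp add: D_df_field(1)[OF x V] gauss_formula_const[OF x] cov_deriv_def linear_add[OF lin_df[OF x]])

text \<open>Differentiating \<langle>\<eta>, df(w)\<rangle> = 0 gives the tangential part,
  differentiating \<langle>\<eta>, \<eta>\<rangle> = 1 the normal one.\<close>

lemma weingarten:
  assumes x: "x \<in> S"
  shows "D u \<eta> x = - dir_deriv f x (A x u)"
proof (rule tangent_normal_eqI[OF x])
  interpret H: inner_form "h x" by (rule form_h[OF x])
  have "dir_deriv (\<lambda>y. h y (\<eta> y) (dir_deriv f y w)) x u = dir_deriv (\<lambda>_. 0) x u" for w
    by (rule dir_deriv_cong[OF open_S x \<eta>_df])
  then have "h x (D u \<eta> x) (dir_deriv f x w) + h x (\<eta> x) (D u (\<lambda>y. dir_deriv f y w) x) = 0" for w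
    unfolding D_metric[OF x diff_\<eta>[OF x] diff_df[OF x]] by simp
  then show "h x (D u \<eta> x) (dir_deriv f x w) = h x (- dir_deriv f x (A x u)) (dir_deriv f x w)" for w
    by (simp add: H.simps g_eq[symmetric] g_A[OF x] H.sym[of "\<eta> x"] eq_neg_iff_add_eq_0)
  have "dir_deriv (\<lambda>y. h y (\<eta> y) (\<eta> y)) x u = dir_deriv (\<lambda>_. 1) x u"
    by (rule dir_deriv_cong[OF open_S x \<eta>_unit])
  then have "h x (D u \<eta> x) (\<eta> x) = 0"
    unfolding D_metric[OF x diff_\<eta>[OF x] diff_\<eta>[OF x]] by (simp add: H.sym[of "\<eta> x"])
  then show "h x (D u \<eta> x) (\<eta> x) = h x (- dir_deriv f x (A x u)) (\<eta> x)"
    by (simp add: H.simps df_\<eta>[OF x])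
qed

lemma diff_A: "x \<in> S \<Longrightarrow> (\<lambda>y. A y v) differentiable (at x)"
  by (rule smooth_on_differentiable[OF smooth_shape])

lemma D_df_A:
  assumes x: "x \<in> S"
  shows "D u (\<lambda>y. dir_deriv f y (A y v)) x
    = dir_deriv f x (cov_deriv g u (\<lambda>y. A y v) x) + g x (A x u) (A x v) *\<^sub>R \<eta> x"
  by (rule gauss_formula[OF x diff_A[OF x]])

lemma diff_df_A: "x \<in> S \<Longrightarrow> (\<lambda>y. dir_deriv f y (A y v)) differentiable (at x)"
  by (rule D_df_field(2)[OF _ diff_A])

text \<open>The tangential part of \<open>D_curvature\<close> for \<eta>; the curvature term
  vanishes because \<eta> is orthogonal to the image of df.\<close>

lemma codazzi_equation:
  assumes x: "x \<in> S"
  shows "cov_deriv g u (\<lambda>y. A y v) x = cov_deriv g v (\<lambda>y. A y u) x"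
proof -
  have DD: "D u (D v \<eta>) x
      = - (dir_deriv f x (cov_deriv g u (\<lambda>y. A y v) x) + g x (A x u) (A x v) *\<^sub>R \<eta> x)" for u v
  proof -
    have "D u (D v \<eta>) x = D u (\<lambda>y. - dir_deriv f y (A y v)) x" by (rule D_cong[OF x weingarten])
    then show ?thesis by (simp only: D_minus[OF x diff_df_A[OF x]] D_df_A[OF x])
  qed
  have "D u (D v \<eta>) x = D v (D u \<eta>) x"
    using D_curvature[OF x smooth_\<eta>, of u v] by (simp add: df_\<eta>[OF x])
  then show ?thesis
    unfolding DD neg_equal_iff_equal by (rule tangent_normal_unique(1)[OF x])
qed

lemma gauss_equation:
  assumes x: "x \<in> S" and V: "smooth_on V S"
  shows "cov_deriv g u (cov_deriv g v V) x - cov_deriv g v (cov_deriv g u V) x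
        = g x (A x v) (V x) *\<^sub>R A x u - g x (A x u) (V x) *\<^sub>R A x v
          - g x v (V x) *\<^sub>R u + g x u (V x) *\<^sub>R v"
proof -
  interpret H: inner_form "h x" by (rule form_h[OF x])
  let ?fV = "\<lambda>y. dir_deriv f y (V y)"
  have fV: "smooth_on ?fV S" by (rule smooth_on_operator_apply[OF open_S lin_df smooth_df V])
  have b: "(\<lambda>y. g y (A y v) (V y)) differentiable (at x)" for v
    by (rule smooth_on_differentiable[OF smooth_g_apply[OF smooth_shape V] x])
  have cV: "cov_deriv g v V differentiable (at x)" for v
    by (rule smooth_on_differentiable[OF smooth_cov_deriv[OF V] x])
  note l = linear_diff[OF lin_df[OF x]] linear_add[OF lin_df[OF x]] linear_scale[OF lin_df[OF x]]
  \<comment> \<open>\<open>n\<close> collects the normal components; the Gauss equation is the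
    tangential part alone.\<close>
  define n where "n u v = g x (A x u) (cov_deriv g v V x) + dir_deriv (\<lambda>y. g y (A y v) (V y)) x u" for u v
  have DD: "D u (D v ?fV) x = dir_deriv f x (cov_deriv g u (cov_deriv g v V) x - g x (A x v) (V x) *\<^sub>R A x u)
      + n u v *\<^sub>R \<eta> x" for u v
  proof -
    have "D u (D v ?fV) x = D u (\<lambda>y. dir_deriv f y (cov_deriv g v V y) + g y (A y v) (V y) *\<^sub>R \<eta> y) x"
      by (rule D_cong[OF x gauss_formula[OF _ smooth_on_differentiable[OF V]]])
    also have "\<dots> = D u (\<lambda>y. dir_deriv f y (cov_deriv g v V y)) x
        + (dir_deriv (\<lambda>y. g y (A y v) (V y)) x u *\<^sub>R \<eta> x + g x (A x v) (V x) *\<^sub>R D u \<eta> x)"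
      unfolding D_add[OF x D_df_field(2)[OF x cV] differentiable_scaleR[OF b diff_\<eta>[OF x]]]
        D_scaleR[OF x b diff_\<eta>[OF x]] ..
    finally show ?thesis
      unfolding gauss_formula[OF x cV] weingarten[OF x] n_def by (simp add: l algebra_simps)
  qed
  have "D u (D v ?fV) x - D v (D u ?fV) x
      = dir_deriv f x (g x u (V x) *\<^sub>R v - g x v (V x) *\<^sub>R u) + 0 *\<^sub>R \<eta> x"
    unfolding D_curvature[OF x fV] by (simp add: l g_eq)
  then have "dir_deriv f x ((cov_deriv g u (cov_deriv g v V) x - g x (A x v) (V x) *\<^sub>R A x u)
        - (cov_deriv g v (cov_deriv g u V) x - g x (A x u) (V x) *\<^sub>R A x v)) + (n u v - n v u) *\<^sub>R \<eta> x
      = dir_deriv f x (g x u (V x) *\<^sub>R v - g x v (V x) *\<^sub>R u) + 0 *\<^sub>R \<eta> x"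
    unfolding DD by (simp only: l(1) scaleR_diff_left) (simp only: algebra_simps)
  from tangent_normal_unique(1)[OF x this] show ?thesis by (simp add: algebra_simps)
qed

sublocale hyperbolic_shape_operator S g A
  by (rule hyperbolic_shape_operator.intro[OF riemannian_domain_axioms hyperbolic_shape_operator_axioms.intro])
    (fact linear_A A_adj smooth_shape codazzi_equation gauss_equation)+

section \<open>Tension and bitension in terms of the shape operator\<close>

lemma tension_eq:
  assumes x: "x \<in> S"
  shows "tension g hyp_metric f x = mean x *\<^sub>R \<eta> x"
proof -
  have "nabla_d g hyp_metric f x u v = g x (A x u) v *\<^sub>R \<eta> x" for u v
    unfolding nabla_d_def by (simp add: gauss_formula_const[OF x])
  then have "tension g hyp_metric f x = metric_trace g x (\<lambda>u v. g x (A x u) v) *\<^sub>R \<eta> x"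
    unfolding tension_def metric_trace_def by (simp add: scaleR_sum_left)
  then show ?thesis
    by (simp only: metric_trace_self_adjoint[of g x "A x", OF form[OF x] A_adj[OF x]] mean_def)
qed

lemma nabla_sq_tension:
  assumes x: "x \<in> S"
  shows "nabla_sq g hyp_metric f (tension g hyp_metric f) x u v
    = (g x (cov_deriv g u (grad mean) x) v - mean x * g x (A x u) (A x v)) *\<^sub>R \<eta> x
      - dir_deriv f x (dir_deriv mean x v *\<^sub>R A x u + dir_deriv mean x u *\<^sub>R A x v
          + mean x *\<^sub>R (cov_deriv g u (\<lambda>y. A y v) x - A x (christoffel g x u v)))"
proof -
  let ?\<tau> = "tension g hyp_metric f"
  note l = linear_diff[OF lin_df[OF x]] linear_add[OF lin_df[OF x]] linear_scale[OF lin_df[OF x]]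
  have dm: "mean differentiable (at y)" if "y \<in> S" for y
    by (rule smooth_on_differentiable[OF smooth_mean that])
  have dmv: "(\<lambda>y. dir_deriv mean y v) differentiable (at x)"
    by (rule smooth_on_differentiable[OF smooth_on_dir_deriv[OF smooth_mean] x])
  have D1: "D w ?\<tau> y = dir_deriv mean y w *\<^sub>R \<eta> y + mean y *\<^sub>R - dir_deriv f y (A y w)"
    if y: "y \<in> S" for w y
  proof -
    have "D w ?\<tau> y = D w (\<lambda>y. mean y *\<^sub>R \<eta> y) y" by (rule D_cong[OF y tension_eq])
    then show ?thesis by (simp only: D_scaleR[OF y dm[OF y] diff_\<eta>[OF y]] weingarten[OF y])
  qed
  have dfA: "(\<lambda>y. - dir_deriv f y (A y v)) differentiable (at x)"
    by (rule differentiable_minus[OF diff_df_A[OF x]])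
  have "D u (D v ?\<tau>) x = D u (\<lambda>y. dir_deriv mean y v *\<^sub>R \<eta> y + mean y *\<^sub>R - dir_deriv f y (A y v)) x"
    by (rule D_cong[OF x D1])
  also have "\<dots> = (dir_deriv (\<lambda>y. dir_deriv mean y v) x u *\<^sub>R \<eta> x + dir_deriv mean x v *\<^sub>R - dir_deriv f x (A x u))
      + (dir_deriv mean x u *\<^sub>R - dir_deriv f x (A x v)
        + mean x *\<^sub>R - (dir_deriv f x (cov_deriv g u (\<lambda>y. A y v) x) + g x (A x u) (A x v) *\<^sub>R \<eta> x))"
    unfolding D_add[OF x differentiable_scaleR[OF dmv diff_\<eta>[OF x]] differentiable_scaleR[OF dm[OF x] dfA]]
      D_scaleR[OF x dmv diff_\<eta>[OF x]] D_scaleR[OF x dm[OF x] dfA] D_minus[OF x diff_df_A[OF x]]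
      D_df_A[OF x] weingarten[OF x] ..
  finally show ?thesis
    unfolding nabla_sq_def D1[OF x] g_hess[OF x smooth_mean] by (simp add: l algebra_simps)
qed

text \<open>The two mixed terms \<open>T1\<close> and \<open>T2\<close> each contribute A T, and
  \<open>divergence_A\<close> contributes f T. The tangential part 2 A T + f T is the origin of the
  eigenvalue -f/2.\<close>

lemma metric_trace_nabla_sq:
  assumes x: "x \<in> S"
  shows "metric_trace g x (nabla_sq g hyp_metric f (tension g hyp_metric f) x)
    = (tr (\<lambda>u. cov_deriv g u (grad mean) x) - mean x * sq_norm_A x) *\<^sub>R \<eta> x
      - dir_deriv f x (2 *\<^sub>R A x (grad mean x) + mean x *\<^sub>R grad mean x)"
proof -
  interpret inner_form "g x" by (rule form[OF x])
  define E where "E b = sharp g x (\<lambda>z. z \<bullet> b)" for b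
  note l = linear_sum[OF lin_df[OF x]] linear_add[OF lin_df[OF x]] linear_scale[OF lin_df[OF x]]
  note gE = sharp_inner[of g x, OF form[OF x], folded E_def]
  have hess: "(\<Sum>b\<in>Basis. g x (cov_deriv g (E b) (grad mean) x) b) = tr (\<lambda>u. cov_deriv g u (grad mean) x)"
    using metric_trace_self_adjoint[of g x "\<lambda>u. cov_deriv g u (grad mean) x", OF form[OF x] hess_sym[OF x smooth_mean]]
    by (simp only: metric_trace_def E_def)
  have sq: "(\<Sum>b\<in>Basis. g x (A x (E b)) (A x b)) = sq_norm_A x"
  proof -
    have "(\<Sum>b\<in>Basis. g x (A x (E b)) (A x b)) = (\<Sum>b\<in>Basis. g x (E b) (A x (A x b)))"
      by (simp only: A_adj[OF x])
    then show ?thesis by (simp only: gE sq_norm_A_def tr_def)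
  qed
  have T1: "(\<Sum>b\<in>Basis. dir_deriv mean x b *\<^sub>R A x (E b)) = A x (grad mean x)"
  proof -
    have "(\<Sum>b\<in>Basis. dir_deriv mean x b *\<^sub>R E b) = grad mean x"
    proof (rule eqI)
      fix z
      have "g x (\<Sum>b\<in>Basis. dir_deriv mean x b *\<^sub>R E b) z = (\<Sum>b\<in>Basis. (z \<bullet> b) *\<^sub>R dir_deriv mean x b)"
        by (simp add: simps gE mult.commute)
      also have "\<dots> = dir_deriv mean x z"
        by (rule dir_deriv_expand[symmetric, OF smooth_on_differentiable[OF smooth_mean x]])
      finally show "g x (\<Sum>b\<in>Basis. dir_deriv mean x b *\<^sub>R E b) z = g x (grad mean x) z"
        by (simp only: g_T[OF x])
    qed
    then have "A x (grad mean x) = A x (\<Sum>b\<in>Basis. dir_deriv mean x b *\<^sub>R E b)" by (simp only:)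
    then show ?thesis by (simp add: linear_sum[OF linear_A[OF x]] linear_scale[OF linear_A[OF x]])
  qed
  have T2: "(\<Sum>b\<in>Basis. dir_deriv mean x (E b) *\<^sub>R A x b) = A x (grad mean x)"
    unfolding linear_expand[OF linear_A[OF x], of "grad mean x"]
    by (rule sum.cong[OF refl]) (simp add: g_T[OF x, symmetric] sym[of "grad mean x"] gE)
  have "metric_trace g x (nabla_sq g hyp_metric f (tension g hyp_metric f) x)
    = (\<Sum>b\<in>Basis. (g x (cov_deriv g (E b) (grad mean) x) b - mean x * g x (A x (E b)) (A x b)) *\<^sub>R \<eta> x
      - dir_deriv f x (dir_deriv mean x b *\<^sub>R A x (E b) + dir_deriv mean x (E b) *\<^sub>R A x b
          + mean x *\<^sub>R (cov_deriv g (E b) (\<lambda>y. A y b) x - A x (christoffel g x (E b) b))))"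
    by (simp only: metric_trace_def nabla_sq_tension[OF x] E_def)
  also have "\<dots> = (\<Sum>b\<in>Basis. g x (cov_deriv g (E b) (grad mean) x) b - mean x * g x (A x (E b)) (A x b)) *\<^sub>R \<eta> x
      - dir_deriv f x (\<Sum>b\<in>Basis. dir_deriv mean x b *\<^sub>R A x (E b) + dir_deriv mean x (E b) *\<^sub>R A x b
          + mean x *\<^sub>R (cov_deriv g (E b) (\<lambda>y. A y b) x - A x (christoffel g x (E b) b)))"
    by (simp only: sum_subtractf l(1) scaleR_sum_left scaleR_diff_left o_def)
  also have "(\<Sum>b\<in>Basis. g x (cov_deriv g (E b) (grad mean) x) b - mean x * g x (A x (E b)) (A x b))
      = tr (\<lambda>u. cov_deriv g u (grad mean) x) - mean x * sq_norm_A x"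
    by (simp only: sum_subtractf sum_distrib_left[symmetric] hess sq)
  also have "(\<Sum>b\<in>Basis. dir_deriv mean x b *\<^sub>R A x (E b) + dir_deriv mean x (E b) *\<^sub>R A x b
          + mean x *\<^sub>R (cov_deriv g (E b) (\<lambda>y. A y b) x - A x (christoffel g x (E b) b)))
      = A x (grad mean x) + A x (grad mean x) + mean x *\<^sub>R grad mean x"
    by (simp only: sum.distrib scaleR_sum_right[symmetric] T1 T2 divergence_A[OF x, folded E_def])
  finally show ?thesis by (simp only: scaleR_2)
qed

text \<open>The tension field is normal, so R(df(u), \<tau>) df(v) reduces to \<langle>u, v\<rangle>
  \<tau>, whose trace is m \<tau>.\<close>

lemma bitension_eq:
  assumes x: "x \<in> S"
  shows "bitension g hyp_metric f x
    = dir_deriv f x (- (2 *\<^sub>R A x (grad mean x) + mean x *\<^sub>R grad mean x))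
      + (tr (\<lambda>u. cov_deriv g u (grad mean) x) - mean x * sq_norm_A x - CARD('m) * mean x) *\<^sub>R \<eta> x"
proof -
  interpret H: inner_form "h x" by (rule form_h[OF x])
  have "metric_trace g x (\<lambda>u v. curvature hyp_metric (f x) (dir_deriv f x u) (tension g hyp_metric f x) (dir_deriv f x v))
      = (CARD('m) * mean x) *\<^sub>R \<eta> x"
    unfolding curvature_hyp_metric[OF f_hyp[OF x]] tension_eq[OF x] metric_trace_def
    by (simp add: H.simps \<eta>_df[OF x] g_eq[symmetric] sharp_inner[of g x, OF form[OF x]] inner_Basis
        sum_constant_scaleR)
  then show ?thesis
    unfolding bitension_def rough_laplacian_def metric_trace_nabla_sq[OF x] linear_neg[OF lin_df[OF x]]
    by (simp add: scaleR_diff_left)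
qed

end

theorem theorem4p2:
  fixes M :: "'a topology"
    and \<A> :: "('a, real ^ 'm) chart set"
    and \<phi> :: "'a \<Rightarrow> (real ^ 'm) \<times> real"
  assumes "hypersurface M \<A> hyp_space \<phi>"
    and "at_most_two_principal_curvatures \<A> hyp_metric \<phi>"
  shows "\<not> proper_biharmonic_map \<A> (induced_metric hyp_metric \<phi>) hyp_metric \<phi>"
proof
  assume proper: "proper_biharmonic_map \<A> (induced_metric hyp_metric \<phi>) hyp_metric \<phi>"
  then obtain c x0 where c: "c \<in> \<A>" and x0: "x0 \<in> chart_image c"
    and nz: "tension (induced_metric hyp_metric \<phi> c) hyp_metric (\<phi> \<circ> chart_inv c) x0 \<noteq> 0"
    unfolding proper_biharmonic_map_def harmonic_map_def by blast
  define f where "f = \<phi> \<circ> chart_inv c"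
  let ?g = "pullback_metric hyp_metric f"
  let ?\<tau> = "tension ?g hyp_metric f"
  have bih: "bitension ?g hyp_metric f x = 0" if "x \<in> chart_image c" for x
    using proper c that
    unfolding proper_biharmonic_map_def biharmonic_map_def induced_metric_def f_def by blast
  have man: "smooth_manifold M \<A>" and imm: "immersion M \<A> hyp_space \<phi>"
    using assms(1) unfolding hypersurface_def by blast+
  have op: "open (chart_image c)" using man c unfolding smooth_manifold_def by blast
  have sub: "fst c \<subseteq> topspace M" using man c unfolding smooth_manifold_def by blast
  interpret I: hyp_immersion "chart_image c" f
  proof (rule hyp_immersion.intro[OF op])
    show "smooth_on f (chart_image c)" and "\<And>x. x \<in> chart_image c \<Longrightarrow> inj (dir_deriv f x)"
      using imm c unfolding immersion_def f_def by blast+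
    show "f x \<in> hyp_space" if "x \<in> chart_image c" for x
      using imm inv_into_into[OF that] sub unfolding immersion_def f_def by auto
  qed
  \<comment> \<open>The argument takes place on this open subset of one chart; it contains
    \<open>x0\<close>, so showing it empty is the contradiction.\<close>
  define S where "S = {x \<in> chart_image c. ?\<tau> x \<noteq> 0}"
  have SC: "S \<subseteq> chart_image c" by (auto simp: S_def)
  have opS: "open S"
    unfolding S_def
    using continuous_open_preimage[OF smooth_on_continuous[OF I.smooth_tension] op, of "- {0}"]
    by (simp add: vimage_def Int_def open_Compl)
  define n where "n x = sqrt (hyp_metric (f x) (?\<tau> x) (?\<tau> x))" for x
  define \<eta> where "\<eta> x = (1 / n x) *\<^sub>R ?\<tau> x" for x
  have n_pos: "hyp_metric (f x) (?\<tau> x) (?\<tau> x) > 0" "n x > 0" if "x \<in> S" for x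
    using inner_form.pos[OF I.form_h] that by (auto simp: S_def n_def)
  interpret S: hyp_immersion S f
    by (rule hyp_immersion.intro[OF opS smooth_on_subset[OF I.smooth_f SC]])
      (use I.f_hyp I.inj_df SC in blast)+
  have smn: "smooth_on n S"
    unfolding n_def
    by (intro smooth_on_sqrt opS S.smooth_h S.smooth_tension n_pos)
  interpret S: hyp_hypersurface S f \<eta>
  proof (rule hyp_hypersurface.intro[OF S.hyp_immersion_axioms hyp_hypersurface_axioms.intro])
    show "smooth_on \<eta> S"
      unfolding \<eta>_def
      by (intro smooth_on_scaleR smooth_on_divide smooth_on_const smn opS S.smooth_tension)
        (use n_pos(2) in force)
    show "unit_normal hyp_metric f x (\<eta> x)" if x: "x \<in> S" for x
    proof -
      interpret H: inner_form "hyp_metric (f x)" by (rule S.form_h[OF x])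
      have "n x * n x = hyp_metric (f x) (?\<tau> x) (?\<tau> x)" using n_pos[OF x] by (simp add: n_def)
      then show ?thesis
        unfolding unit_normal_def using n_pos[OF x] S.tension_normal[OF x]
        by (simp add: \<eta>_def H.simps H.sym[of "dir_deriv f x _"] field_simps)
    qed
  qed
  \<comment> \<open>The tension field is both tr A times \<eta> and its own length times \<eta>, so
    this choice of normal makes tr A positive.\<close>
  have mean: "S.mean x = n x" if x: "x \<in> S" for x
  proof -
    interpret H: inner_form "hyp_metric (f x)" by (rule S.form_h[OF x])
    have "S.mean x *\<^sub>R \<eta> x = n x *\<^sub>R \<eta> x"
      using n_pos(2)[OF x] by (simp add: S.tension_eq[OF x, symmetric]) (simp add: \<eta>_def)
    moreover have "\<eta> x \<noteq> 0" using S.\<eta>_unit[OF x] H.eq_0_iff[of "\<eta> x"] by auto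
    ultimately show ?thesis by simp
  qed
  interpret S: biharmonic_shape_operator S ?g S.A
  proof (rule biharmonic_shape_operator.intro[OF S.hyperbolic_shape_operator_axioms
        biharmonic_shape_operator_axioms.intro])
    fix x assume x: "x \<in> S"
    show "S.mean x > 0" using mean[OF x] n_pos(2)[OF x] by simp
    \<comment> \<open>Zero is written in split form so that uniqueness of the decomposition yields
      the tangential and the normal equation at once.\<close>
    have "bitension ?g hyp_metric f x = dir_deriv f x 0 + 0 *\<^sub>R \<eta> x"
      using bih[of x] x SC linear_0[OF S.lin_df[OF x]] by auto
    note eq = S.tangent_normal_unique[OF x this[unfolded S.bitension_eq[OF x]]]
    show "S.A x (S.grad S.mean x) = (- S.mean x / 2) *\<^sub>R S.grad S.mean x"
    proof -
      have "2 *\<^sub>R S.A x (S.grad S.mean x) = (- S.mean x) *\<^sub>R S.grad S.mean x"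
        using eq(1) unfolding neg_equal_0_iff_equal scaleR_minus_left eq_neg_iff_add_eq_0 .
      then have "(1 / 2) *\<^sub>R (2 *\<^sub>R S.A x (S.grad S.mean x)) = (1 / 2) *\<^sub>R ((- S.mean x) *\<^sub>R S.grad S.mean x)"
        by (simp only:)
      then show ?thesis by simp
    qed
    show "tr (\<lambda>u. cov_deriv ?g u (S.grad S.mean) x) = (CARD('m) + S.sq_norm_A x) * S.mean x"
      using eq(2) by (simp add: algebra_simps)
    have pc: "{k. \<exists>u. u \<noteq> 0 \<and> S.A x u = k *\<^sub>R u} = principal_curvatures hyp_metric f x (\<eta> x)"
      by (simp add: principal_curvatures_def S.A_def)
    have "x \<in> chart_image c" using x SC by blast
    from assms(2)[unfolded at_most_two_principal_curvatures_def, rule_format, OF c this,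
        folded f_def, OF S.unit_normal_\<eta>[OF x]]
    show "finite {k. \<exists>u. u \<noteq> 0 \<and> S.A x u = k *\<^sub>R u}"
      and "card {k. \<exists>u. u \<noteq> 0 \<and> S.A x u = k *\<^sub>R u} \<le> 2"
      unfolding pc by blast+
  qed
  have "x0 \<in> S" using x0 nz by (simp add: S_def f_def induced_metric_def)
  then show False using S.empty by blast
qed

end
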